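(* Suppose $\alpha>-1$ and $\varphi\in H^\infty_1$, i.e. $\varphi$ is an analytic function on the unit disk $\mathbb{D}$ with $\sup_{z\in\mathbb{D}}|\varphi(z)|\le1$. Then the following conditions are equivalent. (a) The operator $E^\alpha_{\overline\varphi}=I-T_\varphi^*T_\varphi$ is compact on $A^2_\alpha$. (b) The function $\varphi$ is a finite Blaschke product. (c) The range of $E^\alpha_{\overline\varphi}$ (on $A^2_\alpha$) equals $A^2_{\alpha-2}$. (d) The range of $E^\alpha_{\overline\varphi}$ (on $A^2_\alpha$) is contained in $A^2_{\alpha-2}$.
   Context: For any real $\gamma$, $A^2_\gamma$ denotes the space of analytic functions $f$ on $\mathbb{D}$ such that $\int_{\mathbb{D}}(1-|z|^2)^{2k+\gamma}|f^{(k)}(z)|^2\,dA(z)<\infty$, where $k$ is any non-negative integer with $2k+\gamma>-1$ (the space does not depend on the choice of $k$) and $dA$ is normalized area measure on $\mathbb{D}$. For $\alpha>-1$, $A^2_\alpha$ is the weighted Bergman space with the inner product of $L^2(\mathbb{D},dA_\alpha)$, where $dA_\alpha(z)=(\alpha+1)(1-|z|^2)^\alpha\,dA(z)$. $T_\varphi$ is multiplication by $\varphi$ on $A^2_\alpha$ (a contraction) and $T_\varphi^*$ is its adjoint on $A^2_\alpha$. A finite Blaschke product is a unimodular constant times a finite product of Möbius maps $\frac{a-z}{1-\overline{a}z}$, $a\in\mathbb{D}$.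
   Formalization: It is additionally assumed that φ is not a constant of modulus 1 on the disk; for such φ the operator E is 0, so (a) and (d) hold while (c) fails. *)

theory Defs
  imports "HOL-Complex_Analysis.Complex_Analysis"
begin

abbreviation unit_disk :: "complex set" where
  "unit_disk \<equiv> ball 0 1"

definition dA :: "complex measure" where
  "dA = uniform_measure lborel unit_disk"

definition dA_weighted :: "real \<Rightarrow> complex measure" where
  "dA_weighted \<alpha> = density dA (\<lambda>z. ennreal ((\<alpha> + 1) * (1 - (cmod z)\<^sup>2) powr \<alpha>))"

text \<open>
  An analytic function on the disk is represented by its extension by \<open>0\<close> to the whole plane, so
  that equality of functions on the disk is equality in HOL. The space does not depend on the
  admissible \<open>k\<close>; since admissible \<open>k\<close> always exist, quantifying over all of them is not vacuous.
  The integral is restricted to the disk because the values of \<open>(deriv ^^ k) f\<close> on the unit circle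
  are unspecified and need not be Borel measurable.
\<close>

definition A2 :: "real \<Rightarrow> (complex \<Rightarrow> complex) set" where
  "A2 \<gamma> = {f. f holomorphic_on unit_disk \<and> (\<forall>z. z \<notin> unit_disk \<longrightarrow> f z = 0) \<and>
     (\<forall>k::nat. 2 * real k + \<gamma> > -1 \<longrightarrow>
        set_integrable dA unit_disk
          (\<lambda>z. (1 - (cmod z)\<^sup>2) powr (2 * real k + \<gamma>) * (cmod ((deriv ^^ k) f z))\<^sup>2))}"

definition A2_inner :: "real \<Rightarrow> (complex \<Rightarrow> complex) \<Rightarrow> (complex \<Rightarrow> complex) \<Rightarrow> complex" where
  "A2_inner \<alpha> f g = (\<integral>z. f z * cnj (g z) \<partial>dA_weighted \<alpha>)"

definition A2_norm :: "real \<Rightarrow> (complex \<Rightarrow> complex) \<Rightarrow> real" where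
  "A2_norm \<alpha> f = sqrt (Re (A2_inner \<alpha> f f))"

definition A2_topology :: "real \<Rightarrow> (complex \<Rightarrow> complex) topology" where
  "A2_topology \<alpha> = Metric_space.mtopology (A2 \<alpha>) (\<lambda>f g. A2_norm \<alpha> (\<lambda>z. f z - g z))"

text \<open>
  The adjoint on the Hilbert space \<open>A2 \<alpha>\<close> (for \<open>\<alpha> > -1\<close>); for a bounded linear \<open>T\<close> the function
  described exists and is unique.
\<close>

definition A2_adjoint ::
    "real \<Rightarrow> ((complex \<Rightarrow> complex) \<Rightarrow> complex \<Rightarrow> complex) \<Rightarrow> (complex \<Rightarrow> complex) \<Rightarrow> complex \<Rightarrow> complex" where
  "A2_adjoint \<alpha> T g =
     (THE h. h \<in> A2 \<alpha> \<and> (\<forall>f\<in>A2 \<alpha>. A2_inner \<alpha> (T f) g = A2_inner \<alpha> f h))"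

definition A2_compact_operator ::
    "real \<Rightarrow> ((complex \<Rightarrow> complex) \<Rightarrow> complex \<Rightarrow> complex) \<Rightarrow> bool" where
  "A2_compact_operator \<alpha> T \<longleftrightarrow>
     T ` A2 \<alpha> \<subseteq> A2 \<alpha> \<and>
     compactin (A2_topology \<alpha>) (A2_topology \<alpha> closure_of (T ` {f \<in> A2 \<alpha>. A2_norm \<alpha> f \<le> 1}))"

definition Hinf1 :: "(complex \<Rightarrow> complex) set" where
  "Hinf1 = {\<phi>. \<phi> holomorphic_on unit_disk \<and> (\<forall>z\<in>unit_disk. cmod (\<phi> z) \<le> 1)}"

definition T_op :: "(complex \<Rightarrow> complex) \<Rightarrow> (complex \<Rightarrow> complex) \<Rightarrow> complex \<Rightarrow> complex" where
  "T_op \<phi> f = (\<lambda>z. \<phi> z * f z)"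

definition E_bar_op ::
    "real \<Rightarrow> (complex \<Rightarrow> complex) \<Rightarrow> (complex \<Rightarrow> complex) \<Rightarrow> complex \<Rightarrow> complex" where
  "E_bar_op \<alpha> \<phi> f = (\<lambda>z. f z - A2_adjoint \<alpha> (T_op \<phi>) (T_op \<phi> f) z)"

definition finite_Blaschke_product :: "(complex \<Rightarrow> complex) \<Rightarrow> bool" where
  "finite_Blaschke_product \<phi> \<longleftrightarrow>
     (\<exists>c as. cmod c = 1 \<and> set as \<subseteq> unit_disk \<and>
        (\<forall>z\<in>unit_disk. \<phi> z = c * (\<Prod>a\<leftarrow>as. (a - z) / (1 - cnj a * z))))"

end

theory Submission imports Defs begin

text \<open>
  Everything is expressed in Taylor coefficients: \<open>z \<mapsto> z\<^sup>n\<close> is an orthogonal system for every radial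
  weight, so \<open>A2 \<gamma>\<close> is a weighted sequence space, and \<open>A2 (\<alpha> - 2)\<close> is the domain of
  \<open>L f = z f' + (\<alpha> + 2) f\<close> in \<open>A2 \<alpha>\<close>. The operator \<open>E\<close> is \<open>f \<mapsto> P ((1 - |\<phi>|\<^sup>2) f)\<close> with the Bergman
  projection \<open>P\<close>.

  If \<open>\<phi>\<close> is not a finite Blaschke product, then \<open>|\<phi>| \<le> r < 1\<close> along a sequence tending to the circle, and
  the normalized reproducing kernels at these points satisfy \<open>\<langle>E k, k\<rangle> \<ge> \<delta>\<close> although they are weakly
  null; this contradicts compactness directly, and the range inclusion by a gliding hump.

  If \<open>\<phi>\<close> is a nonconstant finite Blaschke product, then \<open>1 - |\<phi>|\<^sup>2 = (1 - |z|\<^sup>2) \<Sum>\<^sub>j |e\<^sub>j|\<^sup>2\<close> with \<open>e\<^sub>j\<close>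
  analytic across the circle. Since \<open>\<langle>(1 - |z|\<^sup>2) u, L v\<rangle> = (\<alpha> + 1) \<langle>u, v\<rangle>\<close>, commuting \<open>L\<close> with \<open>e\<^sub>j\<close> gives
  \<open>\<langle>E f, L F\<rangle> = \<Sum>\<^sub>j ((\<alpha> + 1) \<langle>e\<^sub>j f, e\<^sub>j F\<rangle> - \<langle>(1 - |z|\<^sup>2) e\<^sub>j f, z e\<^sub>j' F\<rangle>)\<close>.
  Bounding the right-hand side shows that \<open>L E\<close> is bounded on \<open>A2 \<alpha>\<close>, whence compactness; taking
  \<open>f = F\<close> bounds \<open>\<parallel>F\<parallel>\<close> for the Galerkin solutions of \<open>E F = g\<close>, whose weak limit solves the equation.
\<close>

section \<open>Radial integrals over the disk\<close>

text \<open>The factor \<open>n + p + 2\<close> by which L acts on \<open>z ^ n\<close> is, up to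
  the constant \<open>p + 2\<close>, the ratio of the squared norms of \<open>z ^ n\<close> in the
  weights p and p + 1. This is why L undoes the multiplication by 1 - |z|^2. Being diagonal with
  real entries, L is symmetric, has a compact inverse and maps polynomials of degree below N to such
  polynomials. The obstacle to solving E F = g is that the form of E degenerates at the circle: it
  is coercive only in the weaker norm of weight p + 1, so no bound in \<open>A2 p\<close> follows
  from testing with F alone. Testing with L F restores coercivity in \<open>A2 p\<close>, up to a
  commutator term which again carries 1 - |z|^2 and is controlled by the weaker norm. Galerkin
  spaces of polynomials allow both tests, since L F stays in the space of F. In the other direction,
  if E f lies in \<open>A2 (p - 2)\<close>, then its pairing with a kernel k equals that of L E f
  with the inverse image of k under L, and compactness of that inverse makes the latter small. The
  bound depends on f, so a single bad f has to be built.\<close>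

lemma lborel_complex_eq_distr:
  "(lborel :: complex measure) = distr (lborel \<Otimes>\<^sub>M lborel) borel (\<lambda>p. Complex (fst p) (snd p))"
proof (rule lborel_eqI)
  have [measurable]: "(\<lambda>p::real\<times>real. Complex (fst p) (snd p)) \<in> borel_measurable (lborel \<Otimes>\<^sub>M lborel)"
    by (auto simp: borel_measurable_complex_iff)
  fix l u :: complex
  assume le: "\<And>b. b \<in> Basis \<Longrightarrow> l \<bullet> b \<le> u \<bullet> b"
  have lu: "Re l \<le> Re u" "Im l \<le> Im u"
    using le[of 1] le[of \<i>] by (auto simp: Basis_complex_def)
  have "(\<lambda>p::real\<times>real. Complex (fst p) (snd p)) -` box l u \<inter> space (lborel \<Otimes>\<^sub>M lborel)
        = {Re l<..<Re u} \<times> {Im l<..<Im u}"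
    by (auto simp: in_box_complex_iff space_pair_measure)
  then show "emeasure (distr (lborel \<Otimes>\<^sub>M lborel) borel (\<lambda>p. Complex (fst p) (snd p))) (box l u)
      = ennreal (\<Prod>b\<in>Basis. (u - l) \<bullet> b)"
    using lu by (simp add: emeasure_distr lborel.emeasure_pair_measure_Times Basis_complex_def ennreal_mult)
qed simp

lemma nn_integral_lborel_complex:
  assumes [measurable]: "f \<in> borel_measurable borel"
  shows "(\<integral>\<^sup>+z. f z \<partial>(lborel :: complex measure)) = (\<integral>\<^sup>+x. \<integral>\<^sup>+y. f (Complex x y) \<partial>lborel \<partial>lborel)"
    and "(\<integral>\<^sup>+z. f z \<partial>(lborel :: complex measure)) = (\<integral>\<^sup>+y. \<integral>\<^sup>+x. f (Complex x y) \<partial>lborel \<partial>lborel)"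
proof -
  have m [measurable]: "(\<lambda>p::real\<times>real. Complex (fst p) (snd p)) \<in> borel_measurable (lborel \<Otimes>\<^sub>M lborel)"
    by (auto simp: borel_measurable_complex_iff)
  have eq: "(\<integral>\<^sup>+z. f z \<partial>(lborel :: complex measure))
      = (\<integral>\<^sup>+p. f (Complex (fst p) (snd p)) \<partial>(lborel \<Otimes>\<^sub>M lborel))"
    by (subst lborel_complex_eq_distr) (simp add: nn_integral_distr)
  show "(\<integral>\<^sup>+z. f z \<partial>(lborel :: complex measure)) = (\<integral>\<^sup>+x. \<integral>\<^sup>+y. f (Complex x y) \<partial>lborel \<partial>lborel)"
    unfolding eq by (subst lborel.nn_integral_fst[symmetric]) auto
  show "(\<integral>\<^sup>+z. f z \<partial>(lborel :: complex measure)) = (\<integral>\<^sup>+y. \<integral>\<^sup>+x. f (Complex x y) \<partial>lborel \<partial>lborel)"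
    unfolding eq by (subst lborel_pair.nn_integral_snd[symmetric]) auto
qed

text \<open>Integrating first in the sheared coordinate, with the other one fixed, leaves a
  translation of the real line.\<close>

lemma nn_integral_lborel_shear:
  assumes [measurable]: "f \<in> borel_measurable borel"
  shows "(\<integral>\<^sup>+z. f (Complex (Re z + t * Im z) (Im z)) \<partial>lborel) = (\<integral>\<^sup>+z. f z \<partial>(lborel :: complex measure))"
    and "(\<integral>\<^sup>+z. f (Complex (Re z) (Im z + t * Re z)) \<partial>lborel) = (\<integral>\<^sup>+z. f z \<partial>(lborel :: complex measure))"
proof -
  have [measurable]: "(\<lambda>z. Complex (Re z + t * Im z) (Im z)) \<in> borel_measurable borel"
     "(\<lambda>z. Complex (Re z) (Im z + t * Re z)) \<in> borel_measurable borel"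
     "\<And>y. (\<lambda>x. Complex x y) \<in> borel_measurable borel" "\<And>x. Complex x \<in> borel_measurable borel"
    by (auto simp: borel_measurable_complex_iff)
  have sh: "(\<integral>\<^sup>+x. g (x + s) \<partial>lborel) = (\<integral>\<^sup>+x. g x \<partial>lborel)" 
    if [measurable]: "g \<in> borel_measurable borel" for g :: "real \<Rightarrow> ennreal" and s
    using nn_integral_real_affine[of g 1 s] by (simp add: add.commute)
  show "(\<integral>\<^sup>+z. f (Complex (Re z + t * Im z) (Im z)) \<partial>lborel) = (\<integral>\<^sup>+z. f z \<partial>(lborel :: complex measure))"
    by (simp add: nn_integral_lborel_complex(2) sh[of "\<lambda>x. f (Complex x _)"])
  show "(\<integral>\<^sup>+z. f (Complex (Re z) (Im z + t * Re z)) \<partial>lborel) = (\<integral>\<^sup>+z. f z \<partial>(lborel :: complex measure))"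
    by (simp add: nn_integral_lborel_complex(1) sh[of "\<lambda>y. f (Complex _ y)"])
qed

text \<open>A rotation by an angle \<open>\<theta>\<close> with \<open>sin \<theta> \<noteq> 0\<close> is a product of three shears.\<close>

lemma nn_integral_lborel_rotate:
  assumes f [measurable]: "f \<in> borel_measurable borel" and "sin \<theta> \<noteq> 0"
  shows "(\<integral>\<^sup>+z. f (cis \<theta> * z) \<partial>lborel) = (\<integral>\<^sup>+z. f z \<partial>(lborel :: complex measure))"
proof -
  \<comment> \<open>This is \<open>- tan (\<theta> / 2)\<close>, the parameter for which the outer
    two shears and the middle one with \<open>sin \<theta>\<close> compose to the rotation.\<close>
  define t where "t = (cos \<theta> - 1) / sin \<theta>"
  have [measurable]: "(\<lambda>z. Complex (Re z + t * Im z) (Im z)) \<in> borel_measurable borel"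
     "(\<lambda>z. Complex (Re z) (Im z + sin \<theta> * Re z)) \<in> borel_measurable borel"
    by (auto simp: borel_measurable_complex_iff)
  let ?A = "\<lambda>z. Complex (Re z + t * Im z) (Im z)"
  let ?B = "\<lambda>z. Complex (Re z) (Im z + sin \<theta> * Re z)"
  have s: "sin \<theta> * t = cos \<theta> - 1" "t * (x * sin \<theta>) = (cos \<theta> - 1) * x" for x
    using assms by (auto simp: t_def)
  have tt: "t + t * cos \<theta> = - sin \<theta>"
  proof -
    have "t + t * cos \<theta> = ((cos \<theta>)\<^sup>2 - 1) / sin \<theta>"
      by (simp add: t_def power2_eq_square field_simps diff_divide_distrib)
    also have "\<dots> = - sin \<theta>"
      using assms sin_cos_squared_add[of \<theta>] by (simp add: field_simps power2_eq_square)
    finally show ?thesis .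
  qed
  have rot: "?A (?B (?A z)) = cis \<theta> * z" for z
  proof (rule complex_eqI)
    have "Re (?A (?B (?A z))) = Re z * (1 + sin \<theta> * t) + Im z * (t + t * (1 + sin \<theta> * t))"
      by (simp add: algebra_simps)
    also have "\<dots> = Re z * cos \<theta> + Im z * (t + t * cos \<theta>)"
      by (simp add: s)
    finally show "Re (?A (?B (?A z))) = Re (cis \<theta> * z)"
      by (simp add: tt algebra_simps)
    have "Im (?A (?B (?A z))) = Im z * (1 + sin \<theta> * t) + sin \<theta> * Re z"
      by (simp add: algebra_simps)
    then show "Im (?A (?B (?A z))) = Im (cis \<theta> * z)"
      by (simp add: s algebra_simps)
  qed
  have "(\<integral>\<^sup>+z. f (cis \<theta> * z) \<partial>lborel) = (\<integral>\<^sup>+z. f (?A (?B (?A z))) \<partial>lborel)"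
    by (simp only: rot)
  also have "\<dots> = (\<integral>\<^sup>+z. f (?A (?B z)) \<partial>lborel)"
    by (rule nn_integral_lborel_shear(1)[where f="\<lambda>z. f (?A (?B z))"]) measurable
  also have "\<dots> = (\<integral>\<^sup>+z. f (?A z) \<partial>lborel)"
    by (rule nn_integral_lborel_shear(2)[where f="\<lambda>z. f (?A z)"]) measurable
  also have "\<dots> = (\<integral>\<^sup>+z. f z \<partial>lborel)"
    by (rule nn_integral_lborel_shear(1)) measurable
  finally show ?thesis .
qed

lemma distr_lborel_rotate:
  assumes "sin \<theta> \<noteq> 0"
  shows "distr lborel borel (\<lambda>z. cis \<theta> * z) = (lborel :: complex measure)"
proof (rule measure_eqI)
  fix A :: "complex set" assume "A \<in> sets (distr lborel borel (\<lambda>z. cis \<theta> * z))"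
  then have [measurable]: "A \<in> sets borel" by simp
  have "(\<integral>\<^sup>+z. indicator A (cis \<theta> * z) \<partial>lborel) = (\<integral>\<^sup>+z. indicator A z \<partial>(lborel :: complex measure))"
    by (rule nn_integral_lborel_rotate) (use assms in auto)
  also have "(\<integral>\<^sup>+z. indicator A (cis \<theta> * z) \<partial>lborel) = (\<integral>\<^sup>+z. indicator A z \<partial>distr lborel borel (\<lambda>z. cis \<theta> * z))"
    by (subst nn_integral_distr) auto
  finally show "emeasure (distr lborel borel (\<lambda>z. cis \<theta> * z)) A = emeasure lborel A"
    by simp
qed simp

text \<open>The disk given by |z|^2 < x has area pi x, and half-lines generate the Borel sets. With
  |z|^2 as the variable, radial integrals reduce to the line without polar coordinates.\<close>

lemma distr_lborel_norm_square:
  "distr (lborel :: complex measure) borel (\<lambda>z. (cmod z)\<^sup>2) = density lborel (\<lambda>t. ennreal pi * indicator {0<..} t)"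
proof -
  let ?L = "distr (lborel :: complex measure) borel (\<lambda>z. (cmod z)\<^sup>2)"
  let ?R = "density lborel (\<lambda>t::real. ennreal pi * indicator {0<..} t)"
  let ?E = "range (\<lambda>x::real. {..<x})"
  have em: "emeasure ?L {..<x} = ennreal (pi * max 0 x)" "emeasure ?R {..<x} = ennreal (pi * max 0 x)" for x
  proof -
    have "(cmod z)\<^sup>2 < x \<longleftrightarrow> cmod z < sqrt (max 0 x)" for z
    proof -
      have "(cmod z)\<^sup>2 < x \<longleftrightarrow> (cmod z)\<^sup>2 < max 0 x"
      proof (cases "0 \<le> x")
        case False
        then have "\<not> (cmod z)\<^sup>2 < x" "max 0 x = 0"
          using zero_le_power2[of "cmod z"] by linarith+
        then show ?thesis by simp
      qed (simp add: max_def)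
      also have "\<dots> \<longleftrightarrow> sqrt ((cmod z)\<^sup>2) < sqrt (max 0 x)"
        by (rule real_sqrt_less_iff[symmetric])
      finally show ?thesis by simp
    qed
    then have "(\<lambda>z::complex. (cmod z)\<^sup>2) -` {..<x} = ball 0 (sqrt (max 0 x))"
      by auto
    then show "emeasure ?L {..<x} = ennreal (pi * max 0 x)"
      by (simp add: emeasure_distr emeasure_ball unit_ball_vol_2)
    have "emeasure ?R {..<x} = (\<integral>\<^sup>+t. ennreal pi * indicator {0<..<x} t \<partial>lborel)"
      by (subst emeasure_density) (auto intro!: nn_integral_cong split: split_indicator)
    also have "\<dots> = ennreal pi * emeasure lborel {0<..<x}"
      by (subst nn_integral_cmult_indicator) auto
    also have "\<dots> = ennreal (pi * max 0 x)"
      by (cases "0 \<le> x") (auto simp: ennreal_mult max_def)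
    finally show "emeasure ?R {..<x} = ennreal (pi * max 0 x)" .
  qed
  show ?thesis
  proof (rule measure_eqI_generator_eq[where E="?E" and \<Omega>=UNIV and A="\<lambda>n. {..<real n}"])
    show "Int_stable ?E"
    proof (clarsimp simp: Int_stable_def)
      fix a b :: real
      have "{..<a} \<inter> {..<b} = {..<min a b}" by auto
      then show "{..<a} \<inter> {..<b} \<in> ?E" by blast
    qed
    show "sets ?L = sigma_sets UNIV ?E" "sets ?R = sigma_sets UNIV ?E"
      by (simp_all add: borel_Iio)
    show "(\<Union>i. {..<real i}) = UNIV"
      using reals_Archimedean2 by auto
  qed (auto simp: em)
qed


section \<open>The weighted area measure as a Lebesgue density and its moments\<close>

lemma ball_measurable [measurable]: "ball a r \<in> sets (borel :: 'a::metric_space measure)"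
  by simp

lemma cnj_measurable [measurable]: "cnj \<in> borel_measurable borel"
  by (intro borel_measurable_continuous_onI continuous_intros)

lemma emeasure_unit_disk: "emeasure lborel unit_disk = ennreal pi"
  by (simp add: emeasure_ball unit_ball_vol_2)

lemma dA_eq_density: "dA = density lborel (\<lambda>z. ennreal (indicat_real unit_disk z / pi))"
  unfolding dA_def uniform_measure_def emeasure_unit_disk
  by (intro arg_cong[where f="density lborel"] ext)
     (auto split: split_indicator simp: divide_ennreal[symmetric])

text \<open>The density of \<open>dA_weighted p\<close> with respect to Lebesgue measure, through
  which rotation invariance and the push-forward under |z|^2 reach the weighted measures.\<close>

definition bergman_density :: "real \<Rightarrow> complex \<Rightarrow> real" where
  "bergman_density p z = indicat_real unit_disk z * ((p + 1) * (1 - (cmod z)\<^sup>2) powr p) / pi"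

lemma bergman_density_nonneg: "p > -1 \<Longrightarrow> 0 \<le> bergman_density p z"
  by (simp add: bergman_density_def)

lemma bergman_density_measurable [measurable]: "bergman_density p \<in> borel_measurable borel"
  unfolding bergman_density_def by measurable

lemma dA_weighted_eq_density:
  assumes "p > -1"
  shows "dA_weighted p = density lborel (\<lambda>z. ennreal (bergman_density p z))"
  unfolding dA_weighted_def dA_eq_density
  by (subst density_density_eq)
     (use assms in \<open>auto intro!: arg_cong[where f="density lborel"] ext
        simp: bergman_density_def ennreal_mult[symmetric] split: split_indicator\<close>)

lemma sets_dA_weighted [measurable_cong, simp]: "sets (dA_weighted p) = sets borel"
  by (simp add: dA_weighted_def dA_def)

lemma space_dA_weighted [simp]: "space (dA_weighted p) = UNIV"
  by (simp add: dA_weighted_def dA_def)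

lemma AE_dA_weighted:
  assumes "p > -1"
  shows "AE z in dA_weighted p. z \<in> unit_disk"
  unfolding dA_weighted_eq_density[OF assms]
  by (subst AE_density) (auto simp: bergman_density_def split: split_indicator)

text \<open>A suitable rotation multiplies the integrand by \<i> and preserves the measure, so the
  integral equals \<i> times itself. Both steps hold for non-integrable functions as well, so no
  integrability is assumed.\<close>

lemma integral_radial_monomials:
  fixes h :: "real \<Rightarrow> real"
  assumes [measurable]: "h \<in> borel_measurable borel" and "m \<noteq> n"
  shows "(\<integral>z. h (cmod z) *\<^sub>R (z ^ m * cnj (z ^ n)) \<partial>lborel) = 0"
proof -
  \<comment> \<open>Chosen so that \<open>(m - n) * \<theta>\<close> is a quarter turn. A half turn
    would give \<theta> = pi when m and n are neighbours, where the sine vanishes and the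
    decomposition into shears breaks down.\<close>
  define \<theta> where "\<theta> = pi / 2 / (real m - real n)"
  have ab: "\<bar>\<theta>\<bar> \<le> pi / 2" "\<theta> \<noteq> 0"
  proof -
    have "1 \<le> \<bar>real m - real n\<bar>"
      using \<open>m \<noteq> n\<close> by linarith
    then have "pi / 2 / \<bar>real m - real n\<bar> \<le> pi / 2 / 1"
      by (intro divide_left_mono) auto
    then show "\<bar>\<theta>\<bar> \<le> pi / 2"
      by (simp only: \<theta>_def abs_divide) simp
    show "\<theta> \<noteq> 0"
      using \<open>m \<noteq> n\<close> by (simp add: \<theta>_def)
  qed
  have "sin \<theta> \<noteq> 0"
  proof
    assume "sin \<theta> = 0"
    moreover have "0 < sin \<bar>\<theta>\<bar>"
      using ab pi_gt_zero by (intro sin_gt_zero) auto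
    ultimately show False by (cases "\<theta> \<ge> 0") auto
  qed
  let ?F = "\<lambda>z. h (cmod z) *\<^sub>R (z ^ m * cnj (z ^ n))"
  have "(\<integral>z. ?F z \<partial>lborel) = (\<integral>z. ?F z \<partial>distr lborel borel (\<lambda>z. cis \<theta> * z))"
    by (simp add: distr_lborel_rotate[OF \<open>sin \<theta> \<noteq> 0\<close>])
  also have "\<dots> = (\<integral>z. ?F (cis \<theta> * z) \<partial>lborel)"
    by (subst integral_distr) auto
  also have "\<dots> = (\<integral>z. \<i> * ?F z \<partial>lborel)"
  proof (rule Bochner_Integration.integral_cong)
    fix z
    have "cis \<theta> ^ m * cnj (cis \<theta> ^ n) = cis (real m * \<theta>) * cis (- (real n * \<theta>))"
      unfolding complex_cnj_power cis_cnj by (simp only: Complex.DeMoivre) (simp add: cis_cnj)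
    also have "\<dots> = cis ((real m - real n) * \<theta>)"
      by (simp add: cis_mult algebra_simps)
    also have "(real m - real n) * \<theta> = pi / 2"
    proof -
      have "real m - real n \<noteq> 0"
        using \<open>m \<noteq> n\<close> by simp
      then show ?thesis
        unfolding \<theta>_def by (metis nonzero_mult_div_cancel_left times_divide_eq_right)
    qed
    finally have "cis \<theta> ^ m * cnj (cis \<theta> ^ n) = \<i>" by simp
    moreover have "?F (cis \<theta> * z) = (cis \<theta> ^ m * cnj (cis \<theta> ^ n)) * ?F z"
      by (simp add: norm_mult power_mult_distrib scaleR_conv_of_real)
    ultimately show "?F (cis \<theta> * z) = \<i> * ?F z" by simp
  qed simp
  also have "\<dots> = \<i> * (\<integral>z. ?F z \<partial>lborel)"
    by (rule integral_mult_right_zero)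
  finally have "(1 - \<i>) * (\<integral>z. ?F z \<partial>lborel) = 0"
    unfolding left_diff_distrib mult_1_left by (rule right_minus_eq[THEN iffD2])
  then show ?thesis
    by (auto simp: complex_eq_iff)
qed

text \<open>The squared norm of \<open>z ^ n\<close> in \<open>dA_weighted p\<close>, that is n!
  Gamma(p + 2) / Gamma(n + p + 2). In Pochhammer form its recurrences in n and in p are plain
  algebra.\<close>

definition bergman_weight :: "real \<Rightarrow> nat \<Rightarrow> real" where
  "bergman_weight p n = fact n / pochhammer (p + 2) n"

lemma bergman_weight_pos: "p > -1 \<Longrightarrow> bergman_weight p n > 0"
  by (simp add: bergman_weight_def pochhammer_pos)

lemma bergman_weight_Suc:
  "p > -1 \<Longrightarrow> bergman_weight p (Suc n) = bergman_weight p n * (real n + 1) / (real n + p + 2)"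
  by (simp add: bergman_weight_def pochhammer_Suc field_simps)

text \<open>The coefficient form of the link between 1 - |z|^2 and L: lowering the weight from p + 1
  to p costs exactly the eigenvalue \<open>n + p + 2\<close> of L on \<open>z ^ n\<close>.\<close>

lemma bergman_weight_plus1:
  assumes "p > -1"
  shows "bergman_weight (p + 1) n * (real n + p + 2) = bergman_weight p n * (p + 2)"
proof -
  have "pochhammer (p + 2) n * (p + 2 + real n) = (p + 2) * pochhammer (p + 3) n"
    using pochhammer_Suc[of "p + 2" n] pochhammer_rec[of "p + 2" n] by (simp add: add.commute)
  moreover have "pochhammer (p + 2) n > 0" "pochhammer (p + 3) n > 0"
    using assms by (auto intro!: pochhammer_pos)
  moreover have "pochhammer (p + 1 + 2) n = pochhammer (p + 3) n"
    by (simp add: add.commute add.left_commute)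
  ultimately show ?thesis
    by (simp add: bergman_weight_def divide_simps) (simp add: mult.commute add.commute add.left_commute)
qed

text \<open>With t = |z|^2 the integral becomes (p + 1) Beta(n + 1, p + 1).\<close>

lemma nn_integral_norm_power_dA_weighted:
  assumes p: "p > -1"
  shows "(\<integral>\<^sup>+z. ennreal ((cmod z)^(2*n)) \<partial>dA_weighted p) = ennreal (bergman_weight p n)"
proof -
  define h where "h t = indicat_real {..<1} t * ((p + 1) * (1 - t) powr p) / pi * t ^ n" for t
  have [measurable]: "h \<in> borel_measurable borel"
    unfolding h_def by measurable
  have "(\<integral>\<^sup>+z. ennreal ((cmod z)^(2*n)) \<partial>dA_weighted p) = (\<integral>\<^sup>+z. ennreal (h ((cmod z)\<^sup>2)) \<partial>lborel)"
    unfolding dA_weighted_eq_density[OF p]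
    by (subst nn_integral_density)
       (use p in \<open>auto simp: ennreal_mult[symmetric] bergman_density_nonneg h_def bergman_density_def
          power_mult abs_square_less_1 split: split_indicator intro!: nn_integral_cong\<close>)
  also have "\<dots> = (\<integral>\<^sup>+t. ennreal (h t) \<partial>distr (lborel :: complex measure) borel (\<lambda>z. (cmod z)\<^sup>2))"
    by (subst nn_integral_distr) auto
  also have "\<dots> = (\<integral>\<^sup>+t. ennreal ((p + 1) * (t powr (real (n + 1) - 1) * (1 - t) powr ((p + 1) - 1)) * indicator {0<..<1} t) \<partial>lborel)"
    unfolding distr_lborel_norm_square
    by (subst nn_integral_density)
       (use p in \<open>auto intro!: nn_integral_cong simp: h_def powr_realpow ennreal_mult[symmetric] split: split_indicator\<close>)
  also have "\<dots> = ennreal ((p + 1) * Beta (real (n + 1)) (p + 1))"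
  proof (rule nn_integral_has_integral_lborel)
    have "((\<lambda>t. (p + 1) * (t powr (real (n + 1) - 1) * (1 - t) powr (p + 1 - 1))) has_integral
       (p + 1) * Beta (real (n + 1)) (p + 1)) {0<..<1}"
      using has_integral_Beta_real[of "real (n + 1)" "p + 1"] p
      by (intro has_integral_mult_right) (simp_all add: has_integral_Icc_iff_Ioo)
    then have "((\<lambda>t. if t \<in> {0<..<1} then (p + 1) * (t powr (real (n + 1) - 1) * (1 - t) powr (p + 1 - 1)) else 0) has_integral
       (p + 1) * Beta (real (n + 1)) (p + 1)) UNIV"
      by (simp only: has_integral_restrict_UNIV)
    then show "((\<lambda>t. (p + 1) * (t powr (real (n + 1) - 1) * (1 - t) powr (p + 1 - 1)) * indicat_real {0<..<1} t) has_integral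
       (p + 1) * Beta (real (n + 1)) (p + 1)) UNIV"
      by (rule has_integral_eq[rotated]) auto
  qed (use p in \<open>auto split: split_indicator\<close>)
  also have "(p + 1) * Beta (real (n + 1)) (p + 1) = bergman_weight p n"
  proof -
    have nz: "p + 1 \<notin> \<int>\<^sub>\<le>\<^sub>0" "p + 2 \<notin> \<int>\<^sub>\<le>\<^sub>0"
      using p by (auto dest: nonpos_Ints_nonpos)
    have g2: "Gamma (p + 2) = (p + 1) * Gamma (p + 1)"
      using Gamma_plus1[OF nz(1)] by (simp add: add.commute)
    have "Gamma (real (n + 1)) = fact n"
      using Gamma_fact[of n, where ?'a = real] by (simp add: add.commute)
    moreover have "bergman_weight p n = fact n * Gamma (p + 2) / Gamma (p + 2 + real n)"
      by (simp only: bergman_weight_def pochhammer_Gamma[OF nz(2)] divide_divide_eq_right)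
    moreover have "real (n + 1) + (p + 1) = p + 2 + real n"
      by simp
    ultimately show ?thesis
      by (simp only: Beta_def g2) simp
  qed
  finally show ?thesis .
qed

section \<open>Taylor coefficients and the norm identity\<close>

lemma finite_measure_dA_weighted: "p > -1 \<Longrightarrow> finite_measure (dA_weighted p)"
  using nn_integral_norm_power_dA_weighted[of p 0]
  by (intro finite_measureI) (simp add: bergman_weight_def)

definition disk_fun :: "(complex \<Rightarrow> complex) \<Rightarrow> bool" where
  "disk_fun f \<longleftrightarrow> f holomorphic_on unit_disk \<and> (\<forall>z. z \<notin> unit_disk \<longrightarrow> f z = 0)"

definition disk_restrict :: "(complex \<Rightarrow> complex) \<Rightarrow> complex \<Rightarrow> complex" where
  "disk_restrict f z = (if z \<in> unit_disk then f z else 0)"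

definition taylor_coeff :: "(complex \<Rightarrow> complex) \<Rightarrow> nat \<Rightarrow> complex" where
  "taylor_coeff f n = (deriv ^^ n) f 0 / fact n"

lemma disk_fun_disk_restrict: "f holomorphic_on unit_disk \<Longrightarrow> disk_fun (disk_restrict f)"
  by (auto simp: disk_fun_def disk_restrict_def intro: holomorphic_transform)

lemma disk_fun_measurable: "disk_fun f \<Longrightarrow> f \<in> borel_measurable borel"
proof -
  assume f: "disk_fun f"
  then have "(\<lambda>z. indicator unit_disk z *\<^sub>R f z) \<in> borel_measurable borel"
    by (intro borel_measurable_continuous_on_indicator holomorphic_on_imp_continuous_on)
       (auto simp: disk_fun_def)
  moreover have "(\<lambda>z. indicator unit_disk z *\<^sub>R f z) = f"
    using f by (auto simp: disk_fun_def fun_eq_iff split: split_indicator)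
  ultimately show ?thesis by simp
qed

lemma taylor_coeff_cong: "(\<And>z. z \<in> unit_disk \<Longrightarrow> f z = g z) \<Longrightarrow> taylor_coeff f n = taylor_coeff g n"
  unfolding taylor_coeff_def
  by (subst higher_deriv_cong_ev[of f g 0 0 n]) (auto simp: eventually_nhds intro!: exI[of _ unit_disk])

lemma taylor_coeff_sums:
  assumes "f holomorphic_on unit_disk" "cmod z < 1"
  shows "(\<lambda>n. taylor_coeff f n * z ^ n) sums f z"
  using holomorphic_power_series[of f 0 1 z] assms by (simp add: taylor_coeff_def)

lemma taylor_coeff_abs_summable:
  assumes "f holomorphic_on unit_disk" "0 \<le> r" "r < 1"
  shows "summable (\<lambda>n. cmod (taylor_coeff f n) * r ^ n)"
proof -
  define s where "s = (r + 1) / 2"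
  have s: "r < s" "s < 1" "0 < s" using assms by (auto simp: s_def)
  have "summable (\<lambda>n. taylor_coeff f n * complex_of_real s ^ n)"
    using taylor_coeff_sums[OF assms(1), of "of_real s"] s by (simp add: sums_iff)
  then have "summable (\<lambda>n. cmod (taylor_coeff f n * complex_of_real r ^ n))"
    by (rule powser_insidea) (use assms s in auto)
  then show ?thesis
    using assms by (simp add: norm_mult norm_power)
qed

lemma bounded_integrable_dA_weighted:
  fixes f :: "complex \<Rightarrow> complex"
  assumes p: "p > -1" and [measurable]: "f \<in> borel_measurable borel"
    and "\<And>z. z \<in> unit_disk \<Longrightarrow> cmod (f z) \<le> C"
  shows "integrable (dA_weighted p) f"
proof -
  interpret finite_measure "dA_weighted p" by (rule finite_measure_dA_weighted[OF p])
  show ?thesis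
    using AE_dA_weighted[OF p] assms(3) by (intro integrable_const_bound[of _ C]) (auto elim!: eventually_mono)
qed

lemma integral_ball_monomials:
  assumes p: "p > -1" and "m \<noteq> n"
  shows "(\<integral>z. indicator (ball 0 r) z *\<^sub>R (z ^ m * cnj (z ^ n)) \<partial>dA_weighted p) = 0"
proof -
  define h where "h t = indicat_real {..<1} t * ((p + 1) * (1 - t\<^sup>2) powr p) / pi * indicat_real {..<r} t" for t
  have [measurable]: "h \<in> borel_measurable borel" unfolding h_def by measurable
  have "(\<integral>z. indicator (ball 0 r) z *\<^sub>R (z ^ m * cnj (z ^ n)) \<partial>dA_weighted p)
    = (\<integral>z. bergman_density p z *\<^sub>R (indicator (ball 0 r) z *\<^sub>R (z ^ m * cnj (z ^ n))) \<partial>lborel)"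
    unfolding dA_weighted_eq_density[OF p]
    by (subst integral_density) (auto simp: bergman_density_nonneg[OF p])
  also have "\<dots> = (\<integral>z. h (cmod z) *\<^sub>R (z ^ m * cnj (z ^ n)) \<partial>lborel)"
    by (intro Bochner_Integration.integral_cong) (auto simp: h_def bergman_density_def split: split_indicator)
  also have "\<dots> = 0"
    using \<open>m \<noteq> n\<close> by (intro integral_radial_monomials) auto
  finally show ?thesis .
qed

lemma integral_ball_polynomial:
  assumes p: "p > -1"
  shows "(\<integral>z. indicator (ball 0 r) z * (cmod (\<Sum>n<N. c n * z ^ n))\<^sup>2 \<partial>dA_weighted p)
    = (\<Sum>n<N. \<integral>z. indicator (ball 0 r) z * (cmod (c n * z ^ n))\<^sup>2 \<partial>dA_weighted p)"
proof -
  define e :: "nat \<Rightarrow> nat \<Rightarrow> complex \<Rightarrow> complex"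
    where "e m n z = indicator (ball 0 r) z *\<^sub>R (z ^ m * cnj (z ^ n))" for m n z
  have int: "integrable (dA_weighted p) (\<lambda>z. e m n z)" for m n
    unfolding e_def by (rule bounded_integrable_dA_weighted[OF p, where C=1])
       (auto simp: norm_mult norm_power mult_le_one power_le_one split: split_indicator)
  have "complex_of_real (\<integral>z. indicator (ball 0 r) z * (cmod (\<Sum>n<N. c n * z ^ n))\<^sup>2 \<partial>dA_weighted p)
    = (\<integral>z. complex_of_real (indicator (ball 0 r) z * (cmod (\<Sum>n<N. c n * z ^ n))\<^sup>2) \<partial>dA_weighted p)"
    by (rule integral_complex_of_real[symmetric])
  also have "\<dots> = (\<integral>z. (\<Sum>m<N. \<Sum>n<N. (c m * cnj (c n)) * e m n z) \<partial>dA_weighted p)"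
  proof (rule Bochner_Integration.integral_cong)
    fix z
    have "complex_of_real ((cmod (\<Sum>n<N. c n * z ^ n))\<^sup>2) = (\<Sum>m<N. c m * z ^ m) * cnj (\<Sum>n<N. c n * z ^ n)"
      by (rule complex_norm_square)
    also have "\<dots> = (\<Sum>m<N. \<Sum>n<N. (c m * cnj (c n)) * (z ^ m * cnj (z ^ n)))"
      by (simp add: sum_product cnj_sum mult_ac)
    finally show "complex_of_real (indicator (ball 0 r) z * (cmod (\<Sum>n<N. c n * z ^ n))\<^sup>2)
      = (\<Sum>m<N. \<Sum>n<N. (c m * cnj (c n)) * e m n z)"
      by (cases "z \<in> ball 0 r") (simp_all add: e_def)
  qed simp
  also have "\<dots> = (\<Sum>m<N. \<Sum>n<N. (c m * cnj (c n)) * (\<integral>z. e m n z \<partial>dA_weighted p))"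
    using int by (simp add: Bochner_Integration.integral_sum Bochner_Integration.integrable_sum)
  also have "\<dots> = (\<Sum>m<N. (c m * cnj (c m)) * (\<integral>z. e m m z \<partial>dA_weighted p))"
  proof (intro sum.cong refl)
    fix m assume "m \<in> {..<N}"
    then show "(\<Sum>n<N. (c m * cnj (c n)) * (\<integral>z. e m n z \<partial>dA_weighted p))
       = (c m * cnj (c m)) * (\<integral>z. e m m z \<partial>dA_weighted p)"
      using integral_ball_monomials[OF p] unfolding e_def by (subst sum.remove[of _ m]) (auto intro!: sum.neutral)
  qed
  also have "\<dots> = (\<Sum>m<N. (\<integral>z. complex_of_real (indicator (ball 0 r) z * (cmod (c m * z ^ m))\<^sup>2) \<partial>dA_weighted p))"
  proof (intro sum.cong refl)
    fix m
    have "(c m * cnj (c m)) * (\<integral>z. e m m z \<partial>dA_weighted p)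
      = (\<integral>z. (c m * cnj (c m)) * e m m z \<partial>dA_weighted p)"
      by (rule integral_mult_right_zero[symmetric])
    also have "\<dots> = (\<integral>z. complex_of_real (indicator (ball 0 r) z * (cmod (c m * z ^ m))\<^sup>2) \<partial>dA_weighted p)"
      by (intro Bochner_Integration.integral_cong)
         (auto simp del: of_real_power simp: complex_norm_square e_def split: split_indicator)
    finally show "(c m * cnj (c m)) * (\<integral>z. e m m z \<partial>dA_weighted p)
      = (\<integral>z. complex_of_real (indicator (ball 0 r) z * (cmod (c m * z ^ m))\<^sup>2) \<partial>dA_weighted p)" .
  qed
  also have "\<dots> = complex_of_real (\<Sum>n<N. \<integral>z. indicator (ball 0 r) z * (cmod (c n * z ^ n))\<^sup>2 \<partial>dA_weighted p)"
    by (simp only: integral_complex_of_real of_real_sum)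
  finally show ?thesis
    by (simp only: of_real_eq_iff)
qed

text \<open>On a smaller disk all partial sums of the Taylor series share one bound, so
  orthogonality of the monomials passes to the limit by dominated convergence. On the whole disk
  such a bound may fail.\<close>

lemma nn_integral_ball_parseval:
  assumes p: "p > -1" and f: "disk_fun f" and r: "0 < r" "r < 1"
  shows "(\<integral>\<^sup>+z. ennreal ((cmod (f z))\<^sup>2) * indicator (ball 0 r) z \<partial>dA_weighted p)
    = (\<integral>\<^sup>+z. (\<Sum>n. ennreal ((cmod (taylor_coeff f n * z ^ n))\<^sup>2)) * indicator (ball 0 r) z \<partial>dA_weighted p)"
proof -
  interpret finite_measure "dA_weighted p" by (rule finite_measure_dA_weighted[OF p])
  have [measurable]: "f \<in> borel_measurable borel" by (rule disk_fun_measurable[OF f])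
  have hol: "f holomorphic_on unit_disk" using f by (simp add: disk_fun_def)
  define K where "K = (\<Sum>n. cmod (taylor_coeff f n) * r ^ n)"
  have sm: "summable (\<lambda>n. cmod (taylor_coeff f n) * r ^ n)"
    by (rule taylor_coeff_abs_summable[OF hol]) (use r in auto)
  define I where "I N = (\<integral>z. indicator (ball 0 r) z * (cmod (\<Sum>n<N. taylor_coeff f n * z ^ n))\<^sup>2 \<partial>dA_weighted p)" for N
  define J where "J n = (\<integral>z. indicator (ball 0 r) z * (cmod (taylor_coeff f n * z ^ n))\<^sup>2 \<partial>dA_weighted p)" for n
  have K: "cmod (\<Sum>n<N. taylor_coeff f n * z ^ n) \<le> K" if "cmod z < r" for z N
  proof -
    have "cmod (\<Sum>n<N. taylor_coeff f n * z ^ n) \<le> (\<Sum>n<N. cmod (taylor_coeff f n) * r ^ n)"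
      using that by (intro sum_norm_le) (auto simp: norm_mult norm_power intro!: mult_left_mono power_mono)
    also have "\<dots> \<le> K" 
      unfolding K_def using r by (intro sum_le_suminf sm) auto
    finally show ?thesis .
  qed
  have lim: "(\<lambda>N. \<Sum>n<N. taylor_coeff f n * z ^ n) \<longlonglongrightarrow> f z" if "cmod z < r" for z
    using taylor_coeff_sums[OF hol, of z] that r by (simp add: sums_def)
  have bd: "norm (indicator (ball 0 r) z * (cmod (\<Sum>n<N. taylor_coeff f n * z ^ n))\<^sup>2) \<le> K\<^sup>2" for z N
    using K[of z N] by (auto split: split_indicator intro!: power_mono)
  have conv: "(\<lambda>N. indicator (ball 0 r) z * (cmod (\<Sum>n<N. taylor_coeff f n * z ^ n))\<^sup>2) \<longlonglongrightarrow> indicator (ball 0 r) z * (cmod (f z))\<^sup>2" for z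
    by (cases "cmod z < r") (auto intro!: tendsto_intros lim simp: indicator_def)
  have Ilim: "I \<longlonglongrightarrow> (\<integral>z. indicator (ball 0 r) z * (cmod (f z))\<^sup>2 \<partial>dA_weighted p)"
    unfolding I_def using conv bd
    by (intro integral_dominated_convergence[where w="\<lambda>_. K\<^sup>2"]) auto
  have intf: "integrable (dA_weighted p) (\<lambda>z. indicator (ball 0 r) z * (cmod (f z))\<^sup>2)"
  proof (rule integrable_const_bound[of _ "K\<^sup>2"])
    have "cmod (f z) \<le> K" if "cmod z < r" for z
      by (rule LIMSEQ_le_const2[OF tendsto_norm[OF lim[OF that]]]) (use K[OF that] in auto)
    then show "AE z in dA_weighted p. norm (indicator (ball 0 r) z * (cmod (f z))\<^sup>2) \<le> K\<^sup>2"
      by (auto split: split_indicator intro!: power_mono)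
  qed measurable
  have Isum: "I N = (\<Sum>n<N. J n)" for N
    unfolding I_def J_def by (rule integral_ball_polynomial[OF p])
  have J0: "J n \<ge> 0" for n
    unfolding J_def by (rule Bochner_Integration.integral_nonneg) auto
  have Jnn: "(\<integral>\<^sup>+z. ennreal ((cmod (taylor_coeff f n * z ^ n))\<^sup>2) * indicator (ball 0 r) z \<partial>dA_weighted p) = ennreal (J n)" for n
  proof -
    have "integrable (dA_weighted p) (\<lambda>z. indicator (ball 0 r) z * (cmod (taylor_coeff f n * z ^ n))\<^sup>2)"
    proof (rule integrable_const_bound[of _ "(cmod (taylor_coeff f n))\<^sup>2"])
      show "AE z in dA_weighted p. norm (indicator (ball 0 r) z * (cmod (taylor_coeff f n * z ^ n))\<^sup>2) \<le> (cmod (taylor_coeff f n))\<^sup>2"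
        using r by (auto simp: norm_mult norm_power power_mult_distrib mult_left_le power_le_one split: split_indicator)
    qed measurable
    then have "(\<integral>\<^sup>+z. ennreal (indicator (ball 0 r) z * (cmod (taylor_coeff f n * z ^ n))\<^sup>2) \<partial>dA_weighted p) = ennreal (J n)"
      unfolding J_def by (intro nn_integral_eq_integral) auto
    moreover have "(\<integral>\<^sup>+z. ennreal ((cmod (taylor_coeff f n * z ^ n))\<^sup>2) * indicator (ball 0 r) z \<partial>dA_weighted p)
      = (\<integral>\<^sup>+z. ennreal (indicator (ball 0 r) z * (cmod (taylor_coeff f n * z ^ n))\<^sup>2) \<partial>dA_weighted p)"
      by (intro nn_integral_cong) (simp split: split_indicator)
    ultimately show ?thesis by simp
  qed
  have "(\<integral>\<^sup>+z. ennreal ((cmod (f z))\<^sup>2) * indicator (ball 0 r) z \<partial>dA_weighted p)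
    = (\<integral>\<^sup>+z. ennreal (indicator (ball 0 r) z * (cmod (f z))\<^sup>2) \<partial>dA_weighted p)"
    by (intro nn_integral_cong) (simp split: split_indicator)
  also have "\<dots> = ennreal (\<integral>z. indicator (ball 0 r) z * (cmod (f z))\<^sup>2 \<partial>dA_weighted p)"
    using intf by (intro nn_integral_eq_integral) auto
  also have "\<dots> = (\<Sum>n. ennreal (J n))"
  proof -
    have "J sums (\<integral>z. indicator (ball 0 r) z * (cmod (f z))\<^sup>2 \<partial>dA_weighted p)"
      using Ilim unfolding sums_def Isum .
    then show ?thesis
      using J0 by (simp add: suminf_ennreal2 sums_iff)
  qed
  also have "\<dots> = (\<integral>\<^sup>+z. (\<Sum>n. ennreal ((cmod (taylor_coeff f n * z ^ n))\<^sup>2) * indicator (ball 0 r) z) \<partial>dA_weighted p)"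
    unfolding Jnn[symmetric] by (rule nn_integral_suminf[symmetric]) measurable
  also have "\<dots> = (\<integral>\<^sup>+z. (\<Sum>n. ennreal ((cmod (taylor_coeff f n * z ^ n))\<^sup>2)) * indicator (ball 0 r) z \<partial>dA_weighted p)"
    by (intro nn_integral_cong) (rule ennreal_suminf_multc)
  finally show ?thesis .
qed

text \<open>Exhausting the disk by smaller ones. The identity holds in [0, \<infinity>] for every
  analytic function, so it yields the membership criterion as well as the value of the norm.\<close>

lemma nn_integral_parseval:
  assumes p: "p > -1" and f: "disk_fun f"
  shows "(\<integral>\<^sup>+z. ennreal ((cmod (f z))\<^sup>2) \<partial>dA_weighted p)
    = (\<Sum>n. ennreal ((cmod (taylor_coeff f n))\<^sup>2 * bergman_weight p n))"
proof -
  have fm[measurable]: "f \<in> borel_measurable borel" by (rule disk_fun_measurable[OF f])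
  \<comment> \<open>The shift by 2 keeps the radius positive already for k = 0.\<close>
  define r where "r k = 1 - 1 / (real k + 2)" for k
  have r: "0 < r k" "r k < 1" for k by (auto simp: r_def field_simps)
  define B :: "nat \<Rightarrow> complex set" where "B k = ball 0 (r k)" for k
  have B: "range B \<subseteq> sets borel" by (auto simp: B_def)
  have "incseq B"
    unfolding B_def by (intro incseq_SucI subset_ball) (auto simp: r_def field_simps)
  have UB: "(\<Union>k. B k) = unit_disk"
  proof
    show "unit_disk \<subseteq> (\<Union>k. B k)"
    proof
      fix z :: complex assume "z \<in> unit_disk"
      then have "0 < 1 - cmod z" by simp
      then obtain k where "inverse (real (Suc k)) < 1 - cmod z"
        using reals_Archimedean by blast
      moreover have "1 / (real k + 2) \<le> inverse (real (Suc k))"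
        by (simp add: field_simps)
      ultimately have "z \<in> B k" by (simp add: B_def r_def)
      then show "z \<in> (\<Union>k. B k)" by blast
    qed
    show "(\<Union>k. B k) \<subseteq> unit_disk"
    proof safe
      fix z k assume "z \<in> B k"
      then show "z \<in> unit_disk" using r[of k] by (simp add: B_def)
    qed
  qed
  let ?S = "\<lambda>z. \<Sum>n. ennreal ((cmod (taylor_coeff f n * z ^ n))\<^sup>2)"
  \<comment> \<open>Reading both integrals as measures turns the exhaustion into continuity from
    below.\<close>
  let ?\<nu>1 = "density (dA_weighted p) (\<lambda>z. ennreal ((cmod (f z))\<^sup>2))"
  let ?\<nu>2 = "density (dA_weighted p) ?S"
  have em: "emeasure ?\<nu>1 (B k) = emeasure ?\<nu>2 (B k)" for k
    using nn_integral_ball_parseval[OF p f r[of k]]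
    by (simp add: emeasure_density B_def)
  have "emeasure ?\<nu>1 unit_disk = (SUP k. emeasure ?\<nu>1 (B k))"
    unfolding UB[symmetric] using B by (intro SUP_emeasure_incseq[symmetric] \<open>incseq B\<close>) auto
  also have "\<dots> = (SUP k. emeasure ?\<nu>2 (B k))"
    by (simp only: em)
  also have "\<dots> = emeasure ?\<nu>2 unit_disk"
    unfolding UB[symmetric] using B by (intro SUP_emeasure_incseq \<open>incseq B\<close>) auto
  finally have eq: "emeasure ?\<nu>1 unit_disk = emeasure ?\<nu>2 unit_disk" .
  have AE: "AE z in dA_weighted p. z \<in> unit_disk" by (rule AE_dA_weighted[OF p])
  have "(\<integral>\<^sup>+z. ennreal ((cmod (f z))\<^sup>2) \<partial>dA_weighted p) = emeasure ?\<nu>1 unit_disk"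
    using AE by (subst emeasure_density) (auto intro!: nn_integral_cong_AE simp: indicator_def elim: eventually_mono)
  also have "\<dots> = (\<integral>\<^sup>+z. ?S z \<partial>dA_weighted p)"
    unfolding eq using AE by (subst emeasure_density) (auto intro!: nn_integral_cong_AE simp: indicator_def elim: eventually_mono)
  also have "\<dots> = (\<Sum>n. \<integral>\<^sup>+z. ennreal ((cmod (taylor_coeff f n * z ^ n))\<^sup>2) \<partial>dA_weighted p)"
    by (rule nn_integral_suminf) measurable
  also have "\<dots> = (\<Sum>n. ennreal ((cmod (taylor_coeff f n))\<^sup>2 * bergman_weight p n))"
  proof (intro arg_cong[where f=suminf] ext)
    fix n
    have "(\<integral>\<^sup>+z. ennreal ((cmod (taylor_coeff f n * z ^ n))\<^sup>2) \<partial>dA_weighted p)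
      = (\<integral>\<^sup>+z. ennreal ((cmod (taylor_coeff f n))\<^sup>2) * ennreal ((cmod z)^(2*n)) \<partial>dA_weighted p)"
      by (simp add: norm_mult norm_power power_mult_distrib ennreal_mult power_mult[symmetric] mult.commute)
    also have "\<dots> = ennreal ((cmod (taylor_coeff f n))\<^sup>2) * ennreal (bergman_weight p n)"
      by (subst nn_integral_cmult) (auto simp: nn_integral_norm_power_dA_weighted[OF p])
    finally show "(\<integral>\<^sup>+z. ennreal ((cmod (taylor_coeff f n * z ^ n))\<^sup>2) \<partial>dA_weighted p)
      = ennreal ((cmod (taylor_coeff f n))\<^sup>2 * bergman_weight p n)"
      using bergman_weight_pos[OF p, of n] by (simp add: ennreal_mult)
  qed
  finally show ?thesis .
qed

section \<open>Membership in \<open>A2\<close> through Taylor coefficients\<close>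

lemma taylor_coeff_unique:
  assumes "\<And>z. z \<in> unit_disk \<Longrightarrow> (\<lambda>n. c n * z ^ n) sums f z"
  shows "taylor_coeff f n = c n"
proof -
  have "f has_fps_expansion Abs_fps c"
    using assms by (intro has_fps_expansionI) (auto simp: eventually_nhds intro!: exI[of _ unit_disk])
  from fps_nth_fps_expansion[OF this, of n] show ?thesis
    by (simp add: taylor_coeff_def)
qed

lemma summable_two_sided:
  fixes x y :: "nat \<Rightarrow> real"
  assumes "a > 0" "\<And>n. 0 \<le> x n" "\<And>n. a * x n \<le> y n" "\<And>n. y n \<le> b * x n"
  shows "summable x \<longleftrightarrow> summable y"
proof
  assume "summable x"
  then have "summable (\<lambda>n. b * x n)" by (rule summable_mult)
  moreover have "0 \<le> y n" for n
    using mult_nonneg_nonneg[of a "x n"] assms(1) assms(2)[of n] assms(3)[of n] by linarith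
  ultimately show "summable y"
    using assms(4) by (intro summable_comparison_test[of y "\<lambda>n. b * x n"]) auto
next
  assume "summable y"
  then have "summable (\<lambda>n. y n / a)" by (rule summable_divide)
  then show "summable x"
  proof (rule summable_comparison_test[rotated], intro exI allI impI)
    fix n
    show "norm (x n) \<le> y n / a"
      using assms(1) assms(2)[of n] assms(3)[of n] by (simp add: field_simps)
  qed
qed

lemma taylor_coeff_higher_deriv:
  "taylor_coeff ((deriv ^^ k) f) n = of_real (fact (n + k) / fact n) * taylor_coeff f (n + k)"
  by (simp add: taylor_coeff_def funpow_add)

lemma suminf_ennreal_finite_iff:
  assumes "\<And>n. 0 \<le> a n"
  shows "(\<Sum>n. ennreal (a n)) < \<infinity> \<longleftrightarrow> summable a"
proof
  assume "(\<Sum>n. ennreal (a n)) < \<infinity>"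
  then show "summable a"
    by (intro summable_suminf_not_top assms) (metis infinity_ennreal_def less_irrefl)
next
  assume "summable a"
  then show "(\<Sum>n. ennreal (a n)) < \<infinity>"
    by (subst suminf_ennreal2[OF assms]) (auto simp only: infinity_ennreal_def ennreal_less_top)
qed

text \<open>Finiteness of both sides of the Parseval identity. It is applied to the restriction of g
  by zero, since g is arbitrary off the disk and may fail to be measurable there.\<close>

lemma set_integrable_iff_summable_taylor_coeff:
  assumes q: "q > -1" and g: "g holomorphic_on unit_disk"
  shows "set_integrable dA unit_disk (\<lambda>z. (1 - (cmod z)\<^sup>2) powr q * (cmod (g z))\<^sup>2)
     \<longleftrightarrow> summable (\<lambda>n. (cmod (taylor_coeff g n))\<^sup>2 * bergman_weight q n)"
proof -
  have dg: "disk_fun (disk_restrict g)" by (rule disk_fun_disk_restrict[OF g])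
  have tcg: "taylor_coeff (disk_restrict g) n = taylor_coeff g n" for n by (rule taylor_coeff_cong) (simp add: disk_restrict_def)
  have gm[measurable]: "disk_restrict g \<in> borel_measurable borel" by (rule disk_fun_measurable[OF dg])
  have sdA[measurable_cong]: "sets dA = sets borel" by (simp add: dA_def)
  let ?F = "\<lambda>z. indicat_real unit_disk z *\<^sub>R ((1 - (cmod z)\<^sup>2) powr q * (cmod (g z))\<^sup>2)"
  have F: "?F = (\<lambda>z. indicat_real unit_disk z * ((1 - (cmod z)\<^sup>2) powr q * (cmod (disk_restrict g z))\<^sup>2))"
    by (auto simp: disk_restrict_def fun_eq_iff split: split_indicator)
  have Fm: "?F \<in> borel_measurable dA" unfolding F by measurable
  have "(\<integral>\<^sup>+z. ennreal ((cmod (disk_restrict g z))\<^sup>2) \<partial>dA_weighted q)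
     = (\<integral>\<^sup>+z. ennreal ((q + 1) * (1 - (cmod z)\<^sup>2) powr q) * ennreal ((cmod (disk_restrict g z))\<^sup>2) \<partial>dA)"
    unfolding dA_weighted_def by (subst nn_integral_density) (auto simp: add.commute)
  also have "\<dots> = (\<integral>\<^sup>+z. ennreal (q + 1) * ennreal (norm (?F z)) \<partial>dA)"
    using q by (intro nn_integral_cong) (auto simp: disk_restrict_def ennreal_mult[symmetric] mult_ac split: split_indicator)
  also have "\<dots> = ennreal (q + 1) * (\<integral>\<^sup>+z. ennreal (norm (?F z)) \<partial>dA)"
    using Fm by (intro nn_integral_cmult) auto
  finally have eq: "(\<Sum>n. ennreal ((cmod (taylor_coeff g n))\<^sup>2 * bergman_weight q n))
      = ennreal (q + 1) * (\<integral>\<^sup>+z. ennreal (norm (?F z)) \<partial>dA)"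
    using nn_integral_parseval[OF q dg] by (simp only: tcg)
  have fin: "ennreal (q + 1) * X < \<infinity> \<longleftrightarrow> X < \<infinity>" for X
    using q by (cases X) (auto simp: ennreal_mult[symmetric] ennreal_mult_top)
  have "set_integrable dA unit_disk (\<lambda>z. (1 - (cmod z)\<^sup>2) powr q * (cmod (g z))\<^sup>2)
    \<longleftrightarrow> (\<integral>\<^sup>+z. ennreal (norm (?F z)) \<partial>dA) < \<infinity>"
    unfolding set_integrable_def using Fm by (simp add: integrable_iff_bounded)
  also have "\<dots> \<longleftrightarrow> ennreal (q + 1) * (\<integral>\<^sup>+z. ennreal (norm (?F z)) \<partial>dA) < \<infinity>"
    by (simp only: fin)
  also have "\<dots> \<longleftrightarrow> summable (\<lambda>n. (cmod (taylor_coeff g n))\<^sup>2 * bergman_weight q n)"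
    unfolding eq[symmetric] using bergman_weight_pos[OF q]
    by (intro suminf_ennreal_finite_iff) (simp add: less_imp_le)
  finally show ?thesis .
qed

text \<open>For the Taylor coefficients c of f, these are the summands of the squared norm of the
  k-th derivative of f in the weight \<open>2 * k + \<gamma>\<close>.\<close>

definition deriv_term :: "real \<Rightarrow> (nat \<Rightarrow> complex) \<Rightarrow> nat \<Rightarrow> nat \<Rightarrow> real" where
  "deriv_term \<gamma> c k n = (cmod (of_real (fact (n + k) / fact n) * c (n + k)))\<^sup>2 * bergman_weight (2 * real k + \<gamma>) n"

lemma set_integrable_deriv_iff:
  assumes f: "f holomorphic_on unit_disk" and k: "2 * real k + \<gamma> > -1"
  shows "set_integrable dA unit_disk (\<lambda>z. (1 - (cmod z)\<^sup>2) powr (2 * real k + \<gamma>) * (cmod ((deriv ^^ k) f z))\<^sup>2)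
    \<longleftrightarrow> summable (deriv_term \<gamma> (taylor_coeff f) k)"
  using set_integrable_iff_summable_taylor_coeff[OF k, of "(deriv ^^ k) f"] f
  by (simp add: holomorphic_higher_deriv taylor_coeff_higher_deriv deriv_term_def[abs_def])

text \<open>Passing from \<open>k\<close> to \<open>k + 1\<close> multiplies the coefficient weights by
  \<open>(n + 1) (q + 2) (q + 3) / (n + q + 3)\<close> with \<open>q = 2 k + \<gamma>\<close>, which stays between positive constants.\<close>

lemma summable_deriv_term_Suc:
  assumes q: "2 * real k + \<gamma> > -1"
  shows "summable (deriv_term \<gamma> c k) \<longleftrightarrow> summable (deriv_term \<gamma> c (Suc k))"
proof -
  define q where "q = 2 * real k + \<gamma>"
  have q: "q > -1" using assms by (simp add: q_def)
  have q2: "2 * real (Suc k) + \<gamma> = q + 2" by (simp add: q_def)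
  have "summable (deriv_term \<gamma> c k) \<longleftrightarrow> summable (\<lambda>n. deriv_term \<gamma> c k (Suc n))"
    by (rule summable_Suc_iff[symmetric])
  also have "\<dots> \<longleftrightarrow> summable (deriv_term \<gamma> c (Suc k))"
  proof (rule summable_two_sided)
    fix n
    define r where "r = (real n + 1) * (q + 2) * (q + 3) / (real n + q + 3)"
    have w1: "bergman_weight (q + 1) n = bergman_weight q n * (q + 2) / (real n + q + 2)"
      using bergman_weight_plus1[OF q, of n] q by (simp add: field_simps)
    have w2: "bergman_weight (q + 2) n = bergman_weight (q + 1) n * (q + 3) / (real n + q + 3)"
      using bergman_weight_plus1[of "q + 1" n] q by (simp add: field_simps)
    have ws: "bergman_weight q (Suc n) = bergman_weight q n * (real n + 1) / (real n + q + 2)"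
      by (rule bergman_weight_Suc[OF q])
    have "(real n + 1)\<^sup>2 * bergman_weight (q + 2) n = r * bergman_weight q (Suc n)"
      unfolding w2 w1 ws r_def by (simp add: power2_eq_square mult_ac)
    moreover have "deriv_term \<gamma> c (Suc k) n
       = (cmod (of_real (fact (Suc n + k) / fact (Suc n)) * c (Suc n + k)))\<^sup>2 * ((real n + 1)\<^sup>2 * bergman_weight (q + 2) n)"
    proof -
      have "(fact (Suc n) :: real) = (real n + 1) * fact n"
        by simp
      then have "(fact (n + Suc k) / fact n :: real) = (real n + 1) * (fact (Suc n + k) / fact (Suc n))"
        by (simp only: add_Suc_right add_Suc) (simp del: fact_Suc)
      then have "cmod (of_real (fact (n + Suc k) / fact n) * c (n + Suc k))
          = (real n + 1) * cmod (of_real (fact (Suc n + k) / fact (Suc n)) * c (Suc n + k))"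
        by (simp only: norm_mult norm_of_real abs_mult) simp
      then show ?thesis
        unfolding deriv_term_def q2 by (simp only: power_mult_distrib mult_ac)
    qed
    moreover have "deriv_term \<gamma> c k (Suc n)
       = (cmod (of_real (fact (Suc n + k) / fact (Suc n)) * c (Suc n + k)))\<^sup>2 * bergman_weight q (Suc n)"
      by (simp only: deriv_term_def q_def)
    ultimately have eq: "deriv_term \<gamma> c (Suc k) n = r * deriv_term \<gamma> c k (Suc n)"
      by (simp only: mult.left_commute)
    show nn: "0 \<le> deriv_term \<gamma> c k (Suc n)"
      unfolding deriv_term_def q_def[symmetric]
      using bergman_weight_pos[OF q, of "Suc n"] by simp
    have "r \<ge> q + 2"
    proof -
      have "(q + 2) * (real n + q + 3) \<le> (q + 2) * ((real n + 1) * (q + 3))"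
      proof (rule mult_left_mono)
        have "0 \<le> real n * (q + 2)" using q by simp
        then show "real n + q + 3 \<le> (real n + 1) * (q + 3)" by (simp add: algebra_simps)
      qed (use q in simp)
      then show ?thesis
        unfolding r_def using q by (simp add: pos_le_divide_eq mult_ac)
    qed
    then show "(q + 2) * deriv_term \<gamma> c k (Suc n) \<le> deriv_term \<gamma> c (Suc k) n"
      unfolding eq using nn by (rule mult_right_mono)
    have "r \<le> (q + 2) * (q + 3)"
    proof -
      have "(real n + 1) * ((q + 2) * (q + 3)) \<le> (real n + q + 3) * ((q + 2) * (q + 3))"
        using q by (intro mult_right_mono) auto
      then show ?thesis
        unfolding r_def using q by (simp add: pos_divide_le_eq mult_ac)
    qed
    then show "deriv_term \<gamma> c (Suc k) n \<le> ((q + 2) * (q + 3)) * deriv_term \<gamma> c k (Suc n)"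
      unfolding eq using nn by (rule mult_right_mono)
  qed (use q in simp)
  finally show ?thesis .
qed

text \<open>The space does not depend on k: neighbouring admissible orders are equivalent, so a
  single one decides the condition that \<open>A2\<close> imposes for all of them.\<close>

lemma A2_iff_summable_deriv_term:
  assumes k: "2 * real k + \<gamma> > -1"
  shows "f \<in> A2 \<gamma> \<longleftrightarrow> disk_fun f \<and> summable (deriv_term \<gamma> (taylor_coeff f) k)"
proof -
  have all: "summable (deriv_term \<gamma> c i) \<longleftrightarrow> summable (deriv_term \<gamma> c j)"
    if "2 * real i + \<gamma> > -1" "2 * real j + \<gamma> > -1" for i j c
  proof -
    have up: "summable (deriv_term \<gamma> c i) \<longleftrightarrow> summable (deriv_term \<gamma> c (i + d))"
      if "2 * real i + \<gamma> > -1" for i d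
      using that by (induction d) (auto simp: summable_deriv_term_Suc[symmetric])
    show ?thesis
    proof (cases "i \<le> j")
      case True
      then show ?thesis using up[OF that(1), of "j - i"] by simp
    next
      case False
      then show ?thesis using up[OF that(2), of "i - j"] by simp
    qed
  qed
  show ?thesis
  proof
    assume "f \<in> A2 \<gamma>"
    then show "disk_fun f \<and> summable (deriv_term \<gamma> (taylor_coeff f) k)"
      using set_integrable_deriv_iff[OF _ k, of f] k by (simp add: A2_def disk_fun_def)
  next
    assume f: "disk_fun f \<and> summable (deriv_term \<gamma> (taylor_coeff f) k)"
    then have "f holomorphic_on unit_disk" by (simp add: disk_fun_def)
    with f show "f \<in> A2 \<gamma>"
      unfolding A2_def disk_fun_def using set_integrable_deriv_iff[of f] all[OF k] by blast
  qed
qed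

lemma A2_iff:
  assumes "\<alpha> > -1"
  shows "f \<in> A2 \<alpha> \<longleftrightarrow> disk_fun f \<and> summable (\<lambda>n. (cmod (taylor_coeff f n))\<^sup>2 * bergman_weight \<alpha> n)"
  using A2_iff_summable_deriv_term[of 0 \<alpha> f] assms by (simp add: deriv_term_def[abs_def])

text \<open>The order k = 1 is always admissible here, because 2 + (\<alpha> - 2) = \<alpha>. The
  natural factor n is replaced by the comparable \<open>n + \<alpha> + 2\<close>, which is the
  eigenvalue of L and never vanishes.\<close>

lemma A2_minus2_iff:
  assumes \<alpha>: "\<alpha> > -1"
  shows "f \<in> A2 (\<alpha> - 2) \<longleftrightarrow>
    disk_fun f \<and> summable (\<lambda>n. (real n + \<alpha> + 2)\<^sup>2 * (cmod (taylor_coeff f n))\<^sup>2 * bergman_weight \<alpha> n)"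
proof -
  let ?y = "\<lambda>n. (real n + \<alpha> + 2)\<^sup>2 * (cmod (taylor_coeff f n))\<^sup>2 * bergman_weight \<alpha> n"
  have "summable ?y \<longleftrightarrow> summable (\<lambda>n. ?y (Suc n))"
    by (rule summable_Suc_iff[symmetric])
  also have "\<dots> \<longleftrightarrow> summable (deriv_term (\<alpha> - 2) (taylor_coeff f) 1)"
  proof (rule summable_two_sided)
    fix n
    let ?t = "(cmod (taylor_coeff f (Suc n)))\<^sup>2 * bergman_weight \<alpha> n"
    have t: "0 \<le> ?t" using bergman_weight_pos[OF \<alpha>, of n] by simp
    have x: "?y (Suc n) = ?t * ((real n + \<alpha> + 3)\<^sup>2 * (real n + 1) / (real n + \<alpha> + 2))"
      using \<alpha> by (simp add: bergman_weight_Suc add.commute add.left_commute)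
    have y: "deriv_term (\<alpha> - 2) (taylor_coeff f) 1 n = ?t * (real n + 1)\<^sup>2"
    proof -
      have "cmod (of_real (fact (n + 1) / fact n) * taylor_coeff f (n + 1)) = (real n + 1) * cmod (taylor_coeff f (Suc n))"
        by (simp only: norm_mult norm_of_real) simp
      then show ?thesis
        by (simp add: deriv_term_def power_mult_distrib)
    qed
    show "0 \<le> ?y (Suc n)" using bergman_weight_pos[OF \<alpha>, of "Suc n"] by simp
    have le1: "(real n + \<alpha> + 3) / (real n + \<alpha> + 2) \<le> 2"
      using \<alpha> by (simp add: field_simps)
    have le2: "real n + \<alpha> + 3 \<le> (\<alpha> + 3) * (real n + 1)"
    proof -
      have "0 \<le> real n * (\<alpha> + 2)" using \<alpha> by simp
      then show ?thesis by (simp add: algebra_simps)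
    qed
    have u: "(real n + \<alpha> + 3)\<^sup>2 * (real n + 1) / (real n + \<alpha> + 2)
        = (real n + \<alpha> + 3) / (real n + \<alpha> + 2) * ((real n + \<alpha> + 3) * (real n + 1))"
      by (simp add: power2_eq_square)
    have "(real n + \<alpha> + 3)\<^sup>2 * (real n + 1) / (real n + \<alpha> + 2) \<le> 2 * ((\<alpha> + 3) * (real n + 1) * (real n + 1))"
      unfolding u using le1 le2 \<alpha> by (intro mult_mono) auto
    then have "?y (Suc n) \<le> ?t * (2 * ((\<alpha> + 3) * (real n + 1) * (real n + 1)))"
      unfolding x using t by (rule mult_left_mono)
    also have "\<dots> = (2 * (\<alpha> + 3)) * deriv_term (\<alpha> - 2) (taylor_coeff f) 1 n"
      unfolding y by (simp add: power2_eq_square)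
    finally show "(1 / (2 * (\<alpha> + 3))) * ?y (Suc n) \<le> deriv_term (\<alpha> - 2) (taylor_coeff f) 1 n"
      using \<alpha> by (simp add: field_simps)
    have "(real n + 1)\<^sup>2 \<le> (real n + \<alpha> + 3) / (real n + \<alpha> + 2) * ((real n + \<alpha> + 3) * (real n + 1))"
    proof -
      have "1 * ((real n + 1) * (real n + 1)) \<le> (real n + \<alpha> + 3) / (real n + \<alpha> + 2) * ((real n + \<alpha> + 3) * (real n + 1))"
        using \<alpha> by (intro mult_mono) auto
      then show ?thesis by (simp add: power2_eq_square)
    qed
    then show "deriv_term (\<alpha> - 2) (taylor_coeff f) 1 n \<le> 1 * ?y (Suc n)"
      unfolding x y u mult_1_left using t by (rule mult_left_mono)
  qed (use \<alpha> in simp)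
  finally show ?thesis
    using A2_iff_summable_deriv_term[of 1 "\<alpha> - 2" f] \<alpha> by simp
qed

section \<open>The Hilbert space structure\<close>

text \<open>The ambient space. Products with 1 - |\<phi>|^2 or 1 - |z|^2 are no longer analytic, yet
  \<open>A2_inner\<close> has to be used on them.\<close>

definition L2 :: "real \<Rightarrow> (complex \<Rightarrow> complex) \<Rightarrow> bool" where
  "L2 p f \<longleftrightarrow> f \<in> borel_measurable borel \<and> integrable (dA_weighted p) (\<lambda>z. (cmod (f z))\<^sup>2)"

definition L2_norm_sq :: "real \<Rightarrow> (complex \<Rightarrow> complex) \<Rightarrow> real" where
  "L2_norm_sq p f = (\<integral>z. (cmod (f z))\<^sup>2 \<partial>dA_weighted p)"

lemma L2_norm_sq_nonneg [simp]: "0 \<le> L2_norm_sq p f"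
  by (simp add: L2_norm_sq_def)

lemma A2_inner_self: "A2_inner p f f = of_real (L2_norm_sq p f)"
  unfolding A2_inner_def L2_norm_sq_def
  by (simp only: complex_norm_square[symmetric] integral_complex_of_real)

lemma A2_norm_eq: "A2_norm p f = sqrt (L2_norm_sq p f)"
  by (simp add: A2_norm_def A2_inner_self)

lemma A2_norm_nonneg [simp]: "0 \<le> A2_norm p f"
  by (simp add: A2_norm_eq)

lemma A2_norm_squared: "(A2_norm p f)\<^sup>2 = L2_norm_sq p f"
  by (simp add: A2_norm_eq)

lemma A2_inner_commute: "A2_inner p g f = cnj (A2_inner p f g)"
  unfolding A2_inner_def by (subst Bochner_Integration.integral_cnj[symmetric]) (simp add: mult.commute)

lemma L2_measurable: "L2 p f \<Longrightarrow> f \<in> borel_measurable borel"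
  by (simp add: L2_def)

lemma L2_dominated:
  assumes "integrable (dA_weighted p) u" "f \<in> borel_measurable borel" "\<And>z. (cmod (f z))\<^sup>2 \<le> u z"
  shows "L2 p f"
  unfolding L2_def
proof (intro conjI Bochner_Integration.integrable_bound[OF assms(1)])
  show "AE z in dA_weighted p. norm ((cmod (f z))\<^sup>2) \<le> norm (u z)"
    by (intro AE_I2) (use assms(3) abs_ge_self order_trans in fastforce)
qed (use assms(2) in auto)

lemma L2_scale: "L2 p f \<Longrightarrow> L2 p (\<lambda>z. c * f z)"
  by (auto simp: L2_def norm_mult power_mult_distrib)

lemma L2_uminus: "L2 p f \<Longrightarrow> L2 p (\<lambda>z. - f z)"
  by (auto simp: L2_def)

lemma mult_le_sum_squares: "0 \<le> x \<Longrightarrow> 0 \<le> y \<Longrightarrow> x * y \<le> x\<^sup>2 + (y::real)\<^sup>2"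
  using sum_squares_bound[of x y] mult_nonneg_nonneg[of x y] by linarith

lemma norm_add_sq_le: "(cmod (a + b))\<^sup>2 \<le> 2 * (cmod a)\<^sup>2 + 2 * (cmod b)\<^sup>2"
proof -
  have "(cmod (a + b))\<^sup>2 \<le> (cmod a + cmod b)\<^sup>2"
    by (intro power_mono norm_triangle_ineq) auto
  also have "\<dots> \<le> 2 * (cmod a)\<^sup>2 + 2 * (cmod b)\<^sup>2"
    using zero_le_power2[of "cmod a - cmod b"] by (simp add: power2_sum power2_diff del: zero_le_power2)
  finally show ?thesis .
qed

lemma L2_add: "L2 p f \<Longrightarrow> L2 p g \<Longrightarrow> L2 p (\<lambda>z. f z + g z)"
  by (rule L2_dominated[where u="\<lambda>z. 2 * (cmod (f z))\<^sup>2 + 2 * (cmod (g z))\<^sup>2"])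
     (auto simp: L2_def norm_add_sq_le)

lemma L2_diff: "L2 p f \<Longrightarrow> L2 p g \<Longrightarrow> L2 p (\<lambda>z. f z - g z)"
  using L2_add[of p f "\<lambda>z. - g z"] L2_uminus[of p g] by simp

lemma L2_sum: "(\<And>i. i \<in> I \<Longrightarrow> L2 p (f i)) \<Longrightarrow> L2 p (\<lambda>z. \<Sum>i\<in>I. f i z)"
proof (induction I rule: infinite_finite_induct)
  case (insert x F)
  then show ?case by (simp add: L2_add)
qed (simp_all add: L2_def)

lemma AE_norm_mult_le:
  assumes "p > -1" and "\<And>z. z \<in> unit_disk \<Longrightarrow> cmod (h z) \<le> C"
  shows "AE z in dA_weighted p. (cmod (h z * f z))\<^sup>2 \<le> C\<^sup>2 * (cmod (f z))\<^sup>2"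
  using AE_dA_weighted[OF assms(1)]
proof eventually_elim
  case (elim z)
  have "(cmod (h z))\<^sup>2 \<le> C\<^sup>2" by (intro power_mono assms(2) elim) auto
  then show ?case
    unfolding norm_mult power_mult_distrib by (intro mult_right_mono) auto
qed

lemma L2_mult_bounded:
  assumes p: "p > -1" and f: "L2 p f" and [measurable]: "h \<in> borel_measurable borel"
    and h: "\<And>z. z \<in> unit_disk \<Longrightarrow> cmod (h z) \<le> C"
  shows "L2 p (\<lambda>z. h z * f z)" "L2_norm_sq p (\<lambda>z. h z * f z) \<le> C\<^sup>2 * L2_norm_sq p f"
proof -
  have fm[measurable]: "f \<in> borel_measurable borel"
    and fi: "integrable (dA_weighted p) (\<lambda>z. (cmod (f z))\<^sup>2)"
    using f by (auto simp: L2_def)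
  have int: "integrable (dA_weighted p) (\<lambda>z. (cmod (h z * f z))\<^sup>2)"
  proof (rule Bochner_Integration.integrable_bound)
    show "integrable (dA_weighted p) (\<lambda>z. C\<^sup>2 * (cmod (f z))\<^sup>2)" using fi by simp
    show "AE z in dA_weighted p. norm ((cmod (h z * f z))\<^sup>2) \<le> norm (C\<^sup>2 * (cmod (f z))\<^sup>2)"
      using AE_norm_mult_le[where f=f, OF p h] by (auto elim: eventually_mono)
  qed measurable
  then show "L2 p (\<lambda>z. h z * f z)" by (simp add: L2_def)
  have "L2_norm_sq p (\<lambda>z. h z * f z) \<le> (\<integral>z. C\<^sup>2 * (cmod (f z))\<^sup>2 \<partial>dA_weighted p)"
    unfolding L2_norm_sq_def using int fi by (intro integral_mono_AE AE_norm_mult_le[where f=f, OF p h]) auto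
  then show "L2_norm_sq p (\<lambda>z. h z * f z) \<le> C\<^sup>2 * L2_norm_sq p f"
    by (simp add: L2_norm_sq_def)
qed

lemma L2_inner_integrable:
  assumes "L2 p f" "L2 p g"
  shows "integrable (dA_weighted p) (\<lambda>z. f z * cnj (g z))"
proof (rule Bochner_Integration.integrable_bound)
  have [measurable]: "f \<in> borel_measurable borel" "g \<in> borel_measurable borel"
    using assms by (auto simp: L2_def)
  show "integrable (dA_weighted p) (\<lambda>z. (cmod (f z))\<^sup>2 + (cmod (g z))\<^sup>2)"
    using assms by (auto simp: L2_def)
  show "(\<lambda>z. f z * cnj (g z)) \<in> borel_measurable (dA_weighted p)" by measurable
  show "AE z in dA_weighted p. norm (f z * cnj (g z)) \<le> norm ((cmod (f z))\<^sup>2 + (cmod (g z))\<^sup>2)"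
    by (intro AE_I2) (simp add: norm_mult mult_le_sum_squares)
qed

lemma A2_inner_add_left:
  "L2 p f \<Longrightarrow> L2 p g \<Longrightarrow> L2 p h \<Longrightarrow> A2_inner p (\<lambda>z. f z + g z) h = A2_inner p f h + A2_inner p g h"
  unfolding A2_inner_def
  by (simp only: distrib_right) (intro Bochner_Integration.integral_add L2_inner_integrable)

lemma A2_inner_diff_left:
  "L2 p f \<Longrightarrow> L2 p g \<Longrightarrow> L2 p h \<Longrightarrow> A2_inner p (\<lambda>z. f z - g z) h = A2_inner p f h - A2_inner p g h"
  unfolding A2_inner_def
  by (simp only: left_diff_distrib) (intro Bochner_Integration.integral_diff L2_inner_integrable)

lemma A2_inner_diff_right:
  "L2 p f \<Longrightarrow> L2 p g \<Longrightarrow> L2 p h \<Longrightarrow> A2_inner p h (\<lambda>z. f z - g z) = A2_inner p h f - A2_inner p h g"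
  by (simp add: A2_inner_commute[of p h] A2_inner_diff_left)

lemma A2_inner_add_right:
  "L2 p f \<Longrightarrow> L2 p g \<Longrightarrow> L2 p h \<Longrightarrow> A2_inner p h (\<lambda>z. f z + g z) = A2_inner p h f + A2_inner p h g"
  by (simp add: A2_inner_commute[of p h] A2_inner_add_left)

lemma A2_inner_scale_left: "A2_inner p (\<lambda>z. c * f z) h = c * A2_inner p f h"
  unfolding A2_inner_def by (simp only: mult.assoc integral_mult_right_zero)

lemma A2_inner_scale_right: "A2_inner p h (\<lambda>z. c * f z) = cnj c * A2_inner p h f"
  by (simp add: A2_inner_commute[of p h] A2_inner_scale_left)

lemma A2_inner_sum_left:
  assumes "\<And>i. i \<in> I \<Longrightarrow> L2 p (f i)" "L2 p h"
  shows "A2_inner p (\<lambda>z. \<Sum>i\<in>I. f i z) h = (\<Sum>i\<in>I. A2_inner p (f i) h)"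
  using assms
proof (induction I rule: infinite_finite_induct)
  case (insert x F)
  then show ?case by (simp add: A2_inner_add_left L2_sum)
qed (simp_all add: A2_inner_def)

lemma A2_inner_sum_right:
  assumes "\<And>i. i \<in> I \<Longrightarrow> L2 p (f i)" "L2 p h"
  shows "A2_inner p h (\<lambda>z. \<Sum>i\<in>I. f i z) = (\<Sum>i\<in>I. A2_inner p h (f i))"
  using assms by (simp add: A2_inner_commute[of p h] A2_inner_sum_left)

lemma L2_norm_sq_add:
  assumes "L2 p f" "L2 p g"
  shows "L2_norm_sq p (\<lambda>z. f z + g z) = L2_norm_sq p f + L2_norm_sq p g + 2 * Re (A2_inner p f g)"
proof -
  have "complex_of_real (L2_norm_sq p (\<lambda>z. f z + g z)) = A2_inner p (\<lambda>z. f z + g z) (\<lambda>z. f z + g z)"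
    by (simp add: A2_inner_self)
  also have "\<dots> = A2_inner p f f + A2_inner p f g + (A2_inner p g f + A2_inner p g g)"
    using assms L2_add[OF assms] by (simp add: A2_inner_add_left A2_inner_add_right)
  finally have "Re (complex_of_real (L2_norm_sq p (\<lambda>z. f z + g z)))
     = Re (A2_inner p f f + A2_inner p f g + (A2_inner p g f + A2_inner p g g))"
    by simp
  then show ?thesis
    by (simp add: A2_inner_self A2_inner_commute[of p g f])
qed

lemma L2_norm_sq_scale: "L2_norm_sq p (\<lambda>z. c * f z) = (cmod c)\<^sup>2 * L2_norm_sq p f"
  by (simp add: L2_norm_sq_def norm_mult power_mult_distrib)

lemma A2_cauchy_schwarz:
  assumes "L2 p f" "L2 p g"
  shows "cmod (A2_inner p f g) \<le> A2_norm p f * A2_norm p g"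
proof -
  have [measurable]: "f \<in> borel_measurable borel" "g \<in> borel_measurable borel"
    using assms by (auto simp: L2_def)
  have int: "integrable (dA_weighted p) (\<lambda>z. cmod (f z * cnj (g z)))"
    by (intro integrable_norm L2_inner_integrable assms)
  define X where "X = (\<integral>z. cmod (f z * cnj (g z)) \<partial>dA_weighted p)"
  have X0: "X \<ge> 0" by (simp add: X_def)
  have 1: "(\<integral>\<^sup>+z. ennreal (cmod (f z)) * ennreal (cmod (g z)) \<partial>dA_weighted p) = ennreal X"
    unfolding X_def using int
    by (subst nn_integral_eq_integral[symmetric]) (auto simp: norm_mult ennreal_mult)
  have 2: "(\<integral>\<^sup>+z. ennreal (cmod (h z)) ^ 2 \<partial>dA_weighted p) = ennreal (L2_norm_sq p h)" if "L2 p h" for h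
    unfolding L2_norm_sq_def using that
    by (subst nn_integral_eq_integral[symmetric]) (auto simp: L2_def ennreal_power)
  have "(\<integral>\<^sup>+z. ennreal (cmod (f z)) * ennreal (cmod (g z)) \<partial>dA_weighted p)\<^sup>2
      \<le> (\<integral>\<^sup>+z. ennreal (cmod (f z)) ^ 2 \<partial>dA_weighted p) * (\<integral>\<^sup>+z. ennreal (cmod (g z)) ^ 2 \<partial>dA_weighted p)"
    by (rule Cauchy_Schwarz_nn_integral) measurable
  then have "ennreal (X\<^sup>2) \<le> ennreal (L2_norm_sq p f * L2_norm_sq p g)"
    unfolding 1 2[OF assms(1)] 2[OF assms(2)] using X0 by (simp add: ennreal_power ennreal_mult)
  then have "X\<^sup>2 \<le> L2_norm_sq p f * L2_norm_sq p g"
    by (simp add: ennreal_le_iff)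
  then have "X \<le> sqrt (L2_norm_sq p f * L2_norm_sq p g)"
    by (rule real_le_rsqrt)
  moreover have "cmod (A2_inner p f g) \<le> X"
    unfolding A2_inner_def X_def by (rule integral_norm_bound)
  ultimately show ?thesis
    by (simp add: A2_norm_eq real_sqrt_mult)
qed

lemma A2_norm_triangle:
  assumes "L2 p f" "L2 p g"
  shows "A2_norm p (\<lambda>z. f z + g z) \<le> A2_norm p f + A2_norm p g"
proof (rule power2_le_imp_le)
  have "Re (A2_inner p f g) \<le> A2_norm p f * A2_norm p g"
    using A2_cauchy_schwarz[OF assms] complex_Re_le_cmod order_trans by blast
  then show "(A2_norm p (\<lambda>z. f z + g z))\<^sup>2 \<le> (A2_norm p f + A2_norm p g)\<^sup>2"
    by (simp add: power2_sum A2_norm_squared L2_norm_sq_add[OF assms])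
qed simp

lemma A2_norm_scale: "A2_norm p (\<lambda>z. c * f z) = cmod c * A2_norm p f"
  by (simp add: A2_norm_eq L2_norm_sq_scale real_sqrt_mult)

lemma A2_norm_commute: "A2_norm p (\<lambda>z. f z - g z) = A2_norm p (\<lambda>z. g z - f z)"
  by (simp add: A2_norm_eq L2_norm_sq_def norm_minus_commute)

section \<open>Analytic functions inside the ambient space\<close>

lemma disk_fun_hol: "disk_fun f \<Longrightarrow> f holomorphic_on unit_disk"
  by (simp add: disk_fun_def)

lemma disk_fun_sums: "disk_fun f \<Longrightarrow> z \<in> unit_disk \<Longrightarrow> (\<lambda>n. taylor_coeff f n * z ^ n) sums f z"
  by (simp add: disk_fun_def taylor_coeff_sums)

lemma disk_fun_add: "disk_fun f \<Longrightarrow> disk_fun g \<Longrightarrow> disk_fun (\<lambda>z. f z + g z)"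
  by (auto simp: disk_fun_def intro!: holomorphic_intros)

lemma disk_fun_diff: "disk_fun f \<Longrightarrow> disk_fun g \<Longrightarrow> disk_fun (\<lambda>z. f z - g z)"
  by (auto simp: disk_fun_def intro!: holomorphic_intros)

lemma disk_fun_mult: "h holomorphic_on unit_disk \<Longrightarrow> disk_fun f \<Longrightarrow> disk_fun (\<lambda>z. h z * f z)"
  by (auto simp: disk_fun_def intro!: holomorphic_intros)

lemma disk_fun_scale: "disk_fun f \<Longrightarrow> disk_fun (\<lambda>z. c * f z)"
  by (rule disk_fun_mult) auto

lemma taylor_coeff_add: "disk_fun f \<Longrightarrow> disk_fun g \<Longrightarrow> taylor_coeff (\<lambda>z. f z + g z) n = taylor_coeff f n + taylor_coeff g n"
  by (rule taylor_coeff_unique) (auto simp: distrib_right intro!: sums_add disk_fun_sums)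

lemma taylor_coeff_diff: "disk_fun f \<Longrightarrow> disk_fun g \<Longrightarrow> taylor_coeff (\<lambda>z. f z - g z) n = taylor_coeff f n - taylor_coeff g n"
  by (rule taylor_coeff_unique) (auto simp: left_diff_distrib intro!: sums_diff disk_fun_sums)

lemma taylor_coeff_scale: "disk_fun f \<Longrightarrow> taylor_coeff (\<lambda>z. c * f z) n = c * taylor_coeff f n"
  by (rule taylor_coeff_unique) (auto simp: mult.assoc intro!: sums_mult disk_fun_sums)

lemma disk_fun_eqI:
  assumes "disk_fun f" "disk_fun g" "\<And>n. taylor_coeff f n = taylor_coeff g n"
  shows "f = g"
proof
  fix z
  show "f z = g z"
  proof (cases "z \<in> unit_disk")
    case True
    then show ?thesis
      using disk_fun_sums[OF assms(1), of z] disk_fun_sums[OF assms(2), of z] assms(3)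
      by (simp add: sums_unique2)
  qed (use assms in \<open>auto simp: disk_fun_def\<close>)
qed

lemma disk_fun_L2_norm_sq_finite:
  assumes p: "p > -1" and f: "disk_fun f"
  shows "L2 p f \<longleftrightarrow> summable (\<lambda>n. (cmod (taylor_coeff f n))\<^sup>2 * bergman_weight p n)"
    and "L2 p f \<Longrightarrow> (\<lambda>n. (cmod (taylor_coeff f n))\<^sup>2 * bergman_weight p n) sums L2_norm_sq p f"
proof -
  have [measurable]: "f \<in> borel_measurable borel" by (rule disk_fun_measurable[OF f])
  let ?a = "\<lambda>n. (cmod (taylor_coeff f n))\<^sup>2 * bergman_weight p n"
  have a0: "0 \<le> ?a n" for n
    using bergman_weight_pos[OF p, of n] by simp
  have "L2 p f \<longleftrightarrow> (\<integral>\<^sup>+z. ennreal ((cmod (f z))\<^sup>2) \<partial>dA_weighted p) < \<infinity>"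
    by (simp add: L2_def integrable_iff_bounded)
  also have "\<dots> \<longleftrightarrow> summable ?a"
    unfolding nn_integral_parseval[OF p f] by (rule suminf_ennreal_finite_iff) (rule a0)
  finally show iff: "L2 p f \<longleftrightarrow> summable ?a" .
  assume L: "L2 p f"
  then have sm: "summable ?a" using iff by simp
  have "ennreal (L2_norm_sq p f) = (\<integral>\<^sup>+z. ennreal ((cmod (f z))\<^sup>2) \<partial>dA_weighted p)"
    unfolding L2_norm_sq_def using L by (intro nn_integral_eq_integral[symmetric]) (auto simp: L2_def)
  also have "\<dots> = ennreal (suminf ?a)"
    unfolding nn_integral_parseval[OF p f] by (rule suminf_ennreal2[OF a0 sm])
  finally have "L2_norm_sq p f = suminf ?a"
    by (subst (asm) ennreal_inj) (auto intro!: suminf_nonneg sm a0)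
  then show "?a sums L2_norm_sq p f"
    using sm by (simp add: summable_sums)
qed

lemma A2_iff_L2: "p > -1 \<Longrightarrow> f \<in> A2 p \<longleftrightarrow> disk_fun f \<and> L2 p f"
  using A2_iff disk_fun_L2_norm_sq_finite(1) by blast

lemma A2_disk_fun: "f \<in> A2 p \<Longrightarrow> disk_fun f"
  by (auto simp: A2_def disk_fun_def)

lemma A2_L2: "p > -1 \<Longrightarrow> f \<in> A2 p \<Longrightarrow> L2 p f"
  by (simp add: A2_iff_L2)

lemma A2_add: "p > -1 \<Longrightarrow> f \<in> A2 p \<Longrightarrow> g \<in> A2 p \<Longrightarrow> (\<lambda>z. f z + g z) \<in> A2 p"
  by (auto simp: A2_iff_L2 intro: disk_fun_add L2_add)

lemma A2_diff: "p > -1 \<Longrightarrow> f \<in> A2 p \<Longrightarrow> g \<in> A2 p \<Longrightarrow> (\<lambda>z. f z - g z) \<in> A2 p"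
  by (auto simp: A2_iff_L2 intro: disk_fun_diff L2_diff)

lemma A2_scale: "p > -1 \<Longrightarrow> f \<in> A2 p \<Longrightarrow> (\<lambda>z. c * f z) \<in> A2 p"
  by (auto simp: A2_iff_L2 intro: disk_fun_scale L2_scale)

lemma A2_mult_bounded:
  assumes p: "p > -1" and f: "f \<in> A2 p" and h: "h holomorphic_on unit_disk"
    and C: "\<And>z. z \<in> unit_disk \<Longrightarrow> cmod (h z) \<le> C"
  shows "(\<lambda>z. h z * f z) \<in> A2 p" "A2_norm p (\<lambda>z. h z * f z) \<le> C * A2_norm p f"
proof -
  have df: "disk_fun f" and Lf: "L2 p f" using f by (auto simp: A2_iff_L2[OF p])
  have eq: "(\<lambda>z. h z * f z) = (\<lambda>z. disk_restrict h z * f z)"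
    using df by (auto simp: disk_restrict_def fun_eq_iff disk_fun_def)
  have C': "cmod (disk_restrict h z) \<le> C" if "z \<in> unit_disk" for z using C[OF that] that by (simp add: disk_restrict_def)
  have C0: "0 \<le> C" using order_trans[OF norm_ge_zero C[of 0]] by simp
  note L = L2_mult_bounded[OF p Lf disk_fun_measurable[OF disk_fun_disk_restrict[OF h]] C']
  show "(\<lambda>z. h z * f z) \<in> A2 p"
    using L(1) disk_fun_mult[OF h df] by (simp add: A2_iff_L2[OF p] eq)
  show "A2_norm p (\<lambda>z. h z * f z) \<le> C * A2_norm p f"
    using real_sqrt_le_mono[OF L(2)] C0 by (simp add: eq A2_norm_eq real_sqrt_mult)
qed

lemma A2_L2_norm_sq_sums:
  "p > -1 \<Longrightarrow> f \<in> A2 p \<Longrightarrow> (\<lambda>n. (cmod (taylor_coeff f n))\<^sup>2 * bergman_weight p n) sums L2_norm_sq p f"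
  by (simp add: disk_fun_L2_norm_sq_finite(2) A2_iff_L2)

text \<open>Polarization of the norm identity.\<close>

lemma A2_inner_sums:
  assumes p: "p > -1" and f: "f \<in> A2 p" and g: "g \<in> A2 p"
  shows "(\<lambda>n. taylor_coeff f n * cnj (taylor_coeff g n) * of_real (bergman_weight p n)) sums A2_inner p f g"
proof -
  have re: "(\<lambda>n. Re (taylor_coeff f n * cnj (taylor_coeff g n)) * bergman_weight p n) sums Re (A2_inner p f g)"
    if f: "f \<in> A2 p" for f
  proof -
    have df: "disk_fun f" "L2 p f" "disk_fun g" "L2 p g"
      using f g by (auto simp: A2_iff_L2[OF p])
    have eq: "((cmod (taylor_coeff (\<lambda>z. f z + g z) n))\<^sup>2 * bergman_weight p n
        - (cmod (taylor_coeff f n))\<^sup>2 * bergman_weight p n - (cmod (taylor_coeff g n))\<^sup>2 * bergman_weight p n) / 2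
        = Re (taylor_coeff f n * cnj (taylor_coeff g n)) * bergman_weight p n" for n
    proof -
      have "(cmod (a + b))\<^sup>2 = (cmod a)\<^sup>2 + (cmod b)\<^sup>2 + 2 * Re (a * cnj b)" for a b
        unfolding cmod_power2 by (simp add: power2_eq_square algebra_simps)
      then show ?thesis
        unfolding taylor_coeff_add[OF df(1,3)] by (simp add: algebra_simps)
    qed
    have "(\<lambda>n. ((cmod (taylor_coeff (\<lambda>z. f z + g z) n))\<^sup>2 * bergman_weight p n
        - (cmod (taylor_coeff f n))\<^sup>2 * bergman_weight p n - (cmod (taylor_coeff g n))\<^sup>2 * bergman_weight p n) / 2)
        sums ((L2_norm_sq p (\<lambda>z. f z + g z) - L2_norm_sq p f - L2_norm_sq p g) / 2)"
      by (intro sums_divide sums_diff A2_L2_norm_sq_sums[OF p] f g A2_add[OF p])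
    then show ?thesis
      unfolding eq L2_norm_sq_add[OF df(2,4)] by simp
  qed
  \<comment> \<open>The real-part identity for \<open>- \<i> * f\<close> is the imaginary-part
    identity for f.\<close>
  have im: "(\<lambda>n. Im (taylor_coeff f n * cnj (taylor_coeff g n)) * bergman_weight p n) sums Im (A2_inner p f g)"
    using re[OF A2_scale[OF p f], of "- \<i>"]
    by (simp only: taylor_coeff_scale[OF A2_disk_fun[OF f]] A2_inner_scale_left mult.assoc) simp
  show ?thesis
    using re[OF f] im by (simp add: sums_complex_iff)
qed

section \<open>Functions built from coefficient sequences\<close>

definition disk_series :: "(nat \<Rightarrow> complex) \<Rightarrow> complex \<Rightarrow> complex" where
  "disk_series c = disk_restrict (\<lambda>z. \<Sum>n. c n * z ^ n)"

lemma disk_series_summable: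
  assumes "\<And>z. z \<in> unit_disk \<Longrightarrow> summable (\<lambda>n. c n * z ^ n)"
  shows "disk_fun (disk_series c)" "taylor_coeff (disk_series c) n = c n"
proof -
  have "(\<lambda>z. \<Sum>n. c n * z ^ n) holomorphic_on unit_disk"
    using assms by (intro power_series_holomorphic[of _ _ c]) (auto simp: summable_sums)
  then show "disk_fun (disk_series c)" unfolding disk_series_def by (rule disk_fun_disk_restrict)
  show "taylor_coeff (disk_series c) n = c n"
    using assms by (intro taylor_coeff_unique) (auto simp: disk_series_def disk_restrict_def summable_sums)
qed

text \<open>The binomial series of exponent -(p + 2): its coefficients are the reciprocals of the
  weights up to sign. It serves both to prove convergence of square summable series and to give the
  kernels a closed form.\<close>

lemma inverse_bergman_weight_sums:
  assumes p: "p > -1" and z: "cmod z < 1"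
  shows "(\<lambda>n. of_real (1 / bergman_weight p n) * z ^ n) sums (1 - z) powr (- of_real (p + 2))"
proof -
  have "(\<lambda>n. ((- of_real (p + 2)) gchoose n) * (- z) ^ n) sums (1 + - z) powr (- of_real (p + 2))"
    by (rule gen_binomial_complex) (use z in auto)
  moreover have "((- complex_of_real (p + 2)) gchoose n) * (- z) ^ n = of_real (1 / bergman_weight p n) * z ^ n" for n
  proof -
    have "((- complex_of_real (p + 2)) gchoose n) = (- 1) ^ n * pochhammer (complex_of_real (p + 2)) n / fact n"
      by (simp only: gbinomial_pochhammer minus_minus)
    also have "pochhammer (complex_of_real (p + 2)) n = complex_of_real (pochhammer (p + 2) n)"
      by (rule pochhammer_of_real)
    finally have "((- complex_of_real (p + 2)) gchoose n) = (- 1) ^ n * of_real (1 / bergman_weight p n)"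
      by (simp add: bergman_weight_def)
    then have "((- complex_of_real (p + 2)) gchoose n) * (- z) ^ n
        = ((- 1) ^ n * (- 1) ^ n) * (of_real (1 / bergman_weight p n) * z ^ n)"
      by (simp only: power_minus[of z] mult_ac)
    then show ?thesis
      by (simp only: power_mult_distrib[symmetric]) simp
  qed
  ultimately show ?thesis by (simp only: add_uminus_conv_diff)
qed

text \<open>Completeness of the space in coefficient form. Pointwise convergence comes from writing
  each term as (c_n sqrt w_n) (z^n / sqrt w_n) and bounding the product by the sum of the squares,
  both of which are summable.\<close>

lemma disk_series_A2:
  assumes p: "p > -1" and c: "summable (\<lambda>n. (cmod (c n))\<^sup>2 * bergman_weight p n)"
  shows "disk_series c \<in> A2 p" "taylor_coeff (disk_series c) n = c n"
proof -
  have sm: "summable (\<lambda>n. c n * z ^ n)" if "z \<in> unit_disk" for z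
  proof (rule summable_comparison_test)
    have "cmod (of_real ((cmod z)\<^sup>2)) < 1" using that by (simp add: norm_power power_less_one_iff)
    from inverse_bergman_weight_sums[OF p this]
    have "summable (\<lambda>n. complex_of_real (1 / bergman_weight p n * ((cmod z)\<^sup>2) ^ n))"
      by (simp add: sums_iff)
    then have "summable (\<lambda>n. 1 / bergman_weight p n * ((cmod z)\<^sup>2) ^ n)"
      by (simp only: summable_complex_of_real)
    with c show "summable (\<lambda>n. (cmod (c n))\<^sup>2 * bergman_weight p n + 1 / bergman_weight p n * ((cmod z)\<^sup>2) ^ n)"
      by (rule summable_add)
    show "\<exists>N. \<forall>n\<ge>N. norm (c n * z ^ n) \<le> (cmod (c n))\<^sup>2 * bergman_weight p n + 1 / bergman_weight p n * ((cmod z)\<^sup>2) ^ n"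
    proof (intro exI allI impI)
      fix n
      have w: "bergman_weight p n > 0" by (rule bergman_weight_pos[OF p])
      define s where "s = sqrt (bergman_weight p n)"
      have s: "s > 0" "bergman_weight p n = s\<^sup>2" using w by (auto simp: s_def)
      have "norm (c n * z ^ n) = (cmod (c n) * s) * (cmod z ^ n / s)"
        using s(1) by (simp add: norm_mult norm_power)
      also have "\<dots> \<le> (cmod (c n) * s)\<^sup>2 + (cmod z ^ n / s)\<^sup>2"
        using s(1) by (intro mult_le_sum_squares) auto
      finally show "norm (c n * z ^ n) \<le> (cmod (c n))\<^sup>2 * bergman_weight p n + 1 / bergman_weight p n * ((cmod z)\<^sup>2) ^ n"
        by (simp add: s(2) power_mult_distrib power_divide power_mult[symmetric] mult.commute)
    qed
  qed
  show taylor_coeff: "taylor_coeff (disk_series c) n = c n" for n by (rule disk_series_summable(2)[OF sm])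
  show "disk_series c \<in> A2 p"
    unfolding A2_iff[OF p] taylor_coeff using disk_series_summable(1)[OF sm] c by simp
qed

lemma A2_eqI: "f \<in> A2 p \<Longrightarrow> g \<in> A2 p \<Longrightarrow> (\<And>n. taylor_coeff f n = taylor_coeff g n) \<Longrightarrow> f = g"
  by (rule disk_fun_eqI) (auto simp: A2_disk_fun)

section \<open>The Bergman projection and the operator \<open>E\<close>\<close>

definition monom_fun :: "nat \<Rightarrow> complex \<Rightarrow> complex" where
  "monom_fun n = disk_restrict (\<lambda>z. z ^ n)"

lemma disk_fun_monom: "disk_fun (monom_fun n)"
  unfolding monom_fun_def by (intro disk_fun_disk_restrict holomorphic_intros)

lemma taylor_coeff_monom: "taylor_coeff (monom_fun n) m = (if m = n then 1 else 0)"
proof (rule taylor_coeff_unique)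
  fix z :: complex assume z: "z \<in> unit_disk"
  have "(\<lambda>m. if m = n then z ^ m else 0) sums z ^ n" by (rule sums_single)
  moreover have "(\<lambda>m. if m = n then z ^ m else 0) = (\<lambda>m. (if m = n then 1 else 0) * z ^ m)" by auto
  ultimately show "(\<lambda>m. (if m = n then 1 else 0) * z ^ m) sums monom_fun n z"
    using z by (simp add: monom_fun_def disk_restrict_def)
qed

lemma monom_A2: "p > -1 \<Longrightarrow> monom_fun n \<in> A2 p"
  unfolding A2_iff
proof (intro conjI disk_fun_monom)
  have "(\<lambda>m. (cmod (taylor_coeff (monom_fun n) m))\<^sup>2 * bergman_weight p m) = (\<lambda>m. if m = n then bergman_weight p m else 0)"
    by (auto simp: taylor_coeff_monom)
  then show "summable (\<lambda>m. (cmod (taylor_coeff (monom_fun n) m))\<^sup>2 * bergman_weight p m)"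
    by simp
qed

lemma A2_inner_monom:
  assumes p: "p > -1" and f: "f \<in> A2 p"
  shows "A2_inner p f (monom_fun n) = taylor_coeff f n * of_real (bergman_weight p n)"
proof -
  have "(\<lambda>m. taylor_coeff f m * cnj (taylor_coeff (monom_fun n) m) * of_real (bergman_weight p m))
      = (\<lambda>m. if m = n then taylor_coeff f m * of_real (bergman_weight p m) else 0)"
    by (auto simp: taylor_coeff_monom)
  then show ?thesis
    using A2_inner_sums[OF p f monom_A2[OF p, of n]]
      sums_single[of n "\<lambda>m. taylor_coeff f m * of_real (bergman_weight p m)"]
    by (simp add: sums_unique2)
qed

definition disk_poly :: "nat \<Rightarrow> (nat \<Rightarrow> complex) \<Rightarrow> complex \<Rightarrow> complex" where
  "disk_poly N c z = (\<Sum>n<N. c n * monom_fun n z)"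

lemma disk_poly_A2: "p > -1 \<Longrightarrow> disk_poly N c \<in> A2 p"
proof (induction N)
  case 0
  have "disk_poly 0 c = (\<lambda>z. 0 * monom_fun 0 z)" by (simp add: disk_poly_def fun_eq_iff)
  then show ?case using A2_scale[OF 0, OF monom_A2[OF 0]] by metis
next
  case (Suc N)
  have "disk_poly (Suc N) c = (\<lambda>z. disk_poly N c z + c N * monom_fun N z)"
    by (simp add: disk_poly_def fun_eq_iff)
  with Suc show ?case by (simp add: A2_add A2_scale monom_A2)
qed

lemma disk_fun_poly: "disk_fun (disk_poly N c)"
  using disk_poly_A2[of 0] by (rule A2_disk_fun) simp

lemma disk_poly_eq: "z \<in> unit_disk \<Longrightarrow> disk_poly N c z = (\<Sum>n<N. c n * z ^ n)"
  by (simp add: disk_poly_def monom_fun_def disk_restrict_def)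

lemma taylor_coeff_poly: "taylor_coeff (disk_poly N c) n = (if n < N then c n else 0)"
proof (rule taylor_coeff_unique)
  fix z :: complex assume z: "z \<in> unit_disk"
  have "(\<lambda>n. if n \<in> {..<N} then c n * z ^ n else 0) sums (\<Sum>n<N. c n * z ^ n)"
    by (rule sums_If_finite_set) simp
  moreover have "(\<lambda>n. if n \<in> {..<N} then c n * z ^ n else 0) = (\<lambda>n. (if n < N then c n else 0) * z ^ n)" by auto
  ultimately show "(\<lambda>n. (if n < N then c n else 0) * z ^ n) sums disk_poly N c z"
    by (simp add: disk_poly_eq[OF z])
qed

lemma L2_norm_sq_poly:
  assumes p: "p > -1"
  shows "L2_norm_sq p (disk_poly N c) = (\<Sum>n<N. (cmod (c n))\<^sup>2 * bergman_weight p n)"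
proof -
  have "(\<lambda>n. if n \<in> {..<N} then (cmod (c n))\<^sup>2 * bergman_weight p n else 0) sums (\<Sum>n<N. (cmod (c n))\<^sup>2 * bergman_weight p n)"
    by (rule sums_If_finite_set) simp
  moreover have "(\<lambda>n. if n \<in> {..<N} then (cmod (c n))\<^sup>2 * bergman_weight p n else 0)
      = (\<lambda>n. (cmod (taylor_coeff (disk_poly N c) n))\<^sup>2 * bergman_weight p n)" by (auto simp: taylor_coeff_poly)
  ultimately have "(\<lambda>n. (cmod (taylor_coeff (disk_poly N c) n))\<^sup>2 * bergman_weight p n) sums (\<Sum>n<N. (cmod (c n))\<^sup>2 * bergman_weight p n)"
    by simp
  with A2_L2_norm_sq_sums[OF p disk_poly_A2[OF p, of N c]] show ?thesis
    by (rule sums_unique2)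
qed

lemma A2_inner_poly_right:
  assumes p: "p > -1" and u: "L2 p u"
  shows "A2_inner p u (disk_poly N c) = (\<Sum>n<N. cnj (c n) * A2_inner p u (monom_fun n))"
  unfolding disk_poly_def
  using assms by (subst A2_inner_sum_right) (auto simp: A2_inner_scale_right intro!: L2_scale A2_L2 monom_A2)

lemma A2_poly_tendsto:
  assumes p: "p > -1" and f: "f \<in> A2 p"
  shows "(\<lambda>N. A2_norm p (\<lambda>z. f z - disk_poly N (taylor_coeff f) z)) \<longlonglongrightarrow> 0"
proof -
  let ?a = "\<lambda>n. (cmod (taylor_coeff f n))\<^sup>2 * bergman_weight p n"
  have "L2_norm_sq p (\<lambda>z. f z - disk_poly N (taylor_coeff f) z) = L2_norm_sq p f - (\<Sum>n<N. ?a n)" for N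
  proof -
    have "(\<lambda>n. ?a n - (if n \<in> {..<N} then ?a n else 0)) sums (L2_norm_sq p f - (\<Sum>n<N. ?a n))"
      by (intro sums_diff A2_L2_norm_sq_sums[OF p f] sums_If_finite_set) simp
    moreover have "(\<lambda>n. ?a n - (if n \<in> {..<N} then ?a n else 0))
        = (\<lambda>n. (cmod (taylor_coeff (\<lambda>z. f z - disk_poly N (taylor_coeff f) z) n))\<^sup>2 * bergman_weight p n)"
      by (auto simp: taylor_coeff_diff[OF A2_disk_fun[OF f] disk_fun_poly] taylor_coeff_poly)
    ultimately show ?thesis
      using A2_L2_norm_sq_sums[OF p A2_diff[OF p f disk_poly_A2[OF p, of N "taylor_coeff f"]]] by (simp add: sums_unique2)
  qed
  moreover have "(\<lambda>N. L2_norm_sq p f - (\<Sum>n<N. ?a n)) \<longlonglongrightarrow> L2_norm_sq p f - L2_norm_sq p f"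
    using A2_L2_norm_sq_sums[OF p f] by (intro tendsto_intros) (simp add: sums_def)
  ultimately have "(\<lambda>N. sqrt (L2_norm_sq p (\<lambda>z. f z - disk_poly N (taylor_coeff f) z))) \<longlonglongrightarrow> sqrt 0"
    by (intro tendsto_real_sqrt) simp
  then show ?thesis by (simp add: A2_norm_eq)
qed

lemma A2_coeff_sum_le_L2_norm_sq:
  assumes p: "p > -1" and f: "f \<in> A2 p"
  shows "(\<Sum>n<N. (cmod (taylor_coeff f n))\<^sup>2 * bergman_weight p n) \<le> L2_norm_sq p f"
  using A2_L2_norm_sq_sums[OF p f] bergman_weight_pos[OF p]
  by (subst sums_unique[OF A2_L2_norm_sq_sums[OF p f]], intro sum_le_suminf) (auto simp: sums_iff less_imp_le)

lemma A2_coeff_le_L2_norm_sq: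
  assumes p: "p > -1" and f: "f \<in> A2 p"
  shows "(cmod (taylor_coeff f n))\<^sup>2 * bergman_weight p n \<le> L2_norm_sq p f"
proof -
  have "(cmod (taylor_coeff f n))\<^sup>2 * bergman_weight p n \<le> (\<Sum>m<Suc n. (cmod (taylor_coeff f m))\<^sup>2 * bergman_weight p m)"
    using bergman_weight_pos[OF p] by (intro member_le_sum) (auto simp: less_imp_le)
  also have "\<dots> \<le> L2_norm_sq p f" by (rule A2_coeff_sum_le_L2_norm_sq[OF p f])
  finally show ?thesis .
qed

lemma A2_L2_norm_sq_zero:
  assumes p: "p > -1" and f: "f \<in> A2 p" and "L2_norm_sq p f = 0"
  shows "f = (\<lambda>_. 0)"
proof -
  have "taylor_coeff f n = 0" for n
    using A2_coeff_le_L2_norm_sq[OF p f, of n] assms(3) bergman_weight_pos[OF p, of n]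
    by (simp add: mult_le_0_iff)
  moreover have "disk_fun (\<lambda>_. 0)" by (simp add: disk_fun_def)
  moreover have "taylor_coeff (\<lambda>_. 0) n = 0" for n by (rule taylor_coeff_unique) simp
  ultimately show ?thesis by (intro disk_fun_eqI A2_disk_fun[OF f]) auto
qed

definition bergman_proj :: "real \<Rightarrow> (complex \<Rightarrow> complex) \<Rightarrow> complex \<Rightarrow> complex" where
  "bergman_proj p u = disk_series (\<lambda>n. A2_inner p u (monom_fun n) / of_real (bergman_weight p n))"

text \<open>Bessel's inequality: pairing u with a partial sum of its own expansion gives the squared
  norm of that partial sum, so Cauchy-Schwarz bounds it by the norm of u.\<close>

lemma bergman_proj_A2:
  assumes p: "p > -1" and u: "L2 p u"
  shows "bergman_proj p u \<in> A2 p"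
    "taylor_coeff (bergman_proj p u) n = A2_inner p u (monom_fun n) / of_real (bergman_weight p n)"
proof -
  define h where "h n = A2_inner p u (monom_fun n) / of_real (bergman_weight p n)" for n
  have hw: "A2_inner p u (monom_fun n) = h n * of_real (bergman_weight p n)" for n
    using bergman_weight_pos[OF p, of n] by (simp add: h_def)
  have "(\<Sum>n<N. (cmod (h n))\<^sup>2 * bergman_weight p n) \<le> L2_norm_sq p u" for N
  proof -
    let ?S = "L2_norm_sq p (disk_poly N h)"
    have "A2_inner p u (disk_poly N h) = of_real ?S"
      unfolding A2_inner_poly_right[OF p u] hw L2_norm_sq_poly[OF p] of_real_sum
      by (intro sum.cong refl) (simp only: of_real_mult complex_norm_square mult_ac)
    then have "?S \<le> A2_norm p u * A2_norm p (disk_poly N h)"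
      using A2_cauchy_schwarz[OF u A2_L2[OF p disk_poly_A2[OF p, of N h]]] by simp
    then have "(A2_norm p (disk_poly N h))\<^sup>2 \<le> A2_norm p u * A2_norm p (disk_poly N h)"
      by (simp add: A2_norm_squared)
    then have "A2_norm p (disk_poly N h) \<le> A2_norm p u"
      by (cases "A2_norm p (disk_poly N h) = 0") (auto simp: power2_eq_square mult_le_cancel_right less_le)
    then have "?S \<le> L2_norm_sq p u" by (simp add: A2_norm_eq)
    then show ?thesis by (simp add: L2_norm_sq_poly[OF p])
  qed
  then have "summable (\<lambda>n. (cmod (h n))\<^sup>2 * bergman_weight p n)"
    using bergman_weight_pos[OF p] by (intro summableI_nonneg_bounded[of _ "L2_norm_sq p u"]) (auto simp: less_imp_le)
  from disk_series_A2[OF p this] show "bergman_proj p u \<in> A2 p"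
    "taylor_coeff (bergman_proj p u) n = A2_inner p u (monom_fun n) / of_real (bergman_weight p n)"
    by (simp_all add: bergman_proj_def h_def[abs_def])
qed

text \<open>Both sides agree on polynomials by the choice of the coefficients, polynomials are
  dense, and both sides are continuous in f.\<close>

lemma A2_inner_bergman_proj:
  assumes p: "p > -1" and u: "L2 p u" and f: "f \<in> A2 p"
  shows "A2_inner p (bergman_proj p u) f = A2_inner p u f"
proof -
  let ?P = "\<lambda>N. disk_poly N (taylor_coeff f)"
  have lim: "(\<lambda>N. A2_inner p v (?P N)) \<longlonglongrightarrow> A2_inner p v f" if v: "L2 p v" for v
  proof (rule Lim_transform2[OF tendsto_const])
    have "(\<lambda>N. A2_inner p v (\<lambda>z. f z - ?P N z)) \<longlonglongrightarrow> 0"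
    proof (rule tendsto_norm_zero_cancel, rule real_tendsto_sandwich)
      show "\<forall>\<^sub>F N in sequentially. 0 \<le> norm (A2_inner p v (\<lambda>z. f z - ?P N z))" by simp
      show "\<forall>\<^sub>F N in sequentially. norm (A2_inner p v (\<lambda>z. f z - ?P N z))
          \<le> A2_norm p v * A2_norm p (\<lambda>z. f z - ?P N z)"
        by (intro always_eventually allI A2_cauchy_schwarz v A2_L2 A2_diff p f disk_poly_A2)
      show "(\<lambda>N. A2_norm p v * A2_norm p (\<lambda>z. f z - ?P N z)) \<longlonglongrightarrow> 0"
        using tendsto_mult_left[OF A2_poly_tendsto[OF p f], of "A2_norm p v"] by simp
    qed simp
    moreover have "A2_inner p v (\<lambda>z. f z - ?P N z) = A2_inner p v f - A2_inner p v (?P N)" for N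
      by (intro A2_inner_diff_right v A2_L2 p f disk_poly_A2)
    ultimately show "(\<lambda>N. A2_inner p v f - A2_inner p v (?P N)) \<longlonglongrightarrow> 0" by simp
  qed
  have "A2_inner p (bergman_proj p u) (?P N) = A2_inner p u (?P N)" for N
    unfolding A2_inner_poly_right[OF p u] A2_inner_poly_right[OF p A2_L2[OF p bergman_proj_A2(1)[OF p u]]]
    using bergman_weight_pos[OF p]
    by (intro sum.cong refl) (simp add: A2_inner_monom[OF p] bergman_proj_A2[OF p u] less_imp_neq[symmetric])
  then show ?thesis
    using lim[OF u] lim[OF A2_L2[OF p bergman_proj_A2(1)[OF p u]]] LIMSEQ_unique by simp
qed

section \<open>The adjoint of multiplication and the operator \<open>E\<close>\<close>

lemma Hinf1_D: 
  assumes "\<phi> \<in> Hinf1"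
  shows "\<phi> holomorphic_on unit_disk" "z \<in> unit_disk \<Longrightarrow> cmod (\<phi> z) \<le> 1"
  using assms by (auto simp: Hinf1_def)

lemma T_op_A2: "p > -1 \<Longrightarrow> \<phi> \<in> Hinf1 \<Longrightarrow> f \<in> A2 p \<Longrightarrow> T_op \<phi> f \<in> A2 p"
  unfolding T_op_def by (rule A2_mult_bounded(1)[where C=1]) (auto simp: Hinf1_def)

text \<open>The multiplier behind E. Restricting \<phi> by zero makes it Borel measurable on the
  whole plane and extends the bound by 1 beyond the disk.\<close>

definition defect :: "(complex \<Rightarrow> complex) \<Rightarrow> complex \<Rightarrow> complex" where
  "defect \<phi> z = of_real (1 - (cmod (disk_restrict \<phi> z))\<^sup>2)"

lemma defect_measurable: "\<phi> \<in> Hinf1 \<Longrightarrow> defect \<phi> \<in> borel_measurable borel"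
proof -
  assume "\<phi> \<in> Hinf1"
  then have [measurable]: "disk_restrict \<phi> \<in> borel_measurable borel"
    by (intro disk_fun_measurable disk_fun_disk_restrict Hinf1_D)
  show ?thesis unfolding defect_def[abs_def] by measurable
qed

lemma defect_bounded: "\<phi> \<in> Hinf1 \<Longrightarrow> cmod (defect \<phi> z) \<le> 1"
  unfolding defect_def norm_of_real
  by (auto simp: disk_restrict_def abs_le_iff power_le_one Hinf1_D intro: order_trans[of _ 0])

lemma L2_defect: "p > -1 \<Longrightarrow> \<phi> \<in> Hinf1 \<Longrightarrow> L2 p f \<Longrightarrow> L2 p (\<lambda>z. defect \<phi> z * f z)"
  by (rule L2_mult_bounded(1)[where C=1]) (auto simp: defect_measurable defect_bounded)

lemma A2_norm_defect_le: 
  assumes "p > -1" "\<phi> \<in> Hinf1" "L2 p f"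
  shows "A2_norm p (\<lambda>z. defect \<phi> z * f z) \<le> A2_norm p f"
  using L2_mult_bounded(2)[OF assms(1,3) defect_measurable[OF assms(2)] defect_bounded[OF assms(2)]]
  by (simp add: A2_norm_eq)

lemma A2_inner_defect_left:
  "A2_inner p (\<lambda>z. defect \<phi> z * f z) g = A2_inner p f (\<lambda>z. defect \<phi> z * g z)"
  by (simp add: A2_inner_def defect_def mult_ac)

text \<open>The definite description has to be shown meaningful: the Bergman projection of
  \<open>cnj \<phi> * g\<close> provides existence, and pairing the difference of two candidates
  with itself provides uniqueness.\<close>

lemma A2_adjoint_T_op:
  assumes p: "p > -1" and \<phi>: "\<phi> \<in> Hinf1" and g: "g \<in> A2 p"
  shows "A2_adjoint p (T_op \<phi>) g \<in> A2 p"
    "f \<in> A2 p \<Longrightarrow> A2_inner p (T_op \<phi> f) g = A2_inner p f (A2_adjoint p (T_op \<phi>) g)"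
proof -
  have [measurable]: "disk_restrict \<phi> \<in> borel_measurable borel"
    using \<phi> by (intro disk_fun_measurable disk_fun_disk_restrict Hinf1_D)
  define u where "u z = cnj (disk_restrict \<phi> z) * g z" for z
  have u: "L2 p u"
    unfolding u_def
    by (rule L2_mult_bounded(1)[where C=1, OF p A2_L2[OF p g]]) (measurable, simp add: disk_restrict_def Hinf1_D[OF \<phi>])
  have ip: "A2_inner p (T_op \<phi> f) g = A2_inner p f (bergman_proj p u)" if f: "f \<in> A2 p" for f
  proof -
    have "A2_inner p f (bergman_proj p u) = A2_inner p f u"
      using A2_inner_bergman_proj[OF p u f] by (simp add: A2_inner_commute[of p f])
    also have "\<dots> = A2_inner p (T_op \<phi> f) g"
      unfolding A2_inner_def using A2_disk_fun[OF f]
      by (intro Bochner_Integration.integral_cong) (auto simp: u_def T_op_def disk_restrict_def disk_fun_def)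
    finally show ?thesis ..
  qed
  have "A2_adjoint p (T_op \<phi>) g = bergman_proj p u"
    unfolding A2_adjoint_def
  proof (rule the_equality)
    show "bergman_proj p u \<in> A2 p \<and> (\<forall>f\<in>A2 p. A2_inner p (T_op \<phi> f) g = A2_inner p f (bergman_proj p u))"
      using ip bergman_proj_A2(1)[OF p u] by blast
  next
    fix h assume h: "h \<in> A2 p \<and> (\<forall>f\<in>A2 p. A2_inner p (T_op \<phi> f) g = A2_inner p f h)"
    define d where "d z = h z - bergman_proj p u z" for z
    have d: "d \<in> A2 p" unfolding d_def using h by (intro A2_diff p bergman_proj_A2 u) auto
    have "A2_inner p d d = A2_inner p d h - A2_inner p d (bergman_proj p u)"
      using h by (subst (2) d_def[abs_def], intro A2_inner_diff_right A2_L2[OF p] d bergman_proj_A2(1)[OF p u]) auto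
    also have "\<dots> = 0" using h ip[OF d] d by simp
    finally have "L2_norm_sq p d = 0" by (simp add: A2_inner_self)
    from A2_L2_norm_sq_zero[OF p d this] show "h = bergman_proj p u"
      by (simp add: d_def fun_eq_iff)
  qed
  then show "A2_adjoint p (T_op \<phi>) g \<in> A2 p"
    "f \<in> A2 p \<Longrightarrow> A2_inner p (T_op \<phi> f) g = A2_inner p f (A2_adjoint p (T_op \<phi>) g)"
    using ip bergman_proj_A2(1)[OF p u] by auto
qed

text \<open>Moving the adjoint across leaves the difference of the pairings of f, F and of \<phi> f,
  \<phi> F. From here on E is used through this weak form only.\<close>

lemma E_bar_A2:
  assumes p: "p > -1" and \<phi>: "\<phi> \<in> Hinf1" and f: "f \<in> A2 p"
  shows "E_bar_op p \<phi> f \<in> A2 p"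
    and "F \<in> A2 p \<Longrightarrow> A2_inner p (E_bar_op p \<phi> f) F = A2_inner p (\<lambda>z. defect \<phi> z * f z) F"
proof -
  note T = T_op_A2[OF p \<phi>]
  note adj = A2_adjoint_T_op[OF p \<phi> T[OF f]]
  show "E_bar_op p \<phi> f \<in> A2 p"
    unfolding E_bar_op_def by (intro A2_diff p f adj)
  assume F: "F \<in> A2 p"
  have "A2_inner p (E_bar_op p \<phi> f) F = A2_inner p f F - A2_inner p (A2_adjoint p (T_op \<phi>) (T_op \<phi> f)) F"
    unfolding E_bar_op_def by (intro A2_inner_diff_left A2_L2[OF p] f F adj)
  also have "A2_inner p (A2_adjoint p (T_op \<phi>) (T_op \<phi> f)) F = A2_inner p (T_op \<phi> f) (T_op \<phi> F)"
    using adj(2)[OF F] by (simp add: A2_inner_commute[of p _ F] A2_inner_commute[of p "T_op \<phi> f"])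
  also have "A2_inner p f F - A2_inner p (T_op \<phi> f) (T_op \<phi> F)
      = (\<integral>z. f z * cnj (F z) - T_op \<phi> f z * cnj (T_op \<phi> F z) \<partial>dA_weighted p)"
    unfolding A2_inner_def
    by (intro Bochner_Integration.integral_diff[symmetric] L2_inner_integrable A2_L2[OF p] f F T)
  also have "\<dots> = A2_inner p (\<lambda>z. defect \<phi> z * f z) F"
    unfolding A2_inner_def
  proof (intro Bochner_Integration.integral_cong refl)
    fix z
    show "f z * cnj (F z) - T_op \<phi> f z * cnj (T_op \<phi> F z) = defect \<phi> z * f z * cnj (F z)"
    proof (cases "z \<in> unit_disk")
      case True
      then have d: "defect \<phi> z = 1 - \<phi> z * cnj (\<phi> z)"
        by (simp only: defect_def disk_restrict_def of_real_diff complex_norm_square of_real_1 if_True)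
      show ?thesis by (simp add: T_op_def d) (simp add: algebra_simps)
    next
      case False
      then have "f z = 0" using A2_disk_fun[OF f] by (simp add: disk_fun_def)
      then show ?thesis by (simp add: T_op_def)
    qed
  qed
  finally show "A2_inner p (E_bar_op p \<phi> f) F = A2_inner p (\<lambda>z. defect \<phi> z * f z) F" .
qed

lemma taylor_coeff_E_bar:
  assumes p: "p > -1" and \<phi>: "\<phi> \<in> Hinf1" and f: "f \<in> A2 p"
  shows "taylor_coeff (E_bar_op p \<phi> f) n * of_real (bergman_weight p n) = A2_inner p (\<lambda>z. defect \<phi> z * f z) (monom_fun n)"
  using A2_inner_monom[OF p E_bar_A2(1)[OF p \<phi> f], of n] E_bar_A2(2)[OF p \<phi> f monom_A2[OF p, of n]] by simp

text \<open>Fatou's lemma for sequence spaces: each finite coefficient sum passes to the limit below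
  C, and then the number of terms tends to infinity. This is how weak limits are produced as
  functions.\<close>

lemma A2_fatou:
  assumes p: "p > -1" and g: "\<And>j. g j \<in> A2 p" and C: "\<And>j. L2_norm_sq p (g j) \<le> C"
    and lim: "\<And>n. (\<lambda>j. taylor_coeff (g j) n) \<longlonglongrightarrow> c n"
  shows "disk_series c \<in> A2 p" "taylor_coeff (disk_series c) n = c n" "L2_norm_sq p (disk_series c) \<le> C"
proof -
  have le: "(\<Sum>n<N. (cmod (c n))\<^sup>2 * bergman_weight p n) \<le> C" for N
  proof (rule LIMSEQ_le_const2)
    show "(\<lambda>j. \<Sum>n<N. (cmod (taylor_coeff (g j) n))\<^sup>2 * bergman_weight p n) \<longlonglongrightarrow> (\<Sum>n<N. (cmod (c n))\<^sup>2 * bergman_weight p n)"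
      by (intro tendsto_intros lim)
    show "\<exists>N'. \<forall>j\<ge>N'. (\<Sum>n<N. (cmod (taylor_coeff (g j) n))\<^sup>2 * bergman_weight p n) \<le> C"
      using A2_coeff_sum_le_L2_norm_sq[OF p g] C order_trans by blast
  qed
  then have sm: "summable (\<lambda>n. (cmod (c n))\<^sup>2 * bergman_weight p n)"
    using bergman_weight_pos[OF p] by (intro summableI_nonneg_bounded[of _ C]) (auto simp: less_imp_le)
  note fn = disk_series_A2[OF p sm]
  show "disk_series c \<in> A2 p" "taylor_coeff (disk_series c) n = c n" by (fact fn)+
  have "L2_norm_sq p (disk_series c) = (\<Sum>n. (cmod (c n))\<^sup>2 * bergman_weight p n)"
    using A2_L2_norm_sq_sums[OF p fn(1)] by (simp add: fn(2) sums_iff)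
  also have "\<dots> \<le> C" by (rule suminf_le_const[OF sm le])
  finally show "L2_norm_sq p (disk_series c) \<le> C" .
qed

text \<open>For bounded sequences, coefficientwise convergence to 0 is weak convergence to 0:
  replace g by a Taylor polynomial, against which only finitely many coefficients count.\<close>

lemma A2_weakly_null:
  assumes p: "p > -1" and g: "g \<in> A2 p" and x: "\<And>j. x j \<in> A2 p" and C: "\<And>j. A2_norm p (x j) \<le> C"
    and lim: "\<And>n. (\<lambda>j. taylor_coeff (x j) n) \<longlonglongrightarrow> 0"
  shows "(\<lambda>j. A2_inner p g (x j)) \<longlonglongrightarrow> 0"
proof (rule LIMSEQ_I)
  fix e :: real assume e: "e > 0"
  have C0: "0 \<le> C" using C[of 0] order_trans[OF A2_norm_nonneg] by blast
  \<comment> \<open>Using C + 1 avoids a separate case for C = 0.\<close>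
  have "eventually (\<lambda>N. A2_norm p (\<lambda>z. g z - disk_poly N (taylor_coeff g) z) < e / (2 * (C + 1))) sequentially"
    using A2_poly_tendsto[OF p g] e C0 by (intro order_tendstoD(2)) auto
  then obtain N where N: "A2_norm p (\<lambda>z. g z - disk_poly N (taylor_coeff g) z) < e / (2 * (C + 1))"
    by (auto simp: eventually_sequentially)
  let ?P = "disk_poly N (taylor_coeff g)"
  have "(\<lambda>j. cnj (\<Sum>n<N. cnj (taylor_coeff g n) * (taylor_coeff (x j) n * of_real (bergman_weight p n)))) \<longlonglongrightarrow> cnj (\<Sum>n<N. cnj (taylor_coeff g n) * (0 * of_real (bergman_weight p n)))"
    by (intro tendsto_intros lim)
  moreover have "A2_inner p ?P (x j) = cnj (\<Sum>n<N. cnj (taylor_coeff g n) * (taylor_coeff (x j) n * of_real (bergman_weight p n)))" for j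
    unfolding A2_inner_commute[of p ?P] A2_inner_poly_right[OF p A2_L2[OF p x]] A2_inner_monom[OF p x] ..
  ultimately have "(\<lambda>j. A2_inner p ?P (x j)) \<longlonglongrightarrow> 0" by simp
  from LIMSEQ_D[OF this, of "e / 2"] e obtain J where J: "\<And>j. j \<ge> J \<Longrightarrow> cmod (A2_inner p ?P (x j)) < e / 2"
    by auto
  show "\<exists>no. \<forall>j\<ge>no. norm (A2_inner p g (x j) - 0) < e"
  proof (intro exI[of _ J] allI impI)
    fix j assume j: "j \<ge> J"
    have "A2_inner p (\<lambda>z. g z - ?P z) (x j) = A2_inner p g (x j) - A2_inner p ?P (x j)"
      by (intro A2_inner_diff_left A2_L2[OF p] g x disk_poly_A2 p)
    moreover have "cmod (A2_inner p (\<lambda>z. g z - ?P z) (x j)) \<le> e / 2"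
    proof -
      have "cmod (A2_inner p (\<lambda>z. g z - ?P z) (x j)) \<le> A2_norm p (\<lambda>z. g z - ?P z) * A2_norm p (x j)"
        by (intro A2_cauchy_schwarz A2_L2[OF p] A2_diff[OF p] g x disk_poly_A2 p)
      also have "\<dots> \<le> (e / (2 * (C + 1))) * (C + 1)"
        using N C[of j] e C0 by (intro mult_mono) auto
      also have "\<dots> = e / 2" using C0 by (simp add: field_simps)
      finally show ?thesis .
    qed
    moreover have "cmod (A2_inner p g (x j)) \<le> cmod (A2_inner p ?P (x j)) + cmod (A2_inner p g (x j) - A2_inner p ?P (x j))"
      using norm_triangle_sub by blast
    ultimately show "norm (A2_inner p g (x j) - 0) < e" using J[OF j] by simp
  qed
qed

section \<open>Blaschke products and boundary behaviour\<close>

definition moebius :: "complex \<Rightarrow> complex \<Rightarrow> complex" where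
  "moebius a z = (a - z) / (1 - cnj a * z)"

lemma one_minus_cnj_mult_bounds:
  assumes "cmod a < 1" "cmod z \<le> 1"
  shows "1 - cmod a \<le> cmod (1 - cnj a * z)" "cmod (1 - cnj a * z) \<le> 2" "1 - cnj a * z \<noteq> 0"
proof -
  have az: "cmod (cnj a * z) \<le> cmod a"
    using assms by (simp add: norm_mult mult_left_le)
  show 1: "1 - cmod a \<le> cmod (1 - cnj a * z)"
    using norm_triangle_ineq2[of 1 "cnj a * z"] az by simp
  show "cmod (1 - cnj a * z) \<le> 2"
    using norm_triangle_ineq4[of 1 "cnj a * z"] az assms by simp
  show "1 - cnj a * z \<noteq> 0" using 1 assms by auto
qed

lemma one_minus_moebius_square:
  assumes "1 - cnj a * z \<noteq> 0"
  shows "1 - (cmod (moebius a z))\<^sup>2 = (1 - (cmod a)\<^sup>2) * (1 - (cmod z)\<^sup>2) / (cmod (1 - cnj a * z))\<^sup>2"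
proof -
  have "(cmod (1 - cnj a * z))\<^sup>2 - (cmod (a - z))\<^sup>2 = (1 - (cmod a)\<^sup>2) * (1 - (cmod z)\<^sup>2)"
    unfolding cmod_power2 by (simp add: power2_eq_square algebra_simps)
  moreover have "(cmod (1 - cnj a * z))\<^sup>2 \<noteq> 0" using assms by simp
  ultimately show ?thesis
    unfolding moebius_def norm_divide power_divide by (simp add: field_simps)
qed

lemma moebius_norm_le:
  assumes "cmod a < 1" "cmod z < 1"
  shows "cmod (moebius a z) \<le> 1"
proof -
  have "0 \<le> (1 - (cmod a)\<^sup>2) * (1 - (cmod z)\<^sup>2) / (cmod (1 - cnj a * z))\<^sup>2"
    using assms by (simp add: power_le_one)
  then have "(cmod (moebius a z))\<^sup>2 \<le> 1"
    using one_minus_moebius_square[of a z] one_minus_cnj_mult_bounds(3)[of a z] assms by simp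
  then show ?thesis by (simp add: abs_square_le_1)
qed

text \<open>Uniform in the zero a: at a fixed point z, each factor with a zero of modulus at most
  \<rho> loses a fixed amount below 1. This later bounds the number of factors. The 4 is the bound
  for |1 - cnj a z|^2.\<close>

lemma moebius_norm_le_strict:
  assumes "cmod a \<le> \<rho>" "\<rho> < 1" "cmod z < 1"
  shows "(cmod (moebius a z))\<^sup>2 \<le> 1 - (1 - \<rho>\<^sup>2) * (1 - (cmod z)\<^sup>2) / 4"
proof -
  have a: "cmod a < 1" using assms by simp
  have "0 \<le> \<rho>" using assms(1) norm_ge_zero order_trans by blast
  have n: "0 < (cmod (1 - cnj a * z))\<^sup>2" "(cmod (1 - cnj a * z))\<^sup>2 \<le> 4"
    using one_minus_cnj_mult_bounds[OF a, of z] assms power_mono[of "cmod (1 - cnj a * z)" 2 2] by auto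
  have "(1 - \<rho>\<^sup>2) * (1 - (cmod z)\<^sup>2) / 4 \<le> (1 - (cmod a)\<^sup>2) * (1 - (cmod z)\<^sup>2) / (cmod (1 - cnj a * z))\<^sup>2"
  proof (intro frac_le mult_mono mult_nonneg_nonneg)
    show "1 - \<rho>\<^sup>2 \<le> 1 - (cmod a)\<^sup>2" using assms by (simp add: power_mono)
    show "0 \<le> 1 - (cmod a)\<^sup>2" using a by (simp add: power_le_one)
  qed (use n assms in \<open>auto simp: power_le_one\<close>)
  moreover have "1 - (cmod (moebius a z))\<^sup>2 = (1 - (cmod a)\<^sup>2) * (1 - (cmod z)\<^sup>2) / (cmod (1 - cnj a * z))\<^sup>2"
    using one_minus_cnj_mult_bounds(3)[OF a, of z] assms by (intro one_minus_moebius_square) auto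
  ultimately show ?thesis by linarith
qed

lemma moebius_boundary:
  assumes a: "cmod a < 1" and r: "r < 1"
  shows "\<exists>\<rho><1. \<forall>z. \<rho> < cmod z \<and> cmod z < 1 \<longrightarrow> r < cmod (moebius a z)"
proof -
  \<comment> \<open>From 1 - |z|^2 \<le> 2 (1 - |z|) and |1 - cnj a z| \<ge> 1 - |a|, the quantity 1
    - |moebius a z|^2 is at most K (1 - |z|). The radius \<rho> below is where this bound reaches 1
    - r'^2.\<close>
  define K where "K = 2 / (1 - cmod a)\<^sup>2"
  have K: "K > 0" using a by (simp add: K_def)
  define r' where "r' = max 0 r"
  have r': "0 \<le> r'" "r' < 1" "r \<le> r'" using r by (auto simp: r'_def)
  define \<rho> where "\<rho> = 1 - (1 - r'\<^sup>2) / K"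
  have r2: "r'\<^sup>2 < 1" using r' by (simp add: abs_square_less_1)
  have "r < cmod (moebius a z)" if z: "\<rho> < cmod z" "cmod z < 1" for z
  proof -
    have n: "(1 - cmod a)\<^sup>2 \<le> (cmod (1 - cnj a * z))\<^sup>2"
      using one_minus_cnj_mult_bounds(1)[OF a, of z] z a by (intro power_mono) auto
    have "1 - (cmod z)\<^sup>2 = (1 - cmod z) * (1 + cmod z)"
      by (simp add: power2_eq_square algebra_simps)
    also have "\<dots> \<le> (1 - cmod z) * 2"
      using z by (intro mult_left_mono) auto
    finally have z2: "1 - (cmod z)\<^sup>2 \<le> (1 - cmod z) * 2" .
    have "(1 - (cmod a)\<^sup>2) * (1 - (cmod z)\<^sup>2) / (cmod (1 - cnj a * z))\<^sup>2 \<le> 1 * ((1 - cmod z) * 2) / (1 - cmod a)\<^sup>2"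
      using z2 n a z by (intro frac_le mult_mono) (auto simp: power_le_one)
    also have "\<dots> = (1 - cmod z) * K" by (simp add: K_def)
    also have "\<dots> < 1 - r'\<^sup>2"
      using z K unfolding \<rho>_def by (simp add: field_simps)
    finally have "r'\<^sup>2 < (cmod (moebius a z))\<^sup>2"
      using one_minus_moebius_square[of a z] one_minus_cnj_mult_bounds(3)[OF a, of z] z by simp
    then have "r' < cmod (moebius a z)"
      by (rule power2_less_imp_less) simp
    then show ?thesis using r' by simp
  qed
  moreover have "\<rho> < 1" using K r2 by (simp add: \<rho>_def)
  ultimately show ?thesis by blast
qed

text \<open>The maximum principle on circles of radius close to 1, since h need not have boundary
  values.\<close>

lemma bounded_from_boundary:
  assumes h: "h holomorphic_on unit_disk"
    and bd: "\<And>e. e > 0 \<Longrightarrow> \<exists>\<rho><1. \<forall>z. \<rho> < cmod z \<and> cmod z < 1 \<longrightarrow> cmod (h z) \<le> 1 + e"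
    and z: "z \<in> unit_disk"
  shows "cmod (h z) \<le> 1"
proof (rule field_le_epsilon)
  fix e :: real assume "e > 0"
  from bd[OF this] obtain \<rho> where \<rho>: "\<rho> < 1" "\<And>z. \<rho> < cmod z \<Longrightarrow> cmod z < 1 \<Longrightarrow> cmod (h z) \<le> 1 + e" by auto
  define s where "s = (max (max \<rho> 0) (cmod z) + 1) / 2"
  have s: "\<rho> < s" "cmod z < s" "s < 1" "0 < s"
    using \<rho>(1) z norm_ge_zero[of z] unfolding s_def by (auto simp: max_def simp del: norm_ge_zero)
  show "cmod (h z) \<le> 1 + e"
  proof (rule maximum_modulus_frontier[of h "ball 0 s"])
    show "h holomorphic_on interior (ball 0 s)"
      using s by (intro holomorphic_on_subset[OF h]) auto
    show "continuous_on (closure (ball 0 s)) h"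
      using s by (intro holomorphic_on_imp_continuous_on holomorphic_on_subset[OF h]) auto
    fix w :: complex assume "w \<in> frontier (ball 0 s)"
    then have "cmod w = s" using s by (simp add: frontier_ball)
    then show "cmod (h w) \<le> 1 + e" using \<rho>(2) s by simp
  qed (use s in auto)
qed

text \<open>A zero can be divided out without increasing the supremum, because the modulus of the
  Moebius factor tends to 1 at the circle.\<close>

lemma moebius_factor:
  assumes g: "g holomorphic_on unit_disk" and a: "a \<in> unit_disk" "g a = 0"
    and le: "\<And>z. z \<in> unit_disk \<Longrightarrow> cmod (g z) \<le> 1"
  obtains h where "h holomorphic_on unit_disk" "\<And>z. z \<in> unit_disk \<Longrightarrow> g z = moebius a z * h z"
    "\<And>z. z \<in> unit_disk \<Longrightarrow> cmod (h z) \<le> 1"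
proof -
  \<comment> \<open>The difference quotient, completed at a by the derivative, is holomorphic by
    removal of the singularity.\<close>
  define h0 where "h0 z = (if z = a then deriv g a else (g z - g a) / (z - a))" for z
  have h0: "h0 holomorphic_on unit_disk"
    unfolding h0_def by (rule pole_lemma_open[OF g]) simp
  define h where "h z = - (1 - cnj a * z) * h0 z" for z
  have h: "h holomorphic_on unit_disk"
    unfolding h_def by (intro holomorphic_intros h0)
  have eq: "g z = moebius a z * h z" if "z \<in> unit_disk" for z
  proof (cases "z = a")
    case False
    have *: "(a - z) / D * (- D * (G / (z - a))) = G" if "D \<noteq> 0" for D G
      using that False by (simp add: divide_simps) (simp add: algebra_simps)
    have "1 - cnj a * z \<noteq> 0"
      using one_minus_cnj_mult_bounds(3)[of a z] a \<open>z \<in> unit_disk\<close> by simp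
    from *[OF this, of "g z"] show ?thesis
      using False a by (simp add: h_def h0_def moebius_def)
  qed (simp add: moebius_def a)
  have "cmod (h z) \<le> 1" if "z \<in> unit_disk" for z
  proof (rule bounded_from_boundary[OF h _ that])
    fix e :: real assume e: "e > 0"
    have "1 / (1 + e) < 1" using e by simp
    from moebius_boundary[OF _ this, of a] a(1)
    obtain \<rho> where \<rho>: "\<rho> < 1" "\<And>z. \<rho> < cmod z \<Longrightarrow> cmod z < 1 \<Longrightarrow> 1 / (1 + e) < cmod (moebius a z)" by auto
    show "\<exists>\<rho><1. \<forall>z. \<rho> < cmod z \<and> cmod z < 1 \<longrightarrow> cmod (h z) \<le> 1 + e"
    proof (intro exI[of _ \<rho>] conjI \<rho>(1) allI impI)
      fix z assume z: "\<rho> < cmod z \<and> cmod z < 1"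
      have "1 / (1 + e) * cmod (h z) \<le> cmod (moebius a z) * cmod (h z)"
        using \<rho>(2)[of z] z by (intro mult_right_mono) auto
      also have "\<dots> = cmod (g z)" using eq[of z] z by (simp add: norm_mult)
      also have "\<dots> \<le> 1" using le z by simp
      finally show "cmod (h z) \<le> 1 + e" using e by (simp add: field_simps)
    qed
  qed
  with h eq show ?thesis by (rule that)
qed

definition blaschke_prod :: "complex list \<Rightarrow> complex \<Rightarrow> complex" where
  "blaschke_prod as z = (\<Prod>a\<leftarrow>as. moebius a z)"

lemma blaschke_prod_simps [simp]:
  "blaschke_prod [] z = 1" "blaschke_prod (a # as) z = moebius a z * blaschke_prod as z"
  by (simp_all add: blaschke_prod_def)

lemma finite_Blaschke_product_iff:
  "finite_Blaschke_product \<phi> \<longleftrightarrow>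
     (\<exists>c as. cmod c = 1 \<and> set as \<subseteq> unit_disk \<and> (\<forall>z\<in>unit_disk. \<phi> z = c * blaschke_prod as z))"
  by (simp add: finite_Blaschke_product_def blaschke_prod_def moebius_def)

lemma blaschke_prod_norm_le: "set as \<subseteq> unit_disk \<Longrightarrow> z \<in> unit_disk \<Longrightarrow> cmod (blaschke_prod as z) \<le> 1"
  by (induction as) (auto simp: norm_mult intro!: mult_le_one moebius_norm_le)

text \<open>Split off as many zeros as possible. The remaining quotient g has no zero, so the
  maximum principle applies to 1 / g too; both have modulus at most 1 and g is a unimodular
  constant. A maximum exists because each zero lowers the value at a fixed point, where |\<phi>|
  exceeds 1/2.\<close>

lemma finite_Blaschke_productI:
  assumes \<phi>: "\<phi> \<in> Hinf1"
    and bd: "\<And>r. r < 1 \<Longrightarrow> \<exists>\<rho><1. \<forall>z. \<rho> < cmod z \<and> cmod z < 1 \<longrightarrow> r < cmod (\<phi> z)"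
  shows "finite_Blaschke_product \<phi>"
proof -
  \<comment> \<open>The pairs of a list of zeros already split off and the bounded quotient that is
    left.\<close>
  define P where "P = (\<lambda>(as, g). set as \<subseteq> unit_disk \<and> g holomorphic_on unit_disk \<and>
     (\<forall>z\<in>unit_disk. cmod (g z) \<le> 1 \<and> \<phi> z = blaschke_prod as z * g z))"
  have "P ([], \<phi>)" using \<phi> by (simp add: P_def Hinf1_def)
  from bd[of "1/2"] obtain \<rho>0 where \<rho>0: "\<rho>0 < 1" "\<And>z. \<rho>0 < cmod z \<Longrightarrow> cmod z < 1 \<Longrightarrow> 1/2 < cmod (\<phi> z)" by auto
  define \<rho> where "\<rho> = max 0 \<rho>0"
  have \<rho>: "0 \<le> \<rho>" "\<rho> < 1" "\<And>z. \<rho> < cmod z \<Longrightarrow> cmod z < 1 \<Longrightarrow> 1/2 < cmod (\<phi> z)"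
    using \<rho>0 by (auto simp: \<rho>_def)
  \<comment> \<open>A point beyond \<rho>, so that |\<phi>| > 1/2 there, at which the loss caused by
    every zero is measured.\<close>
  define z0 where "z0 = complex_of_real ((\<rho> + 1) / 2)"
  have z0: "cmod z0 = (\<rho> + 1) / 2" using \<rho> unfolding z0_def by (subst norm_of_real) auto
  have \<phi>0: "1/2 < cmod (\<phi> z0)" using \<rho> z0 by (intro \<rho>(3)) auto
  have z0d: "z0 \<in> unit_disk" "cmod z0 < 1" using z0 \<rho> by auto
  define \<kappa> where "\<kappa> = (1 - \<rho>\<^sup>2) * (1 - (cmod z0)\<^sup>2) / 4"
  have \<kappa>: "0 < \<kappa>" "\<kappa> \<le> 1"
  proof -
    have "0 < 1 - \<rho>\<^sup>2" "0 < 1 - (cmod z0)\<^sup>2"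
      using \<rho> z0d by (auto simp: abs_square_less_1)
    then show "0 < \<kappa>" by (simp add: \<kappa>_def)
    have "(1 - \<rho>\<^sup>2) * (1 - (cmod z0)\<^sup>2) \<le> 1"
      using \<open>0 < 1 - \<rho>\<^sup>2\<close> \<open>0 < 1 - (cmod z0)\<^sup>2\<close> by (intro mult_le_one) auto
    then show "\<kappa> \<le> 1" by (simp add: \<kappa>_def)
  qed
  \<comment> \<open>All zeros have modulus at most \<rho>, as |\<phi>| > 1/2 farther out. Each
    contributes a factor of at most 1 - \<kappa> to the squared modulus at z0, which must stay above
    (1/2)^2.\<close>
  have len: "1/4 < (1 - \<kappa>) ^ length (fst y)" if "P y" for y
  proof -
    obtain as g where y: "y = (as, g)" by fastforce
    have as: "set as \<subseteq> unit_disk" and g: "\<And>z. z \<in> unit_disk \<Longrightarrow> cmod (g z) \<le> 1"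
      and eq: "\<And>z. z \<in> unit_disk \<Longrightarrow> \<phi> z = blaschke_prod as z * g z"
      using that by (auto simp: P_def y)
    have as\<rho>: "cmod a \<le> \<rho>" if "a \<in> set as" for a
    proof (rule ccontr)
      assume "\<not> cmod a \<le> \<rho>"
      moreover have "cmod a < 1" using as that by auto
      ultimately have "1/2 < cmod (\<phi> a)" by (intro \<rho>(3)) auto
      moreover have "blaschke_prod as a = 0"
        using that by (auto simp: blaschke_prod_def prod_list_zero_iff moebius_def intro!: image_eqI[of _ _ a])
      ultimately show False using eq[of a] \<open>cmod a < 1\<close> by simp
    qed
    have "(cmod (blaschke_prod as z0))\<^sup>2 \<le> (1 - \<kappa>) ^ length as"
      using as\<rho>
    proof (induction as)
      case (Cons a as)
      have "(cmod (moebius a z0))\<^sup>2 \<le> 1 - \<kappa>"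
        unfolding \<kappa>_def using Cons.prems z0d \<rho>(2) by (intro moebius_norm_le_strict) auto
      then show ?case
        using Cons \<kappa> by (simp add: norm_mult power_mult_distrib mult_mono)
    qed simp
    moreover have "cmod (\<phi> z0) \<le> cmod (blaschke_prod as z0)"
      using g[OF z0d(1)] by (simp add: eq[OF z0d(1)] norm_mult mult_left_le)
    then have "(1/2)\<^sup>2 < (cmod (blaschke_prod as z0))\<^sup>2"
      using \<phi>0 by (intro power_strict_mono) auto
    ultimately show ?thesis by (simp add: y power2_eq_square)
  qed
  obtain b where b: "(1 - \<kappa>) ^ b < 1/4"
    using real_arch_pow_inv[of "1/4" "1 - \<kappa>"] \<kappa> by auto
  have "length (fst y) < b" if "P y" for y
  proof (rule ccontr)
    assume "\<not> length (fst y) < b"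
    then have "(1 - \<kappa>) ^ length (fst y) \<le> (1 - \<kappa>) ^ b"
      using \<kappa> by (intro power_decreasing) auto
    then show False using len[OF that] b by simp
  qed
  then have "\<exists>x. P x \<and> (\<forall>y. P y \<longrightarrow> length (fst y) \<le> length (fst x))"
    using ex_has_greatest_nat[of P "([], \<phi>)" "\<lambda>y. length (fst y)" b] \<open>P ([], \<phi>)\<close> by blast
  then obtain as g where P: "P (as, g)" and max: "\<And>y. P y \<Longrightarrow> length (fst y) \<le> length as"
    by fastforce
  have as: "set as \<subseteq> unit_disk" and g: "g holomorphic_on unit_disk"
    and gle: "\<And>z. z \<in> unit_disk \<Longrightarrow> cmod (g z) \<le> 1"
    and eq: "\<And>z. z \<in> unit_disk \<Longrightarrow> \<phi> z = blaschke_prod as z * g z"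
    using P by (auto simp: P_def)
  have nz: "g a \<noteq> 0" if a: "a \<in> unit_disk" for a
  proof
    assume "g a = 0"
    obtain h where h: "h holomorphic_on unit_disk" "\<And>z. z \<in> unit_disk \<Longrightarrow> g z = moebius a z * h z"
      "\<And>z. z \<in> unit_disk \<Longrightarrow> cmod (h z) \<le> 1"
      using moebius_factor[OF g a \<open>g a = 0\<close> gle] by blast
    have "P (a # as, h)"
      using h eq as a by (simp add: P_def mult_ac)
    from max[OF this] show False by simp
  qed
  \<comment> \<open>Near the circle |g| \<ge> |\<phi>|, because the split-off product has modulus at
    most 1; hence 1 / g is almost bounded by 1 there.\<close>
  have ginv: "cmod (1 / g z) \<le> 1" if "z \<in> unit_disk" for z
  proof (rule bounded_from_boundary[OF _ _ that])
    show "(\<lambda>z. 1 / g z) holomorphic_on unit_disk"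
      using nz by (intro holomorphic_intros g) auto
    fix e :: real assume e: "e > 0"
    have "1 / (1 + e) < 1" using e by simp
    from bd[OF this] obtain \<rho> where \<rho>: "\<rho> < 1" "\<And>z. \<rho> < cmod z \<Longrightarrow> cmod z < 1 \<Longrightarrow> 1 / (1 + e) < cmod (\<phi> z)" by auto
    show "\<exists>\<rho><1. \<forall>z. \<rho> < cmod z \<and> cmod z < 1 \<longrightarrow> cmod (1 / g z) \<le> 1 + e"
    proof (intro exI[of _ \<rho>] conjI \<rho>(1) allI impI)
      fix z assume z: "\<rho> < cmod z \<and> cmod z < 1"
      have "1 / (1 + e) < cmod (\<phi> z)" using \<rho>(2) z by auto
      also have "\<dots> \<le> cmod (g z)"
        using blaschke_prod_norm_le[OF as, of z] z by (simp add: eq norm_mult mult_left_le_one_le)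
      finally show "cmod (1 / g z) \<le> 1 + e"
        using e nz[of z] z by (simp add: norm_divide field_simps)
    qed
  qed
  have g1: "cmod (g z) = 1" if "z \<in> unit_disk" for z
    using gle[OF that] ginv[OF that] nz[OF that] by (simp add: norm_divide field_simps)
  have "g constant_on unit_disk"
    by (rule maximum_modulus_principle[OF g _ _ _ order_refl, of 0]) (auto simp: g1)
  then obtain c where c: "\<And>z. z \<in> unit_disk \<Longrightarrow> g z = c" by (auto simp: constant_on_def)
  have "cmod c = 1" using g1[of 0] c[of 0] by simp
  then show ?thesis
    unfolding finite_Blaschke_product_iff using as eq c by (auto simp: mult.commute)
qed

section \<open>Reproducing kernels\<close>

text \<open>The reproducing kernel at a, given by its coefficients so that membership and norm can
  be read off; the closed form with exponent -(p + 2) is derived from the binomial series.\<close>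

definition bergman_kernel :: "real \<Rightarrow> complex \<Rightarrow> complex \<Rightarrow> complex" where
  "bergman_kernel p a = disk_series (\<lambda>n. cnj a ^ n / of_real (bergman_weight p n))"

lemma bergman_kernel:
  assumes p: "p > -1" and a: "cmod a < 1"
  shows "bergman_kernel p a \<in> A2 p" "taylor_coeff (bergman_kernel p a) n = cnj a ^ n / of_real (bergman_weight p n)"
    "L2_norm_sq p (bergman_kernel p a) = (1 - (cmod a)\<^sup>2) powr (- (p + 2))"
    "z \<in> unit_disk \<Longrightarrow> bergman_kernel p a z = (1 - cnj a * z) powr (- of_real (p + 2))"
proof -
  let ?c = "\<lambda>n. cnj a ^ n / of_real (bergman_weight p n)"
  have a2: "(cmod a)\<^sup>2 < 1" using a by (simp add: abs_square_less_1)
  then have "cmod (of_real ((cmod a)\<^sup>2)) < 1" by (simp only: norm_of_real) simp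
  from inverse_bergman_weight_sums[OF p this]
  have "(\<lambda>n. complex_of_real (1 / bergman_weight p n * ((cmod a)\<^sup>2) ^ n)) sums complex_of_real ((1 - (cmod a)\<^sup>2) powr (- (p + 2)))"
    using a2 by (simp add: powr_of_real[symmetric])
  then have "(\<lambda>n. 1 / bergman_weight p n * ((cmod a)\<^sup>2) ^ n) sums ((1 - (cmod a)\<^sup>2) powr (- (p + 2)))"
    by (simp only: sums_of_real_iff)
  moreover have "1 / bergman_weight p n * ((cmod a)\<^sup>2) ^ n = (cmod (?c n))\<^sup>2 * bergman_weight p n" for n
    using bergman_weight_pos[OF p, of n]
    by (simp add: norm_divide norm_power power_divide power_mult[symmetric] mult.commute power2_eq_square[of "bergman_weight p n"])
  ultimately have s: "(\<lambda>n. (cmod (?c n))\<^sup>2 * bergman_weight p n) sums ((1 - (cmod a)\<^sup>2) powr (- (p + 2)))"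
    by simp
  note f = disk_series_A2[OF p sums_summable[OF s]]
  show K: "bergman_kernel p a \<in> A2 p" and taylor_coeff: "taylor_coeff (bergman_kernel p a) n = ?c n" for n
    unfolding bergman_kernel_def by (fact f)+
  show "L2_norm_sq p (bergman_kernel p a) = (1 - (cmod a)\<^sup>2) powr (- (p + 2))"
    using A2_L2_norm_sq_sums[OF p K] s unfolding taylor_coeff by (rule sums_unique2)
  assume z: "z \<in> unit_disk"
  have "cmod (cnj a * z) < 1"
  proof -
    have "cmod a * cmod z \<le> cmod a * 1" using z by (intro mult_left_mono) auto
    then show ?thesis using a by (simp add: norm_mult)
  qed
  from inverse_bergman_weight_sums[OF p this]
  have "(\<lambda>n. taylor_coeff (bergman_kernel p a) n * z ^ n) sums (1 - cnj a * z) powr (- of_real (p + 2))"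
    by (simp add: taylor_coeff power_mult_distrib)
  then show "bergman_kernel p a z = (1 - cnj a * z) powr (- of_real (p + 2))"
    using disk_fun_sums[OF A2_disk_fun[OF K] z] sums_unique2 by blast
qed

definition normalized_kernel :: "real \<Rightarrow> complex \<Rightarrow> complex \<Rightarrow> complex" where
  "normalized_kernel p a z = of_real ((1 - (cmod a)\<^sup>2) powr ((p + 2) / 2)) * bergman_kernel p a z"

text \<open>The coefficient bound shows that the kernels become weakly null as a approaches the
  circle, since its numerator tends to 0 for fixed n. The pointwise formula is needed for lower
  bounds near a.\<close>

lemma normalized_kernel:
  assumes p: "p > -1" and a: "cmod a < 1"
  shows "normalized_kernel p a \<in> A2 p" "A2_norm p (normalized_kernel p a) = 1"
    "cmod (taylor_coeff (normalized_kernel p a) n) \<le> (1 - (cmod a)\<^sup>2) powr ((p + 2) / 2) / bergman_weight p n"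
    "z \<in> unit_disk \<Longrightarrow> (cmod (normalized_kernel p a z))\<^sup>2
       = (1 - (cmod a)\<^sup>2) powr (p + 2) * cmod (1 - cnj a * z) powr (- (2 * (p + 2)))"
proof -
  note K = bergman_kernel[OF p a]
  have a2: "0 < 1 - (cmod a)\<^sup>2" using a by (simp add: abs_square_less_1)
  show "normalized_kernel p a \<in> A2 p"
    unfolding normalized_kernel_def[abs_def] by (intro A2_scale p K)
  have sq: "((1 - (cmod a)\<^sup>2) powr ((p + 2) / 2))\<^sup>2 = (1 - (cmod a)\<^sup>2) powr (p + 2)"
    by (simp add: power2_eq_square powr_add[symmetric])
  have "L2_norm_sq p (normalized_kernel p a) = (1 - (cmod a)\<^sup>2) powr (p + 2) * (1 - (cmod a)\<^sup>2) powr (- (p + 2))"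
    unfolding normalized_kernel_def[abs_def] L2_norm_sq_scale K(3) norm_of_real power2_abs sq ..
  also have "\<dots> = 1" using a2 by (subst powr_add[symmetric]) auto
  finally show "A2_norm p (normalized_kernel p a) = 1" by (simp add: A2_norm_eq)
  have "cmod (taylor_coeff (normalized_kernel p a) n) = (1 - (cmod a)\<^sup>2) powr ((p + 2) / 2) * cmod a ^ n / bergman_weight p n"
    using bergman_weight_pos[OF p, of n]
    unfolding normalized_kernel_def[abs_def] taylor_coeff_scale[OF A2_disk_fun[OF K(1)]] K(2)
    by (simp add: norm_mult norm_divide norm_power)
  also have "\<dots> \<le> (1 - (cmod a)\<^sup>2) powr ((p + 2) / 2) / bergman_weight p n"
    using bergman_weight_pos[OF p, of n] a by (intro divide_right_mono mult_left_le) (auto simp: power_le_one)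
  finally show "cmod (taylor_coeff (normalized_kernel p a) n) \<le> (1 - (cmod a)\<^sup>2) powr ((p + 2) / 2) / bergman_weight p n" .
  assume z: "z \<in> unit_disk"
  have "cmod ((1 - cnj a * z) powr (- complex_of_real (p + 2))) = cmod (1 - cnj a * z) powr (- (p + 2))"
    by (subst norm_powr_real_powr') auto
  then show "(cmod (normalized_kernel p a z))\<^sup>2
       = (1 - (cmod a)\<^sup>2) powr (p + 2) * cmod (1 - cnj a * z) powr (- (2 * (p + 2)))"
    unfolding normalized_kernel_def norm_mult power_mult_distrib norm_of_real power2_abs sq K(4)[OF z]
    by (simp add: power2_eq_square powr_add[symmetric])
qed

text \<open>The Schwarz lemma on the disk of radius 1 - |a| around a, which lies inside the unit
  disk.\<close>

lemma bounded_holomorphic_lipschitz: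
  assumes \<phi>: "\<phi> \<in> Hinf1" and a: "cmod a < 1" and z: "cmod (z - a) < 1 - cmod a"
  shows "cmod (\<phi> z - \<phi> a) \<le> 3 * cmod (z - a) / (1 - cmod a)"
proof -
  define s where "s = 1 - cmod a"
  have s: "s > 0" using a by (simp add: s_def)
  have in_disk: "a + of_real s * w \<in> unit_disk" if "cmod w < 1" for w
  proof -
    have "cmod (a + of_real s * w) \<le> cmod a + s * cmod w"
      using norm_triangle_ineq[of a "of_real s * w"] s by (simp add: norm_mult)
    also have "\<dots> < cmod a + s * 1" using s that by simp
    finally show ?thesis by (simp add: s_def)
  qed
  \<comment> \<open>The difference is at most 2 in modulus; dividing by 3 gives the strict bound
    that the Schwarz lemma asks for.\<close>
  define g where "g w = (\<phi> (a + of_real s * w) - \<phi> a) / 3" for w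
  have gh: "g holomorphic_on ball 0 1"
    unfolding g_def
    by (intro holomorphic_intros holomorphic_on_compose_gen[OF _ Hinf1_D(1)[OF \<phi>], unfolded o_def])
       (use in_disk in auto)
  have g1: "cmod (g w) < 1" if "cmod w < 1" for w
  proof -
    have "cmod (\<phi> (a + of_real s * w) - \<phi> a) \<le> 1 + 1"
      using Hinf1_D(2)[OF \<phi> in_disk[OF that]] Hinf1_D(2)[OF \<phi>, of a] a
      by (intro order_trans[OF norm_triangle_ineq4] add_mono) auto
    then show ?thesis by (simp add: g_def norm_divide)
  qed
  define w where "w = (z - a) / of_real s"
  have "cmod w = cmod (z - a) / s" using s by (simp add: w_def norm_divide)
  then have w: "cmod w < 1" using z s unfolding s_def[symmetric] by simp
  have "cmod (g w) \<le> cmod w"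
    by (rule Schwarz_Lemma(1)[OF gh _ g1 w]) (auto simp: g_def)
  moreover have "a + of_real s * w = z" using s by (simp add: w_def)
  ultimately have "cmod (\<phi> z - \<phi> a) / 3 \<le> cmod (z - a) / s"
    using s by (simp add: g_def w_def norm_divide)
  then show ?thesis by (simp add: s_def mult.commute)
qed

lemma defect_inner_eq:
  "Re (A2_inner p (\<lambda>z. defect \<phi> z * f z) f) = (\<integral>z. (1 - (cmod (disk_restrict \<phi> z))\<^sup>2) * (cmod (f z))\<^sup>2 \<partial>dA_weighted p)"
proof -
  have "A2_inner p (\<lambda>z. defect \<phi> z * f z) f = (\<integral>z. of_real ((1 - (cmod (disk_restrict \<phi> z))\<^sup>2) * (cmod (f z))\<^sup>2) \<partial>dA_weighted p)"
    unfolding A2_inner_def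
    by (intro Bochner_Integration.integral_cong refl) (simp only: defect_def of_real_mult complex_norm_square mult.assoc)
  then show ?thesis by (simp only: integral_complex_of_real Re_complex_of_real)
qed

text \<open>With s = 1 - |a|, on this ball 1 - |z|^2 lies between s / 2 and 3 s, so the density is
  comparable to s^p while the area is pi c^2 s^2. The minimum of the two powers covers both signs of
  p.\<close>

lemma emeasure_dA_weighted_ball_ge:
  assumes p: "p > -1" and a: "cmod a < 1" and c: "0 < c" "c \<le> 1/2"
  shows "ennreal ((p + 1) * min ((1/2) powr p) (3 powr p) * c\<^sup>2 * (1 - cmod a) powr (p + 2))
      \<le> emeasure (dA_weighted p) (ball a (c * (1 - cmod a)))"
proof -
  define s where "s = 1 - cmod a"
  have s: "s > 0" using a by (simp add: s_def)
  define C where "C = min ((1/2) powr p) (3 powr p)"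
  have C: "C > 0" by (simp add: C_def)
  let ?B = "ball a (c * s)"
  have dens: "(p + 1) * (C * s powr p) / pi \<le> bergman_density p z" if "z \<in> ?B" for z
  proof -
    have za: "cmod (z - a) < c * s" using that by (simp add: dist_norm norm_minus_commute)
    moreover have "c * s \<le> 1/2 * s" using c s by (intro mult_right_mono) auto
    moreover have "cmod z \<le> cmod a + cmod (z - a)" "cmod a \<le> cmod z + cmod (z - a)"
      using norm_triangle_sub[of z a] norm_triangle_sub[of a z] by (auto simp: norm_minus_commute)
    ultimately have u: "1 - cmod z \<ge> s / 2" "1 - cmod z \<le> 3/2 * s" by (auto simp: s_def)
    then have z1: "cmod z < 1" using s by simp
    have e: "1 - (cmod z)\<^sup>2 = (1 - cmod z) * (1 + cmod z)" by (simp add: power2_eq_square algebra_simps)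
    have "(1 - cmod z) * 1 \<le> 1 - (cmod z)\<^sup>2" "1 - (cmod z)\<^sup>2 \<le> (1 - cmod z) * 2"
      unfolding e using z1 by (intro mult_left_mono; simp)+
    then have t: "s / 2 \<le> 1 - (cmod z)\<^sup>2" "1 - (cmod z)\<^sup>2 \<le> 3 * s" using u by auto
    have "C * s powr p \<le> (1 - (cmod z)\<^sup>2) powr p"
    proof (cases "p \<ge> 0")
      case True
      have "C * s powr p \<le> (1/2) powr p * s powr p" by (intro mult_right_mono) (auto simp: C_def)
      also have "\<dots> = (s / 2) powr p" using s by (simp add: powr_mult[symmetric])
      also have "\<dots> \<le> (1 - (cmod z)\<^sup>2) powr p" using s t True by (intro powr_mono2) auto
      finally show ?thesis .
    next
      case False
      have "C * s powr p \<le> 3 powr p * s powr p" by (intro mult_right_mono) (auto simp: C_def)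
      also have "\<dots> = (3 * s) powr p" using s by (simp add: powr_mult[symmetric])
      also have "\<dots> \<le> (1 - (cmod z)\<^sup>2) powr p" using s t False by (intro powr_mono2') auto
      finally show ?thesis .
    qed
    then show ?thesis
      using z1 p by (simp add: bergman_density_def divide_right_mono mult_left_mono)
  qed
  have "ennreal ((p + 1) * C * c\<^sup>2 * s powr (p + 2)) = ennreal ((p + 1) * (C * s powr p) / pi) * emeasure lborel ?B"
    using c s p C by (simp add: emeasure_ball unit_ball_vol_2 ennreal_mult[symmetric] powr_add power2_eq_square mult_ac)
  also have "\<dots> = (\<integral>\<^sup>+z. ennreal ((p + 1) * (C * s powr p) / pi) * indicator ?B z \<partial>lborel)"
    by (subst nn_integral_cmult_indicator) auto
  also have "\<dots> \<le> (\<integral>\<^sup>+z. ennreal (bergman_density p z) * indicator ?B z \<partial>lborel)"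
    using dens by (intro nn_integral_mono) (auto split: split_indicator intro!: ennreal_leI)
  also have "\<dots> = emeasure (dA_weighted p) ?B"
    unfolding dA_weighted_eq_density[OF p] by (subst emeasure_density) auto
  finally show ?thesis by (simp add: C_def s_def)
qed

text \<open>On a ball around a whose radius is a fixed fraction of s = 1 - |a|, \<phi> stays away
  from the circle, the squared normalized kernel is at least of order s^-(p + 2), and the measure is
  at least of order s^(p + 2). The powers of s cancel, so \<delta> does not depend on a.\<close>

lemma defect_kernel_lower_bound:
  assumes p: "p > -1" and \<phi>: "\<phi> \<in> Hinf1" and r: "0 \<le> r" "r < 1"
  obtains \<delta> where "\<delta> > 0" "\<And>a. cmod a < 1 \<Longrightarrow> cmod (\<phi> a) \<le> r \<Longrightarrow>
     \<delta> \<le> Re (A2_inner p (\<lambda>z. defect \<phi> z * normalized_kernel p a z) (normalized_kernel p a))"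
proof -
  \<comment> \<open>Then \<phi> moves by at most 3 c = 3 (1 - r) / 8 on the ball, less than half of
    1 - r, so |\<phi>| \<le> (1 + r) / 2 there.\<close>
  define c where "c = (1 - r) / 8"
  have c: "0 < c" "c \<le> 1/2" using r by (auto simp: c_def)
  define M where "M = (p + 1) * min ((1/2) powr p) (3 powr p) * c\<^sup>2"
  have M: "M > 0" using p c by (simp add: M_def)
  define \<delta> where "\<delta> = (1 - r) / 2 * 3 powr (- (2 * (p + 2))) * M"
  have \<delta>: "\<delta> > 0" using r M by (simp add: \<delta>_def)
  have [measurable]: "disk_restrict \<phi> \<in> borel_measurable borel"
    using \<phi> by (intro disk_fun_measurable disk_fun_disk_restrict Hinf1_D)
  have "\<delta> \<le> Re (A2_inner p (\<lambda>z. defect \<phi> z * normalized_kernel p a z) (normalized_kernel p a))"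
    if a: "cmod a < 1" and le: "cmod (\<phi> a) \<le> r" for a
  proof -
    define s where "s = 1 - cmod a"
    have s: "s > 0" using a by (simp add: s_def)
    define k where "k = normalized_kernel p a"
    have k: "k \<in> A2 p" unfolding k_def by (rule normalized_kernel[OF p a])
    have Lk: "L2 p k" by (rule A2_L2[OF p k])
    have [measurable]: "k \<in> borel_measurable borel" by (rule L2_measurable[OF Lk])
    let ?B = "ball a (c * s)"
    let ?h = "\<lambda>z. (1 - (cmod (disk_restrict \<phi> z))\<^sup>2) * (cmod (k z))\<^sup>2"
    define m where "m = (1 - r) / 2 * (s powr (p + 2) * (3 * s) powr (- (2 * (p + 2))))"
    have m0: "m \<ge> 0" using r by (simp add: m_def)
    have h0: "0 \<le> ?h z" for z
      using Hinf1_D(2)[OF \<phi>, of z] by (auto simp: disk_restrict_def abs_square_le_1)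
    have hm: "m \<le> ?h z" if "z \<in> ?B" for z
    proof -
      have za: "cmod (z - a) < c * s" using that by (simp add: dist_norm norm_minus_commute)
      have cs: "c * s \<le> 1/2 * s" using c s by (intro mult_right_mono) auto
      have z1: "cmod z < 1"
        using norm_triangle_sub[of z a] za cs s s_def by linarith
      have zs: "cmod (z - a) < 1 - cmod a" using za cs s s_def by linarith
      have "cmod (\<phi> z - \<phi> a) \<le> 3 * cmod (z - a) / s"
        unfolding s_def by (rule bounded_holomorphic_lipschitz[OF \<phi> a zs])
      also have "\<dots> \<le> 3 * (c * s) / s" using za s by (intro divide_right_mono) auto
      also have "\<dots> = 3 * (1 - r) / 8" using s by (simp add: c_def)
      finally have "cmod (\<phi> z) \<le> (1 + r) / 2"
        using norm_triangle_sub[of "\<phi> z" "\<phi> a"] le r by simp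
      moreover have "(cmod (\<phi> z))\<^sup>2 \<le> cmod (\<phi> z) * 1"
        using Hinf1_D(2)[OF \<phi>, of z] z1 unfolding power2_eq_square by (intro mult_left_mono) auto
      ultimately have d: "(1 - r) / 2 \<le> 1 - (cmod (disk_restrict \<phi> z))\<^sup>2"
        using z1 by (simp add: disk_restrict_def field_simps)
      have "cmod (1 - cnj a * z) \<le> 3 * s"
      proof -
        have "1 - cnj a * z = of_real (1 - (cmod a)\<^sup>2) + cnj a * (a - z)"
          unfolding of_real_diff complex_norm_square by (simp add: algebra_simps)
        then have "cmod (1 - cnj a * z) \<le> cmod (of_real (1 - (cmod a)\<^sup>2)) + cmod (cnj a * (a - z))"
          using norm_triangle_ineq by metis
        also have "cmod (of_real (1 - (cmod a)\<^sup>2)) = s * (1 + cmod a)"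
          unfolding norm_of_real using a by (simp add: s_def power_le_one power2_eq_square algebra_simps mult_le_one)
        also have "s * (1 + cmod a) \<le> s * 2" using s a by (intro mult_left_mono) auto
        also have "cmod (cnj a * (a - z)) \<le> 1 * (1/2 * s)"
          unfolding norm_mult using a za cs by (intro mult_mono) (auto simp: norm_minus_commute)
        finally show ?thesis using s by simp
      qed
      moreover have "0 < cmod (1 - cnj a * z)"
        using one_minus_cnj_mult_bounds(3)[OF a, of z] z1 by simp
      ultimately have "(3 * s) powr (- (2 * (p + 2))) \<le> cmod (1 - cnj a * z) powr (- (2 * (p + 2)))"
        using p by (intro powr_mono2') auto
      moreover have "s powr (p + 2) \<le> (1 - (cmod a)\<^sup>2) powr (p + 2)"
      proof (rule powr_mono2)
        have "cmod a * cmod a \<le> cmod a * 1" using a by (intro mult_left_mono) auto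
        then show "s \<le> 1 - (cmod a)\<^sup>2" by (simp add: s_def power2_eq_square)
      qed (use p s in auto)
      ultimately have "s powr (p + 2) * (3 * s) powr (- (2 * (p + 2))) \<le> (cmod (k z))\<^sup>2"
        unfolding k_def using z1 by (subst normalized_kernel(4)[OF p a]) (auto intro!: mult_mono)
      then show ?thesis
        unfolding m_def using d r by (intro mult_mono) auto
    qed
    have int: "integrable (dA_weighted p) ?h"
    proof (rule Bochner_Integration.integrable_bound)
      show "integrable (dA_weighted p) (\<lambda>z. (cmod (k z))\<^sup>2)" using Lk by (simp add: L2_def)
      show "AE z in dA_weighted p. norm (?h z) \<le> norm ((cmod (k z))\<^sup>2)"
      proof (rule AE_I2)
        fix z
        have "?h z \<le> 1 * (cmod (k z))\<^sup>2" by (intro mult_right_mono) auto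
        then show "norm (?h z) \<le> norm ((cmod (k z))\<^sup>2)" using h0[of z] by simp
      qed
    qed measurable
    have "ennreal \<delta> = ennreal m * ennreal (M * s powr (p + 2))"
    proof -
      have eq1: "(3 * s) powr (- (2 * (p + 2))) = 3 powr (- (2 * (p + 2))) * s powr (- (2 * (p + 2)))"
        using s by (simp add: powr_mult)
      have eq2: "s powr (p + 2) * s powr (- (2 * (p + 2))) * s powr (p + 2) = 1"
        using s by (simp add: powr_add[symmetric])
      have "m * (M * s powr (p + 2)) = (1 - r) / 2 * 3 powr (- (2 * (p + 2))) * M
          * (s powr (p + 2) * s powr (- (2 * (p + 2))) * s powr (p + 2))"
        unfolding m_def eq1 by (simp only: mult_ac)
      then have "m * (M * s powr (p + 2)) = \<delta>"
        unfolding eq2 \<delta>_def by simp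
      then show ?thesis using m0 M by (simp add: ennreal_mult[symmetric])
    qed
    also have "\<dots> \<le> ennreal m * emeasure (dA_weighted p) ?B"
      using emeasure_dA_weighted_ball_ge[OF p a c] by (intro mult_left_mono) (auto simp: M_def s_def)
    also have "\<dots> = (\<integral>\<^sup>+z. ennreal m * indicator ?B z \<partial>dA_weighted p)"
      by (subst nn_integral_cmult_indicator) auto
    also have "\<dots> \<le> (\<integral>\<^sup>+z. ennreal (?h z) \<partial>dA_weighted p)"
      using hm by (intro nn_integral_mono) (auto split: split_indicator intro!: ennreal_leI)
    also have "\<dots> = ennreal (\<integral>z. ?h z \<partial>dA_weighted p)"
      using int h0 by (intro nn_integral_eq_integral) auto
    finally have "\<delta> \<le> (\<integral>z. ?h z \<partial>dA_weighted p)"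
      by (subst (asm) ennreal_le_iff) (auto intro!: Bochner_Integration.integral_nonneg h0)
    then show ?thesis unfolding k_def[symmetric] defect_inner_eq .
  qed
  with \<delta> show ?thesis by (rule that)
qed

text \<open>The negated boundary criterion supplies points tending to the circle with |\<phi>| \<le>
  r < 1; the sequence consists of the normalized kernels at these points. Both necessity proofs
  start from it.\<close>

lemma not_Blaschke_weakly_null_sequence:
  assumes p: "p > -1" and \<phi>: "\<phi> \<in> Hinf1" and nB: "\<not> finite_Blaschke_product \<phi>"
  obtains x \<delta> where "\<delta> > 0" "\<And>j. x j \<in> A2 p" "\<And>j::nat. A2_norm p (x j) = 1"
    "\<And>n. (\<lambda>j. taylor_coeff (x j) n) \<longlonglongrightarrow> 0" "\<And>j. \<delta> \<le> Re (A2_inner p (\<lambda>z. defect \<phi> z * x j z) (x j))"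
proof -
  from nB finite_Blaschke_productI[OF \<phi>] obtain r0 where
    r0: "r0 < 1" "\<And>\<rho>. \<rho> < 1 \<Longrightarrow> \<exists>z. \<rho> < cmod z \<and> cmod z < 1 \<and> cmod (\<phi> z) \<le> r0"
    by (meson not_le)
  define r where "r = max 0 r0"
  have r: "0 \<le> r" "r < 1" using r0 by (auto simp: r_def)
  have "\<exists>z. 1 - inverse (real (Suc j)) < cmod z \<and> cmod z < 1 \<and> cmod (\<phi> z) \<le> r" for j
    using r0(2)[of "1 - inverse (real (Suc j))"] by (force simp: r_def)
  then obtain a where a: "\<And>j. 1 - inverse (real (Suc j)) < cmod (a j)" "\<And>j. cmod (a j) < 1" "\<And>j. cmod (\<phi> (a j)) \<le> r"
    by metis
  obtain \<delta> where \<delta>: "\<delta> > 0" "\<And>a. cmod a < 1 \<Longrightarrow> cmod (\<phi> a) \<le> r \<Longrightarrow>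
     \<delta> \<le> Re (A2_inner p (\<lambda>z. defect \<phi> z * normalized_kernel p a z) (normalized_kernel p a))"
    using defect_kernel_lower_bound[OF p \<phi> r] by blast
  have lim_a: "(\<lambda>j. cmod (a j)) \<longlonglongrightarrow> 1"
  proof (rule real_tendsto_sandwich)
    show "(\<lambda>j. 1 - inverse (real (Suc j))) \<longlonglongrightarrow> 1"
      using tendsto_diff[OF tendsto_const LIMSEQ_inverse_real_of_nat, of 1] by simp
    show "\<forall>\<^sub>F j in sequentially. 1 - inverse (real (Suc j)) \<le> cmod (a j)"
      using a(1) by (intro always_eventually allI less_imp_le)
    show "\<forall>\<^sub>F j in sequentially. cmod (a j) \<le> 1"
      using a(2) by (intro always_eventually allI less_imp_le)
  qed simp
  have "(\<lambda>j. taylor_coeff (normalized_kernel p (a j)) n) \<longlonglongrightarrow> 0" for n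
  proof (rule Lim_null_comparison)
    have "(\<lambda>j. (1 - (cmod (a j))\<^sup>2) powr ((p + 2) / 2) / bergman_weight p n) \<longlonglongrightarrow> 0 / bergman_weight p n"
    proof (intro tendsto_divide tendsto_const)
      have "(\<lambda>j. 1 - (cmod (a j))\<^sup>2) \<longlonglongrightarrow> 1 - 1\<^sup>2" by (intro tendsto_intros lim_a)
      then show "(\<lambda>j. (1 - (cmod (a j))\<^sup>2) powr ((p + 2) / 2)) \<longlonglongrightarrow> 0"
        using p a(2) by (intro tendsto_zero_powrI[where b="(p + 2) / 2"]) 
          (auto intro!: always_eventually simp: power_le_one less_imp_le)
    qed (use bergman_weight_pos[OF p, of n] in simp)
    then show "(\<lambda>j. (1 - (cmod (a j))\<^sup>2) powr ((p + 2) / 2) / bergman_weight p n) \<longlonglongrightarrow> 0" by simp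
    show "\<forall>\<^sub>F j in sequentially. norm (taylor_coeff (normalized_kernel p (a j)) n) \<le> (1 - (cmod (a j))\<^sup>2) powr ((p + 2) / 2) / bergman_weight p n"
      by (intro always_eventually allI normalized_kernel(3)[OF p a(2)])
  qed
  then show ?thesis
    using that[of \<delta> "\<lambda>j. normalized_kernel p (a j)"] \<delta> a normalized_kernel[OF p a(2)] by blast
qed

section \<open>Necessity of being a Blaschke product\<close>

lemma Metric_space_A2:
  assumes p: "p > -1"
  shows "Metric_space (A2 p) (\<lambda>f g. A2_norm p (\<lambda>z. f z - g z))"
proof
  fix x y :: "complex \<Rightarrow> complex"
  show "A2_norm p (\<lambda>z. x z - y z) = A2_norm p (\<lambda>z. y z - x z)" by (rule A2_norm_commute)
next
  fix x y assume xy: "x \<in> A2 p" "y \<in> A2 p"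
  show "A2_norm p (\<lambda>z. x z - y z) = 0 \<longleftrightarrow> x = y"
  proof
    assume "A2_norm p (\<lambda>z. x z - y z) = 0"
    then have "(\<lambda>z. x z - y z) = (\<lambda>_. 0)"
      by (intro A2_L2_norm_sq_zero[OF p A2_diff[OF p xy]]) (simp add: A2_norm_eq)
    then show "x = y" by (simp add: fun_eq_iff)
  qed (simp add: A2_norm_eq L2_norm_sq_def)
next
  fix x y z assume "x \<in> A2 p" "y \<in> A2 p" "z \<in> A2 p"
  then show "A2_norm p (\<lambda>w. x w - z w) \<le> A2_norm p (\<lambda>w. x w - y w) + A2_norm p (\<lambda>w. y w - z w)"
    using A2_norm_triangle[of p "\<lambda>w. x w - y w" "\<lambda>w. y w - z w"] by (simp add: A2_L2 A2_diff p)
qed simp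

text \<open>Along a subsequence E x_j converges in norm to some l, and l pairs with the weakly null
  x_j to 0. Hence the pairing of E x_j with x_j becomes small, against the lower bound
  \<delta>.\<close>

lemma compact_imp_Blaschke:
  assumes p: "p > -1" and \<phi>: "\<phi> \<in> Hinf1" and cpt: "A2_compact_operator p (E_bar_op p \<phi>)"
  shows "finite_Blaschke_product \<phi>"
proof (rule ccontr)
  assume nB: "\<not> finite_Blaschke_product \<phi>"
  obtain x \<delta> where x: "\<delta> > 0" "\<And>j. x j \<in> A2 p" "\<And>j::nat. A2_norm p (x j) = 1"
    "\<And>n. (\<lambda>j. taylor_coeff (x j) n) \<longlonglongrightarrow> 0" "\<And>j. \<delta> \<le> Re (A2_inner p (\<lambda>z. defect \<phi> z * x j z) (x j))"
    by (rule not_Blaschke_weakly_null_sequence[OF p \<phi> nB], rule that, assumption+)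
  interpret Metric_space "A2 p" "\<lambda>f g. A2_norm p (\<lambda>z. f z - g z)" by (rule Metric_space_A2[OF p])
  let ?E = "E_bar_op p \<phi>"
  let ?S = "?E ` {f \<in> A2 p. A2_norm p f \<le> 1}"
  have S: "?S \<subseteq> A2 p" using E_bar_A2(1)[OF p \<phi>] by auto
  have "compactin mtopology (mtopology closure_of ?S)"
    using cpt by (simp add: A2_compact_operator_def A2_topology_def)
  then have seq: "\<exists>l r. strict_mono r \<and> limitin mtopology (\<sigma> \<circ> r) l sequentially"
    if "range \<sigma> \<subseteq> mtopology closure_of ?S" for \<sigma> :: "nat \<Rightarrow> _"
    using that unfolding compactin_sequentially by blast
  have "range (\<lambda>j. ?E (x j)) \<subseteq> ?S" using x by auto
  also have "\<dots> \<subseteq> mtopology closure_of ?S"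
    by (rule closure_of_subset) (use S in simp)
  finally obtain l r where lr: "strict_mono r" "limitin mtopology ((\<lambda>j. ?E (x j)) \<circ> r) l sequentially"
    using seq by meson
  then have l: "l \<in> A2 p" "\<And>e. e > 0 \<Longrightarrow> \<forall>\<^sub>F j in sequentially. A2_norm p (\<lambda>z. ?E (x (r j)) z - l z) < e"
    by (auto simp: limitin_metric elim: eventually_mono)
  have "(\<lambda>j. A2_inner p l (x (r j))) \<longlonglongrightarrow> 0"
    by (rule A2_weakly_null[where C=1, OF p l(1)])
       (use x LIMSEQ_subseq_LIMSEQ[OF x(4) lr(1)] in \<open>auto simp: o_def\<close>)
  then have "\<forall>\<^sub>F j in sequentially. cmod (A2_inner p l (x (r j))) < \<delta> / 2"
    using order_tendstoD(2)[OF tendsto_norm_zero, of _ sequentially "\<delta> / 2"] x(1) by simp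
  with l(2)[of "\<delta> / 2"] x(1)
  have "\<forall>\<^sub>F j in sequentially. cmod (A2_inner p l (x (r j))) < \<delta> / 2 \<and> A2_norm p (\<lambda>z. ?E (x (r j)) z - l z) < \<delta> / 2"
    by (auto intro: eventually_conj)
  then obtain j where j: "cmod (A2_inner p l (x (r j))) < \<delta> / 2" "A2_norm p (\<lambda>z. ?E (x (r j)) z - l z) < \<delta> / 2"
    by (auto simp: eventually_sequentially)
  let ?y = "x (r j)"
  have y: "?y \<in> A2 p" "?E ?y \<in> A2 p" using x E_bar_A2(1)[OF p \<phi>] by auto
  have "A2_inner p (\<lambda>z. ?E ?y z - l z) ?y = A2_inner p (?E ?y) ?y - A2_inner p l ?y"
    by (intro A2_inner_diff_left A2_L2[OF p] y l)
  moreover have "cmod (A2_inner p (\<lambda>z. ?E ?y z - l z) ?y) \<le> A2_norm p (\<lambda>z. ?E ?y z - l z) * A2_norm p ?y"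
    by (intro A2_cauchy_schwarz A2_L2[OF p] A2_diff[OF p] y l)
  ultimately have "cmod (A2_inner p (?E ?y) ?y - A2_inner p l ?y) < \<delta> / 2"
    using j x(3) by simp
  then have "cmod (A2_inner p (?E ?y) ?y) < \<delta>"
    using norm_triangle_sub[of "A2_inner p (?E ?y) ?y" "A2_inner p l ?y"] j(1) by simp
  moreover have "\<delta> \<le> Re (A2_inner p (?E ?y) ?y)"
    using x(5)[of "r j"] E_bar_A2(2)[OF p \<phi> y(1) y(1)] by simp
  ultimately show False using complex_Re_le_cmod[of "A2_inner p (?E ?y) ?y"] by simp
qed

text \<open>\<open>euler_op\<close> is \<open>f \<mapsto> z f' + (p + 2) f\<close> on Taylor coefficients and \<open>euler_inverse\<close> is its inverse.\<close>

definition euler_op :: "real \<Rightarrow> (complex \<Rightarrow> complex) \<Rightarrow> complex \<Rightarrow> complex" where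
  "euler_op p f = disk_series (\<lambda>n. of_real (real n + p + 2) * taylor_coeff f n)"

definition euler_inverse :: "real \<Rightarrow> (complex \<Rightarrow> complex) \<Rightarrow> complex \<Rightarrow> complex" where
  "euler_inverse p f = disk_series (\<lambda>n. taylor_coeff f n / of_real (real n + p + 2))"

lemma euler_op_A2:
  assumes p: "p > -1" and f: "f \<in> A2 (p - 2)"
  shows "euler_op p f \<in> A2 p" "taylor_coeff (euler_op p f) n = of_real (real n + p + 2) * taylor_coeff f n"
proof -
  have "summable (\<lambda>n. (cmod (of_real (real n + p + 2) * taylor_coeff f n))\<^sup>2 * bergman_weight p n)"
    using f unfolding A2_minus2_iff[OF p] norm_mult power_mult_distrib norm_of_real power2_abs by simp
  from disk_series_A2[OF p this] show "euler_op p f \<in> A2 p" "taylor_coeff (euler_op p f) n = of_real (real n + p + 2) * taylor_coeff f n"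
    by (simp_all only: euler_op_def)
qed

lemma A2_minus2_subset:
  assumes p: "p > -1" and f: "f \<in> A2 (p - 2)"
  shows "f \<in> A2 p"
proof -
  have sm: "summable (\<lambda>n. (real n + p + 2)\<^sup>2 * (cmod (taylor_coeff f n))\<^sup>2 * bergman_weight p n)" and df: "disk_fun f"
    using f by (auto simp: A2_minus2_iff[OF p])
  have "summable (\<lambda>n. (cmod (taylor_coeff f n))\<^sup>2 * bergman_weight p n)"
  proof (rule summable_comparison_test[OF _ sm], intro exI allI impI)
    fix n
    have "1\<^sup>2 \<le> (real n + p + 2)\<^sup>2" using p by (intro power_mono) auto
    then have "1 * ((cmod (taylor_coeff f n))\<^sup>2 * bergman_weight p n) \<le> (real n + p + 2)\<^sup>2 * ((cmod (taylor_coeff f n))\<^sup>2 * bergman_weight p n)"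
      using bergman_weight_pos[OF p, of n] by (intro mult_right_mono) auto
    then show "norm ((cmod (taylor_coeff f n))\<^sup>2 * bergman_weight p n) \<le> (real n + p + 2)\<^sup>2 * (cmod (taylor_coeff f n))\<^sup>2 * bergman_weight p n"
      using bergman_weight_pos[OF p, of n] by (simp add: mult.assoc)
  qed
  with df show ?thesis by (simp add: A2_iff[OF p])
qed

lemma euler_inverse_A2:
  assumes p: "p > -1" and f: "f \<in> A2 p"
  shows "euler_inverse p f \<in> A2 p" "taylor_coeff (euler_inverse p f) n = taylor_coeff f n / of_real (real n + p + 2)"
proof -
  have sm: "summable (\<lambda>n. (cmod (taylor_coeff f n))\<^sup>2 * bergman_weight p n)"
    using f by (auto simp: A2_iff[OF p])
  have "summable (\<lambda>n. (cmod (taylor_coeff f n / of_real (real n + p + 2)))\<^sup>2 * bergman_weight p n)"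
  proof (rule summable_comparison_test[OF _ sm], intro exI allI impI)
    fix n
    have "cmod (taylor_coeff f n / of_real (real n + p + 2)) \<le> cmod (taylor_coeff f n)"
      using p unfolding norm_divide norm_of_real by (auto simp: divide_le_eq mult_left_le mult_le_cancel_left1 intro: mult_le_cancel_left1[THEN iffD2])
    then show "norm ((cmod (taylor_coeff f n / of_real (real n + p + 2)))\<^sup>2 * bergman_weight p n) \<le> (cmod (taylor_coeff f n))\<^sup>2 * bergman_weight p n"
      using bergman_weight_pos[OF p, of n] by (simp add: power_mono)
  qed
  from disk_series_A2[OF p this] show "euler_inverse p f \<in> A2 p" "taylor_coeff (euler_inverse p f) n = taylor_coeff f n / of_real (real n + p + 2)"
    by (simp_all only: euler_inverse_def)
qed

text \<open>The eigenvalues of L are real and nonzero. This trades a pairing with g for one with its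
  inverse image, which is small in norm when g is weakly small.\<close>

lemma A2_inner_euler_op_euler_inverse:
  assumes p: "p > -1" and f: "f \<in> A2 (p - 2)" and g: "g \<in> A2 p"
  shows "A2_inner p (euler_op p f) (euler_inverse p g) = A2_inner p f g"
proof -
  have "taylor_coeff (euler_op p f) n * cnj (taylor_coeff (euler_inverse p g) n) = taylor_coeff f n * cnj (taylor_coeff g n)" for n
  proof -
    define d where "d = complex_of_real (real n + p + 2)"
    have d: "d \<noteq> 0" "cnj d = d"
      using p unfolding d_def by (simp_all only: of_real_eq_0_iff complex_cnj_complex_of_real)
    show ?thesis
      unfolding euler_op_A2(2)[OF p f] euler_inverse_A2(2)[OF p g] d_def[symmetric] using d by simp
  qed
  then show ?thesis
    using A2_inner_sums[OF p euler_op_A2(1)[OF p f] euler_inverse_A2(1)[OF p g]] A2_inner_sums[OF p A2_minus2_subset[OF p f] g]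
    by (simp add: sums_unique2)
qed

text \<open>Compactness of the inverse of L: the first N coefficients tend to 0 by assumption, and
  beyond them the diagonal entries are at most 1 / (N + 1). Both the gliding hump and the
  compactness of E rest on this.\<close>

lemma euler_inverse_weakly_null:
  assumes p: "p > -1" and x: "\<And>j. x j \<in> A2 p" and C: "\<And>j. L2_norm_sq p (x j) \<le> C"
    and lim: "\<And>n. (\<lambda>j. taylor_coeff (x j) n) \<longlonglongrightarrow> 0"
  shows "(\<lambda>j. A2_norm p (euler_inverse p (x j))) \<longlonglongrightarrow> 0"
proof -
  have C0: "0 \<le> C" using C[of 0] order_trans[OF L2_norm_sq_nonneg] by blast
  have le: "L2_norm_sq p (euler_inverse p (x j)) \<le> (\<Sum>n<N. (cmod (taylor_coeff (x j) n))\<^sup>2 * bergman_weight p n) + 1 / (real N + 1)\<^sup>2 * C" for j N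
  proof -
    let ?a = "\<lambda>n. (cmod (taylor_coeff (x j) n))\<^sup>2 * bergman_weight p n"
    have a0: "0 \<le> ?a n" for n using bergman_weight_pos[OF p, of n] by simp
    have "L2_norm_sq p (euler_inverse p (x j)) \<le> (\<Sum>n<N. ?a n) + 1 / (real N + 1)\<^sup>2 * L2_norm_sq p (x j)"
    proof (rule sums_le[OF _ A2_L2_norm_sq_sums[OF p euler_inverse_A2(1)[OF p x]]])
      show "(\<lambda>n. (if n \<in> {..<N} then ?a n else 0) + 1 / (real N + 1)\<^sup>2 * ?a n) sums ((\<Sum>n<N. ?a n) + 1 / (real N + 1)\<^sup>2 * L2_norm_sq p (x j))"
        by (intro sums_add sums_mult A2_L2_norm_sq_sums[OF p x] sums_If_finite_set) simp
      fix n
      have eq: "(cmod (taylor_coeff (euler_inverse p (x j)) n))\<^sup>2 * bergman_weight p n = 1 / (real n + p + 2)\<^sup>2 * ?a n"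
        unfolding euler_inverse_A2(2)[OF p x] norm_divide norm_of_real power_divide power2_abs by simp
      show "(cmod (taylor_coeff (euler_inverse p (x j)) n))\<^sup>2 * bergman_weight p n \<le> (if n \<in> {..<N} then ?a n else 0) + 1 / (real N + 1)\<^sup>2 * ?a n"
      proof (cases "n < N")
        case True
        have "1 \<le> (real n + p + 2)\<^sup>2" using p power_mono[of 1 "real n + p + 2" 2] by simp
        then have "1 / (real n + p + 2)\<^sup>2 \<le> 1" by (subst divide_le_eq_1_pos) linarith+
        then have "1 / (real n + p + 2)\<^sup>2 * ?a n \<le> 1 * ?a n" using a0 by (rule mult_right_mono)
        moreover have "0 \<le> 1 / (real N + 1)\<^sup>2 * ?a n" using a0[of n] by (intro mult_nonneg_nonneg[OF _ a0]) simp
        ultimately show ?thesis unfolding eq using True by simp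
      next
        case False
        then have "1 / (real n + p + 2)\<^sup>2 \<le> 1 / (real N + 1)\<^sup>2"
          using p by (intro divide_left_mono power_mono mult_pos_pos zero_less_power) auto
        then have "1 / (real n + p + 2)\<^sup>2 * ?a n \<le> 1 / (real N + 1)\<^sup>2 * ?a n"
          using a0 by (rule mult_right_mono)
        then show ?thesis unfolding eq using False by simp
      qed
    qed
    also have "\<dots> \<le> (\<Sum>n<N. ?a n) + 1 / (real N + 1)\<^sup>2 * C"
      using C by (intro add_left_mono mult_left_mono) auto
    finally show ?thesis .
  qed
  have "(\<lambda>j. L2_norm_sq p (euler_inverse p (x j))) \<longlonglongrightarrow> 0"
  proof (rule LIMSEQ_I)
    fix e :: real assume e: "e > 0"
    have "(\<lambda>N. 1 / (real N + 1)\<^sup>2 * C) \<longlonglongrightarrow> 0" by real_asymp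
    then have "\<forall>\<^sub>F N in sequentially. 1 / (real N + 1)\<^sup>2 * C < e / 2"
      using e by (intro order_tendstoD(2)) auto
    then obtain N where N: "1 / (real N + 1)\<^sup>2 * C < e / 2" by (auto simp: eventually_sequentially)
    have "(\<lambda>j. \<Sum>n<N. (cmod (taylor_coeff (x j) n))\<^sup>2 * bergman_weight p n) \<longlonglongrightarrow> (\<Sum>n<N. (cmod 0)\<^sup>2 * bergman_weight p n)"
      by (intro tendsto_intros lim)
    then have "\<forall>\<^sub>F j in sequentially. (\<Sum>n<N. (cmod (taylor_coeff (x j) n))\<^sup>2 * bergman_weight p n) < e / 2"
      using e by (intro order_tendstoD(2)) auto
    then obtain J where J: "\<And>j. j \<ge> J \<Longrightarrow> (\<Sum>n<N. (cmod (taylor_coeff (x j) n))\<^sup>2 * bergman_weight p n) < e / 2"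
      by (auto simp: eventually_sequentially)
    show "\<exists>no. \<forall>j\<ge>no. norm (L2_norm_sq p (euler_inverse p (x j)) - 0) < e"
    proof (intro exI[of _ J] allI impI)
      fix j assume "j \<ge> J"
      from J[OF this] N le[of j N] show "norm (L2_norm_sq p (euler_inverse p (x j)) - 0) < e"
        unfolding real_norm_def diff_0_right abs_of_nonneg[OF L2_norm_sq_nonneg] by linarith
    qed
  qed
  from tendsto_real_sqrt[OF this] show ?thesis by (simp add: A2_norm_eq)
qed

lemma taylor_coeff_A2_norm_le:
  assumes p: "p > -1" and f: "f \<in> A2 p"
  shows "cmod (taylor_coeff f n) \<le> A2_norm p f / sqrt (bergman_weight p n)"
proof -
  have "(cmod (taylor_coeff f n))\<^sup>2 \<le> L2_norm_sq p f / bergman_weight p n"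
    using A2_coeff_le_L2_norm_sq[OF p f, of n] bergman_weight_pos[OF p, of n] by (simp add: field_simps)
  then have "cmod (taylor_coeff f n) \<le> sqrt (L2_norm_sq p f / bergman_weight p n)"
    by (rule real_le_rsqrt)
  then show ?thesis by (simp add: A2_norm_eq real_sqrt_divide)
qed

text \<open>Whatever the earlier terms contribute as u, one of the two signs keeps the new term q at
  full size.\<close>

lemma norm_add_or_diff_ge: "cmod q \<le> max (cmod (u + q)) (cmod (u - q))"
proof -
  have "2 * cmod q = cmod ((u + q) - (u - q))" by (simp add: norm_mult[of 2 q, symmetric])
  also have "\<dots> \<le> cmod (u + q) + cmod (u - q)" by (rule norm_triangle_ineq4)
  finally show ?thesis by auto
qed

text \<open>A gliding hump: if the kernels do not see \<open>E\<close> as small, a signed lacunary sum of them has an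
  image whose pairing with the kernels decays too slowly for \<open>A2 (p - 2)\<close>.\<close>

lemma range_subset_imp_Blaschke:
  assumes p: "p > -1" and \<phi>: "\<phi> \<in> Hinf1" and range: "E_bar_op p \<phi> ` A2 p \<subseteq> A2 (p - 2)"
  shows "finite_Blaschke_product \<phi>"
proof (rule ccontr)
  assume nB: "\<not> finite_Blaschke_product \<phi>"
  obtain x \<delta> where x: "\<delta> > 0" "\<And>j. x j \<in> A2 p" "\<And>j::nat. A2_norm p (x j) = 1"
    "\<And>n. (\<lambda>j. taylor_coeff (x j) n) \<longlonglongrightarrow> 0" "\<And>j. \<delta> \<le> Re (A2_inner p (\<lambda>z. defect \<phi> z * x j z) (x j))"
    by (rule not_Blaschke_weakly_null_sequence[OF p \<phi> nB], rule that, assumption+)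
  note L2x = A2_L2[OF p]
  \<comment> \<open>On \<open>A2 p\<close> this is the pairing of E f with y, kept in its weak form
    because only boundedness and linearity in f are needed.\<close>
  define \<Lambda> where "\<Lambda> y f = A2_inner p (\<lambda>z. defect \<phi> z * f z) y" for y f
  have \<Lambda>_bound: "cmod (\<Lambda> y f) \<le> A2_norm p f * A2_norm p y" if "f \<in> A2 p" "y \<in> A2 p" for f y
  proof -
    have "cmod (\<Lambda> y f) \<le> A2_norm p (\<lambda>z. defect \<phi> z * f z) * A2_norm p y"
      unfolding \<Lambda>_def by (intro A2_cauchy_schwarz L2_defect p \<phi> L2x that)
    also have "\<dots> \<le> A2_norm p f * A2_norm p y"
      by (intro mult_right_mono A2_norm_defect_le p \<phi> L2x that) simp
    finally show ?thesis .
  qed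
  have \<Lambda>_add: "\<Lambda> y (\<lambda>z. f z + c * g z) = \<Lambda> y f + c * \<Lambda> y g" if "f \<in> A2 p" "g \<in> A2 p" "y \<in> A2 p" for f g y c
  proof -
    have "\<Lambda> y (\<lambda>z. f z + c * g z) = A2_inner p (\<lambda>z. defect \<phi> z * f z + c * (defect \<phi> z * g z)) y"
      by (simp add: \<Lambda>_def algebra_simps)
    also have "\<dots> = \<Lambda> y f + A2_inner p (\<lambda>z. c * (defect \<phi> z * g z)) y"
      unfolding \<Lambda>_def by (intro A2_inner_add_left L2_scale L2_defect p \<phi> L2x that)
    finally show ?thesis by (simp only: \<Lambda>_def A2_inner_scale_left)
  qed
  have \<delta>1: "\<delta> \<le> 1"
    using x(5)[of 0] \<Lambda>_bound[OF x(2) x(2), of 0 0] complex_Re_le_cmod[of "\<Lambda> (x 0) (x 0)"]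
    by (simp add: \<Lambda>_def x(3))
  \<comment> \<open>The ratio \<delta> / 4 is small enough that all terms after the k-th together
    weigh at most 4/3 t_(k+1) = \<delta> t_k / 3, below the \<delta> t_k secured by the k-th
    term.\<close>
  define t where "t k = (\<delta> / 4) ^ k" for k
  have t: "t k > 0" "t (Suc k) = \<delta> / 4 * t k" "4 * t (Suc k) \<le> t k" "t 0 = 1" for k
    using x(1) \<delta>1 by (auto simp: t_def mult_left_le_one_le)
  have "(\<lambda>j. A2_norm p (euler_inverse p (x j))) \<longlonglongrightarrow> 0"
    by (rule euler_inverse_weakly_null[where C=1, OF p x(2) _ x(4)]) (use x(3) in \<open>simp add: A2_norm_squared[symmetric]\<close>)
  \<comment> \<open>The additional factor 1 / (k + 1) is what the final contradiction lives
    on.\<close>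
  then have "\<exists>m. A2_norm p (euler_inverse p (x m)) < t k / (real k + 1)" for k
    using order_tendstoD(2)[of _ 0 sequentially "t k / (real k + 1)"] t(1)[of k]
    by (fastforce simp: eventually_sequentially)
  then obtain m where m: "\<And>k. A2_norm p (euler_inverse p (x (m k))) < t k / (real k + 1)" by metis
  define y where "y k = x (m k)" for k
  have y: "y k \<in> A2 p" "A2_norm p (y k) = 1" "\<delta> \<le> cmod (\<Lambda> (y k) (y k))" for k
    using x(2,3) x(5)[of "m k"] complex_Re_le_cmod[of "\<Lambda> (y k) (y k)"] by (auto simp: y_def \<Lambda>_def)
  \<comment> \<open>The sign is chosen greedily from the partial sum s accumulated so far, so that
    the new term does not cancel against it.\<close>
  define \<epsilon> :: "nat \<Rightarrow> (complex \<Rightarrow> complex) \<Rightarrow> complex" where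
    "\<epsilon> k s = (if cmod (\<Lambda> (y k) (\<lambda>z. s z + of_real (t k) * y k z)) \<ge> cmod (\<Lambda> (y k) (\<lambda>z. s z + - of_real (t k) * y k z)) then 1 else - 1)" for k s
  have \<epsilon>1: "cmod (\<epsilon> k s) = 1" for k s by (simp add: \<epsilon>_def)
  define S where "S = rec_nat (\<lambda>_. 0) (\<lambda>k s z. s z + \<epsilon> k s * of_real (t k) * y k z)"
  have S0: "S 0 = (\<lambda>_. 0)" and SS: "S (Suc k) = (\<lambda>z. S k z + \<epsilon> k (S k) * of_real (t k) * y k z)" for k
    by (simp_all add: S_def)
  have SA: "S k \<in> A2 p" for k
  proof (induction k)
    case 0
    have "(\<lambda>z. 0 * y 0 z) \<in> A2 p" by (intro A2_scale p y)
    then show ?case by (simp add: S0)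
  next
    case (Suc k)
    then show ?case unfolding SS by (intro A2_add A2_scale p y)
  qed
  have Sstep: "t k * \<delta> \<le> cmod (\<Lambda> (y k) (S (Suc k)))" for k
  proof -
    let ?q = "of_real (t k) * \<Lambda> (y k) (y k)"
    have "t k * \<delta> \<le> cmod ?q" using t(1)[of k] y(3)[of k] by (simp add: norm_mult mult_left_mono)
    also have "\<dots> \<le> max (cmod (\<Lambda> (y k) (S k) + ?q)) (cmod (\<Lambda> (y k) (S k) - ?q))"
      by (rule norm_add_or_diff_ge)
    also have "\<dots> = cmod (\<Lambda> (y k) (S (Suc k)))"
      using \<Lambda>_add[OF SA y(1) y(1), of k k "of_real (t k)" k] \<Lambda>_add[OF SA y(1) y(1), of k k "- of_real (t k)" k]
      unfolding SS \<epsilon>_def by (simp add: max_def)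
    finally show ?thesis .
  qed
  \<comment> \<open>The telescoping form lets the induction close: 4 t_(k+1) \<le> t_k is equivalent
    to t_k \<le> 4/3 (t_k - t_(k+1)).\<close>
  have Sdiff: "A2_norm p (\<lambda>z. S (k + i) z - S k z) \<le> 4/3 * (t k - t (k + i))" for k i
  proof (induction i)
    case 0
    then show ?case by (simp add: A2_norm_eq L2_norm_sq_def)
  next
    case (Suc i)
    let ?r = "\<lambda>z. \<epsilon> (k + i) (S (k + i)) * of_real (t (k + i)) * y (k + i) z"
    have "A2_norm p (\<lambda>z. S (k + Suc i) z - S k z) = A2_norm p (\<lambda>z. (S (k + i) z - S k z) + ?r z)"
      by (simp add: SS algebra_simps)
    also have "\<dots> \<le> A2_norm p (\<lambda>z. S (k + i) z - S k z) + A2_norm p ?r"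
      by (intro A2_norm_triangle L2x A2_diff A2_scale p SA y)
    also have "A2_norm p ?r = t (k + i)"
      unfolding A2_norm_scale y(2) using \<epsilon>1 t(1)[of "k + i"] by (simp add: norm_mult)
    also have "A2_norm p (\<lambda>z. S (k + i) z - S k z) + t (k + i) \<le> 4/3 * (t k - t (k + i)) + t (k + i)"
      using Suc by simp
    also have "\<dots> \<le> 4/3 * (t k - t (k + Suc i))"
      using t(3)[of "k + i"] by (simp only: add_Suc_right right_diff_distrib)
    finally show ?case .
  qed
  have Sdiff': "A2_norm p (\<lambda>z. S (k + i) z - S k z) \<le> 4/3 * t k" for k i
    using Sdiff[of k i] t(1)[of "k + i"] by simp
  have "\<exists>c. (\<lambda>j. taylor_coeff (S j) n) \<longlonglongrightarrow> c" for n
  proof -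
    have "Cauchy (\<lambda>j. taylor_coeff (S j) n)"
    proof (rule metric_CauchyI)
      fix e :: real assume e: "e > 0"
      define W where "W = sqrt (bergman_weight p n)"
      have W: "W > 0" using bergman_weight_pos[OF p, of n] by (simp add: W_def)
      have near: "cmod (taylor_coeff (S (k + i)) n - taylor_coeff (S k) n) \<le> 4/3 * t k / W" for k i
      proof -
        have "cmod (taylor_coeff (\<lambda>z. S (k + i) z - S k z) n) \<le> A2_norm p (\<lambda>z. S (k + i) z - S k z) / W"
          unfolding W_def by (intro taylor_coeff_A2_norm_le A2_diff p SA)
        also have "\<dots> \<le> 4/3 * t k / W" using W Sdiff'[of k i] by (intro divide_right_mono) auto
        finally show ?thesis by (simp add: taylor_coeff_diff A2_disk_fun[OF SA])
      qed
      have "t \<longlonglongrightarrow> 0" unfolding t_def using x(1) \<delta>1 by (intro LIMSEQ_power_zero) auto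
      then have "(\<lambda>k. 4/3 * t k / W) \<longlonglongrightarrow> 4/3 * 0 / W" using W by (intro tendsto_intros) auto
      then have "\<forall>\<^sub>F k in sequentially. 4/3 * t k / W < e / 2"
        using e by (intro order_tendstoD(2)) auto
      then obtain k where k: "4/3 * t k / W < e / 2" by (auto simp: eventually_sequentially)
      have close: "cmod (taylor_coeff (S i) n - taylor_coeff (S k) n) < e / 2" if "i \<ge> k" for i
        using near[of k "i - k"] k that by simp
      show "\<exists>M. \<forall>m\<ge>M. \<forall>i\<ge>M. dist (taylor_coeff (S m) n) (taylor_coeff (S i) n) < e"
      proof (intro exI allI impI)
        fix m i assume "k \<le> m" "k \<le> i"
        then show "dist (taylor_coeff (S m) n) (taylor_coeff (S i) n) < e"
          by (intro dist_triangle_half_l[where y="taylor_coeff (S k) n" and e=e]; unfold dist_norm; intro close)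
      qed
    qed
    then have "convergent (\<lambda>j. taylor_coeff (S j) n)" by (rule Cauchy_convergent)
    then show ?thesis unfolding convergent_def .
  qed
  then obtain c where c: "\<And>n. (\<lambda>j. taylor_coeff (S j) n) \<longlonglongrightarrow> c n" by metis
  \<comment> \<open>Fatou applied to the differences from S k gives the limit function, for k = 0,
    and at the same time the distance of every S k from it.\<close>
  have tails: "disk_series (\<lambda>n. c n - taylor_coeff (S k) n) \<in> A2 p \<and> (\<forall>n. taylor_coeff (disk_series (\<lambda>n. c n - taylor_coeff (S k) n)) n = c n - taylor_coeff (S k) n)
     \<and> L2_norm_sq p (disk_series (\<lambda>n. c n - taylor_coeff (S k) n)) \<le> (4/3 * t k)\<^sup>2" for k
  proof -
    have g: "(\<lambda>z. S (i + k) z - S k z) \<in> A2 p" for i by (intro A2_diff p SA)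
    have b: "L2_norm_sq p (\<lambda>z. S (i + k) z - S k z) \<le> (4/3 * t k)\<^sup>2" for i
      unfolding A2_norm_squared[symmetric] using Sdiff'[of k i] by (intro power_mono) (auto simp: add.commute)
    have l: "(\<lambda>i. taylor_coeff (\<lambda>z. S (i + k) z - S k z) n) \<longlonglongrightarrow> c n - taylor_coeff (S k) n" for n
      unfolding taylor_coeff_diff[OF A2_disk_fun[OF SA] A2_disk_fun[OF SA]]
      by (intro tendsto_diff tendsto_const LIMSEQ_ignore_initial_segment c)
    from A2_fatou[OF p g b l] show ?thesis by blast
  qed
  define f where "f = disk_series c"
  have tcS0: "taylor_coeff (S 0) n = 0" for n unfolding S0 by (rule taylor_coeff_unique) simp
  have f: "f \<in> A2 p" "taylor_coeff f n = c n" for n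
    using tails[of 0] by (auto simp: f_def tcS0)
  have rest: "A2_norm p (\<lambda>z. f z - S k z) \<le> 4/3 * t k" for k
  proof -
    have "(\<lambda>z. f z - S k z) = disk_series (\<lambda>n. c n - taylor_coeff (S k) n)"
      using tails[of k] by (intro A2_eqI[where p=p] A2_diff p f(1) SA) (auto simp: taylor_coeff_diff A2_disk_fun[OF SA] A2_disk_fun[OF f(1)] f(2))
    then show ?thesis
      using tails[of k] t(1)[of k] real_sqrt_le_mono by (fastforce simp: A2_norm_eq)
  qed
  have Ef: "E_bar_op p \<phi> f \<in> A2 (p - 2)" using range f(1) by blast
  define Cf where "Cf = A2_norm p (euler_op p (E_bar_op p \<phi> f))"
  \<comment> \<open>The k-th pairing with f keeps at least 2/3 of t_k \<delta>, since the later
    terms take away at most a third. By moving L across it is also at most Cf t_k / (k + 1), so t_k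
    cancels and large k contradicts.\<close>
  have "\<delta> / 2 < Cf / (real k + 1)" for k
  proof -
    have "t k * \<delta> \<le> cmod (\<Lambda> (y k) (S (Suc k)))" by (rule Sstep)
    also have "\<Lambda> (y k) (S (Suc k)) = \<Lambda> (y k) f - \<Lambda> (y k) (\<lambda>z. f z - S (Suc k) z)"
    proof -
      have "\<Lambda> (y k) (\<lambda>z. f z + (-1) * (f z - S (Suc k) z)) = \<Lambda> (y k) f + (-1) * \<Lambda> (y k) (\<lambda>z. f z - S (Suc k) z)"
        by (intro \<Lambda>_add A2_diff p f SA y)
      then show ?thesis by simp
    qed
    also have "cmod \<dots> \<le> cmod (\<Lambda> (y k) f) + cmod (\<Lambda> (y k) (\<lambda>z. f z - S (Suc k) z))"
      by (rule norm_triangle_ineq4)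
    also have "cmod (\<Lambda> (y k) (\<lambda>z. f z - S (Suc k) z)) \<le> 4/3 * t (Suc k) * 1"
      using \<Lambda>_bound[OF A2_diff[OF p f(1) SA[of "Suc k"]] y(1), of k] rest[of "Suc k"] y(2)[of k] by simp
    also have "\<dots> = t k * \<delta> / 3" by (simp add: t(2))
    finally have "2/3 * (t k * \<delta>) \<le> cmod (\<Lambda> (y k) f)" by simp
    also have "\<Lambda> (y k) f = A2_inner p (euler_op p (E_bar_op p \<phi> f)) (euler_inverse p (y k))"
      unfolding \<Lambda>_def A2_inner_euler_op_euler_inverse[OF p Ef y(1)] by (rule E_bar_A2(2)[OF p \<phi> f(1) y(1), symmetric])
    also have "cmod \<dots> \<le> Cf * A2_norm p (euler_inverse p (y k))"
      unfolding Cf_def by (intro A2_cauchy_schwarz L2x euler_op_A2 euler_inverse_A2 p Ef y)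
    also have "\<dots> \<le> Cf * (t k / (real k + 1))"
      using m[of k] by (intro mult_left_mono) (auto simp: y_def Cf_def)
    finally have "t k * (2/3 * \<delta>) \<le> t k * (Cf / (real k + 1))" by (simp add: mult_ac)
    then have "2/3 * \<delta> \<le> Cf / (real k + 1)" by (simp only: mult_le_cancel_left_pos[OF t(1)])
    then show ?thesis using x(1) by simp
  qed
  note bd = this
  obtain k where "Cf / (\<delta> / 2) < real k" using reals_Archimedean2 by blast
  then have "Cf < \<delta> / 2 * (real k + 1)" using x(1) by (simp add: field_simps)
  then have "Cf / (real k + 1) < \<delta> / 2" by (simp add: pos_divide_less_eq)
  with bd[of k] show False by simp
qed

section \<open>The defect function of a Blaschke product\<close>

text \<open>The margin R > 1 bounds the function and its derivative on the unit disk by compactness,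
  and it survives products.\<close>

definition analytic_closed_disk :: "(complex \<Rightarrow> complex) \<Rightarrow> bool" where
  "analytic_closed_disk e \<longleftrightarrow> (\<exists>R>1. e holomorphic_on ball 0 R)"

lemma analytic_closed_disk_mult:
  assumes "analytic_closed_disk e" "analytic_closed_disk f"
  shows "analytic_closed_disk (\<lambda>z. e z * f z)"
proof -
  obtain R R' where R: "R > 1" "e holomorphic_on ball 0 R" "R' > 1" "f holomorphic_on ball 0 R'"
    using assms by (auto simp: analytic_closed_disk_def)
  have "(\<lambda>z. e z * f z) holomorphic_on ball 0 (min R R')"
    by (intro holomorphic_intros holomorphic_on_subset[OF R(2)] holomorphic_on_subset[OF R(4)]) auto
  with R show ?thesis unfolding analytic_closed_disk_def by (intro exI[of _ "min R R'"]) auto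
qed

lemma analytic_closed_disk_divide:
  assumes a: "cmod a < 1" and u: "u holomorphic_on UNIV"
  shows "analytic_closed_disk (\<lambda>z. u z / (1 - cnj a * z))"
  unfolding analytic_closed_disk_def
proof (intro exI conjI)
  \<comment> \<open>A radius strictly between 1 and the modulus 1 / |a| of the pole, which also
    makes sense for a = 0.\<close>
  show "1 < 2 / (1 + cmod a)"
    using a norm_ge_zero[of a] by (subst less_divide_eq_1_pos) linarith+
  have "1 - cnj a * z \<noteq> 0" if "cmod z < 2 / (1 + cmod a)" for z
  proof
    assume "1 - cnj a * z = 0"
    then have "cmod (cnj a * z) = 1" by simp
    then have "cmod a * cmod z = 1" by (simp add: norm_mult)
    moreover have "cmod a * cmod z \<le> cmod a * (2 / (1 + cmod a))"
      using that by (intro mult_left_mono) auto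
    moreover have "cmod a * 2 / (1 + cmod a) < 1"
      using a norm_ge_zero[of a] by (subst divide_less_eq_1_pos) linarith+
    ultimately show False by simp
  qed
  then show "(\<lambda>z. u z / (1 - cnj a * z)) holomorphic_on ball 0 (2 / (1 + cmod a))"
    by (intro holomorphic_intros holomorphic_on_subset[OF u]) auto
qed

lemma analytic_closed_disk_bounds:
  assumes "analytic_closed_disk e"
  obtains C where "C > 0" "e holomorphic_on unit_disk" "\<And>z. z \<in> unit_disk \<Longrightarrow> cmod (e z) \<le> C" "\<And>z. z \<in> unit_disk \<Longrightarrow> cmod (deriv e z) \<le> C"
proof -
  obtain R where R: "R > 1" "e holomorphic_on ball 0 R"
    using assms by (auto simp: analytic_closed_disk_def)
  have sub: "cball 0 1 \<subseteq> ball (0::complex) R" using R by auto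
  have "bounded (e ` cball 0 1)"
    by (intro compact_imp_bounded compact_continuous_image holomorphic_on_imp_continuous_on holomorphic_on_subset[OF R(2) sub]) simp
  moreover have "bounded (deriv e ` cball 0 1)"
    by (intro compact_imp_bounded compact_continuous_image holomorphic_on_imp_continuous_on
        holomorphic_on_subset[OF holomorphic_deriv[OF R(2)] sub]) auto
  ultimately obtain C1 C2 where "\<forall>x\<in>e ` cball 0 1. cmod x \<le> C1" "\<forall>x\<in>deriv e ` cball 0 1. cmod x \<le> C2"
    unfolding bounded_iff by blast
  then have C: "\<And>z. cmod z \<le> 1 \<Longrightarrow> cmod (e z) \<le> C1" "\<And>z. cmod z \<le> 1 \<Longrightarrow> cmod (deriv e z) \<le> C2"
    by auto
  have "e holomorphic_on unit_disk"
    by (rule holomorphic_on_subset[OF R(2)]) (use R in auto)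
  then show ?thesis
    using C by (intro that[of "max 1 (max C1 C2)"]) (force simp: le_max_iff_disj)+
qed

text \<open>Telescoping \<open>1 - |b B|\<^sup>2 = (1 - |b|\<^sup>2) + |b|\<^sup>2 (1 - |B|\<^sup>2)\<close> over the Moebius factors.\<close>

lemma blaschke_prod_defect:
  assumes "set as \<subseteq> unit_disk"
  shows "\<exists>e. (\<forall>j<length as. analytic_closed_disk (e j)) \<and>
     (\<forall>z\<in>unit_disk. 1 - (cmod (blaschke_prod as z))\<^sup>2 = (1 - (cmod z)\<^sup>2) * (\<Sum>j<length as. (cmod (e j z))\<^sup>2)) \<and>
     (as \<noteq> [] \<longrightarrow> (\<exists>c>0. \<forall>z\<in>unit_disk. c \<le> (cmod (e 0 z))\<^sup>2))"
  using assms
proof (induction as)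
  case (Cons a as)
  then have "set as \<subseteq> unit_disk" by simp
  from Cons.IH[OF this] obtain e where "(\<forall>j<length as. analytic_closed_disk (e j)) \<and>
     (\<forall>z\<in>unit_disk. 1 - (cmod (blaschke_prod as z))\<^sup>2 = (1 - (cmod z)\<^sup>2) * (\<Sum>j<length as. (cmod (e j z))\<^sup>2))"
    by blast
  then have e: "\<And>j. j < length as \<Longrightarrow> analytic_closed_disk (e j)"
    "\<And>z. z \<in> unit_disk \<Longrightarrow> 1 - (cmod (blaschke_prod as z))\<^sup>2 = (1 - (cmod z)\<^sup>2) * (\<Sum>j<length as. (cmod (e j z))\<^sup>2)"
    by blast+
  have a: "cmod a < 1" using Cons.prems by simp
  have a2: "0 < 1 - (cmod a)\<^sup>2" using a by (simp add: abs_square_less_1)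
  \<comment> \<open>The normalized Szego kernel at a: its squared modulus times 1 - |z|^2 is the
    defect of the Moebius factor.\<close>
  define k where "k z = of_real (sqrt (1 - (cmod a)\<^sup>2)) / (1 - cnj a * z)" for z
  have k2: "(cmod (k z))\<^sup>2 = (1 - (cmod a)\<^sup>2) / (cmod (1 - cnj a * z))\<^sup>2" for z
    using a2 by (simp only: k_def norm_divide norm_of_real power_divide power2_abs) simp
  \<comment> \<open>The kernel of the new factor goes to the front, so that index 0 always holds a
    function bounded away from zero; the older functions pick up the Moebius factor.\<close>
  define e' where "e' j = (case j of 0 \<Rightarrow> k | Suc i \<Rightarrow> (\<lambda>z. moebius a z * e i z))" for j
  have ack: "analytic_closed_disk k"
    unfolding k_def[abs_def] by (rule analytic_closed_disk_divide[OF a]) auto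
  have acm: "analytic_closed_disk (moebius a)"
    unfolding moebius_def[abs_def] by (rule analytic_closed_disk_divide[OF a]) (intro holomorphic_intros)
  show ?case
  proof (intro exI[of _ e'] conjI allI impI ballI)
    fix j assume "j < length (a # as)"
    then show "analytic_closed_disk (e' j)"
      using ack analytic_closed_disk_mult[OF acm e(1)] by (cases j) (auto simp: e'_def)
  next
    fix z :: complex assume z: "z \<in> unit_disk"
    have nz: "1 - cnj a * z \<noteq> 0" using one_minus_cnj_mult_bounds(3)[OF a] z by simp
    have "1 - (cmod (blaschke_prod (a # as) z))\<^sup>2
      = (1 - (cmod (moebius a z))\<^sup>2) + (cmod (moebius a z))\<^sup>2 * (1 - (cmod (blaschke_prod as z))\<^sup>2)"
      by (simp add: norm_mult power_mult_distrib algebra_simps)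
    also have "1 - (cmod (moebius a z))\<^sup>2 = (1 - (cmod z)\<^sup>2) * (cmod (k z))\<^sup>2"
      unfolding one_minus_moebius_square[OF nz] k2 by simp
    also have "(cmod (moebius a z))\<^sup>2 * (1 - (cmod (blaschke_prod as z))\<^sup>2)
        = (1 - (cmod z)\<^sup>2) * (\<Sum>j<length as. (cmod (moebius a z * e j z))\<^sup>2)"
      unfolding e(2)[OF z] norm_mult power_mult_distrib sum_distrib_left[symmetric] by simp
    finally show "1 - (cmod (blaschke_prod (a # as) z))\<^sup>2 = (1 - (cmod z)\<^sup>2) * (\<Sum>j<length (a # as). (cmod (e' j z))\<^sup>2)"
      by (simp only: list.size sum.lessThan_Suc_shift e'_def nat.case add_Suc_right add_0_right distrib_left)
  next
    show "\<exists>c>0. \<forall>z\<in>unit_disk. c \<le> (cmod (e' 0 z))\<^sup>2"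
    proof (intro exI[of _ "(1 - (cmod a)\<^sup>2) / 4"] conjI ballI)
      fix z :: complex assume z: "z \<in> unit_disk"
      have "0 < (cmod (1 - cnj a * z))\<^sup>2" "(cmod (1 - cnj a * z))\<^sup>2 \<le> 2\<^sup>2"
        using one_minus_cnj_mult_bounds(3)[OF a, of z] z
          power_mono[OF one_minus_cnj_mult_bounds(2)[OF a, of z] norm_ge_zero, of 2] by auto
      then have "(1 - (cmod a)\<^sup>2) / 4 \<le> (1 - (cmod a)\<^sup>2) / (cmod (1 - cnj a * z))\<^sup>2"
        using a2 by (intro divide_left_mono) auto
      then show "(1 - (cmod a)\<^sup>2) / 4 \<le> (cmod (e' 0 z))\<^sup>2"
        by (simp add: e'_def k2)
    qed (use a2 in simp)
  qed
qed simp

section \<open>The multiplier 1 - |z|^2 and the Euler operator\<close>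

definition disk_weight :: "complex \<Rightarrow> complex" where
  "disk_weight z = of_real (1 - (cmod z)\<^sup>2)"

lemma disk_weight_measurable [measurable]: "disk_weight \<in> borel_measurable borel"
  unfolding disk_weight_def[abs_def] by measurable

lemma disk_weight_bounded: "z \<in> unit_disk \<Longrightarrow> cmod (disk_weight z) \<le> 1"
  unfolding disk_weight_def norm_of_real by (simp add: abs_le_iff power_le_one)

lemma L2_disk_weight: "p > -1 \<Longrightarrow> L2 p f \<Longrightarrow> L2 p (\<lambda>z. disk_weight z * f z)"
  by (rule L2_mult_bounded(1)[where C=1]) (auto intro: disk_weight_bounded)

lemma A2_norm_disk_weight_le: "p > -1 \<Longrightarrow> L2 p f \<Longrightarrow> A2_norm p (\<lambda>z. disk_weight z * f z) \<le> A2_norm p f"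
  using L2_mult_bounded(2)[of p f disk_weight 1] by (simp add: A2_norm_eq disk_weight_bounded)

text \<open>Multiplying the measure by 1 - |z|^2 raises its exponent by one; the constant compares
  the normalizations p + 1 and p + 2.\<close>

lemma A2_inner_disk_weight:
  assumes p: "p > -1" and [measurable]: "u \<in> borel_measurable borel" "v \<in> borel_measurable borel"
  shows "A2_inner p (\<lambda>z. disk_weight z * u z) v = of_real ((p + 1) / (p + 2)) * A2_inner (p + 1) u v"
proof -
  have dens: "bergman_density p z *\<^sub>R (disk_weight z * u z * cnj (v z))
      = of_real ((p + 1) / (p + 2)) * (bergman_density (p + 1) z *\<^sub>R (u z * cnj (v z)))" for z
  proof (cases "z \<in> unit_disk")
    case True
    then have z: "0 < 1 - (cmod z)\<^sup>2" by (simp add: abs_square_less_1)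
    have "bergman_density p z * (1 - (cmod z)\<^sup>2) = (p + 1) / (p + 2) * bergman_density (p + 1) z"
      using True z p by (simp add: bergman_density_def powr_add add.commute)
    then have "of_real (bergman_density p z) * disk_weight z = complex_of_real ((p + 1) / (p + 2)) * of_real (bergman_density (p + 1) z)"
      unfolding disk_weight_def of_real_mult[symmetric] by simp
    then show ?thesis unfolding scaleR_conv_of_real by (metis mult.assoc)
  qed (simp add: bergman_density_def)
  have "A2_inner p (\<lambda>z. disk_weight z * u z) v = (\<integral>z. bergman_density p z *\<^sub>R (disk_weight z * u z * cnj (v z)) \<partial>lborel)"
    unfolding A2_inner_def dA_weighted_eq_density[OF p]
    by (subst integral_density) (auto simp: bergman_density_nonneg[OF p])
  also have "\<dots> = of_real ((p + 1) / (p + 2)) * (\<integral>z. bergman_density (p + 1) z *\<^sub>R (u z * cnj (v z)) \<partial>lborel)"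
    unfolding dens by (rule integral_mult_right_zero)
  also have "(\<integral>z. bergman_density (p + 1) z *\<^sub>R (u z * cnj (v z)) \<partial>lborel) = A2_inner (p + 1) u v"
    using p unfolding A2_inner_def by (subst dA_weighted_eq_density, simp, subst integral_density) (auto simp: bergman_density_nonneg)
  finally show ?thesis .
qed

lemma bergman_weight_plus1_le:
  assumes p: "p > -1"
  shows "bergman_weight (p + 1) n \<le> bergman_weight p n"
proof -
  have "bergman_weight (p + 1) n * (p + 2) \<le> bergman_weight (p + 1) n * (real n + p + 2)"
    using bergman_weight_pos[of "p + 1" n] p by (intro mult_left_mono) auto
  then show ?thesis using bergman_weight_plus1[OF p, of n] p by simp
qed

lemma A2_subset_plus1:
  assumes p: "p > -1" and f: "f \<in> A2 p"
  shows "f \<in> A2 (p + 1)"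
proof -
  have sm: "summable (\<lambda>n. (cmod (taylor_coeff f n))\<^sup>2 * bergman_weight p n)" and df: "disk_fun f"
    using f by (auto simp: A2_iff[OF p])
  have "summable (\<lambda>n. (cmod (taylor_coeff f n))\<^sup>2 * bergman_weight (p + 1) n)"
  proof (rule summable_comparison_test[OF _ sm], intro exI allI impI)
    fix n
    show "norm ((cmod (taylor_coeff f n))\<^sup>2 * bergman_weight (p + 1) n) \<le> (cmod (taylor_coeff f n))\<^sup>2 * bergman_weight p n"
      using bergman_weight_plus1_le[OF p, of n] bergman_weight_pos[of "p + 1" n] p by (simp add: mult_left_mono)
  qed
  with df show ?thesis
    using p by (subst A2_iff) auto
qed

text \<open>Passing to the weight p + 1 makes \<open>bergman_weight_plus1\<close> absorb the
  eigenvalue \<open>n + p + 2\<close>. Here h plays the role of L g, described by coefficients so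
  that functions given by a product rule can be inserted directly.\<close>

lemma A2_inner_disk_weight_euler_op:
  assumes p: "p > -1" and u: "u \<in> A2 p" and g: "g \<in> A2 p" and h: "h \<in> A2 p"
    and taylor_coeff: "\<And>n. taylor_coeff h n = of_real (real n + p + 2) * taylor_coeff g n"
  shows "A2_inner p (\<lambda>z. disk_weight z * u z) h = of_real (p + 1) * A2_inner p u g"
proof -
  have p1: "p + 1 > -1" using p by simp
  have "(\<lambda>n. taylor_coeff u n * cnj (taylor_coeff h n) * of_real (bergman_weight (p + 1) n)) sums A2_inner (p + 1) u h"
    by (intro A2_inner_sums p1 A2_subset_plus1 p u h)
  moreover have "(\<lambda>n. of_real (p + 2) * (taylor_coeff u n * cnj (taylor_coeff g n) * of_real (bergman_weight p n))) sums (of_real (p + 2) * A2_inner p u g)"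
    by (intro sums_mult A2_inner_sums p u g)
  moreover have "taylor_coeff u n * cnj (taylor_coeff h n) * of_real (bergman_weight (p + 1) n)
      = of_real (p + 2) * (taylor_coeff u n * cnj (taylor_coeff g n) * of_real (bergman_weight p n))" for n
  proof -
    have "taylor_coeff u n * cnj (taylor_coeff h n) * of_real (bergman_weight (p + 1) n)
      = taylor_coeff u n * cnj (taylor_coeff g n) * of_real (bergman_weight (p + 1) n * (real n + p + 2))"
      unfolding taylor_coeff by (simp only: complex_cnj_mult complex_cnj_complex_of_real of_real_mult mult_ac)
    then show ?thesis unfolding bergman_weight_plus1[OF p] by (simp only: of_real_mult mult_ac)
  qed
  ultimately have eq: "A2_inner (p + 1) u h = of_real (p + 2) * A2_inner p u g"
    by (simp add: sums_unique2)
  have "A2_inner p (\<lambda>z. disk_weight z * u z) h = of_real ((p + 1) / (p + 2)) * (of_real (p + 2) * A2_inner p u g)"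
    unfolding eq[symmetric] by (intro A2_inner_disk_weight p L2_measurable[OF A2_L2[OF p]] u h)
  also have "\<dots> = of_real ((p + 1) / (p + 2) * (p + 2)) * A2_inner p u g"
    by (simp only: of_real_mult mult.assoc)
  also have "(p + 1) / (p + 2) * (p + 2) = p + 1" using p by simp
  finally show ?thesis .
qed

lemma taylor_coeff_euler:
  assumes f: "disk_fun f" and g: "disk_fun g"
    and eq: "\<And>z. z \<in> unit_disk \<Longrightarrow> g z = z * deriv f z + of_real s * f z"
  shows "taylor_coeff g n = of_real (real n + s) * taylor_coeff f n"
proof (rule taylor_coeff_unique)
  fix z :: complex assume z: "z \<in> unit_disk"
  have "(\<lambda>n. taylor_coeff (deriv f) n * z ^ n) sums deriv f z"
    using z f by (intro taylor_coeff_sums holomorphic_deriv) (auto simp: disk_fun_def)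
  then have "(\<lambda>n. z * (taylor_coeff (deriv f) n * z ^ n)) sums (z * deriv f z)"
    by (rule sums_mult)
  moreover have "z * (taylor_coeff (deriv f) n * z ^ n) = of_nat (Suc n) * taylor_coeff f (Suc n) * z ^ Suc n" for n
  proof -
    have "taylor_coeff (deriv f) n = of_nat (Suc n) * taylor_coeff f (Suc n)"
      by (simp add: taylor_coeff_def funpow_Suc_right del: funpow.simps of_nat_Suc)
    then show ?thesis by simp
  qed
  ultimately have "(\<lambda>n. of_nat (Suc n) * taylor_coeff f (Suc n) * z ^ Suc n) sums (z * deriv f z)"
    by simp
  \<comment> \<open>The term for n = 0 vanishes, so undoing the index shift leaves the sum
    unchanged.\<close>
  then have "(\<lambda>n. of_nat n * taylor_coeff f n * z ^ n) sums (z * deriv f z)"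
    by (subst (asm) sums_Suc_iff) simp
  then have "(\<lambda>n. of_nat n * taylor_coeff f n * z ^ n + of_real s * (taylor_coeff f n * z ^ n)) sums (z * deriv f z + of_real s * f z)"
    by (intro sums_add sums_mult disk_fun_sums f z)
  then show "(\<lambda>n. of_real (real n + s) * taylor_coeff f n * z ^ n) sums g z"
    unfolding eq[OF z] by (simp add: distrib_right mult.assoc)
qed

lemma disk_poly_euler:
  assumes z: "z \<in> unit_disk"
  shows "disk_poly N (\<lambda>n. of_real (real n + s) * c n) z = z * deriv (disk_poly N c) z + of_real s * disk_poly N c z"
proof -
  define g where "g = disk_restrict (\<lambda>z. z * deriv (disk_poly N c) z + of_real s * disk_poly N c z)"
  have h: "disk_poly N c holomorphic_on unit_disk" by (intro disk_fun_hol disk_fun_poly)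
  have g: "disk_fun g"
    unfolding g_def by (intro disk_fun_disk_restrict holomorphic_intros holomorphic_deriv h) auto
  have "taylor_coeff g n = of_real (real n + s) * taylor_coeff (disk_poly N c) n" for n
    by (rule taylor_coeff_euler[OF disk_fun_poly g]) (simp add: g_def disk_restrict_def)
  then have "g = disk_poly N (\<lambda>n. of_real (real n + s) * c n)"
    by (intro disk_fun_eqI g disk_fun_poly) (simp add: taylor_coeff_poly)
  then show ?thesis using z by (simp add: g_def disk_restrict_def fun_eq_iff) (metis)
qed

text \<open>Elimination by one unknown at a time; the nonvanishing form guarantees a nonzero pivot
  at every stage.\<close>

lemma galerkin_solvable:
  fixes G :: "nat \<Rightarrow> nat \<Rightarrow> complex"
  assumes pd: "\<And>N c. (\<exists>n<N. c n \<noteq> 0) \<Longrightarrow> (\<Sum>m<N. cnj (c m) * (\<Sum>n<N. c n * G m n)) \<noteq> 0"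
  shows "\<exists>c. \<forall>m<N. (\<Sum>n<N. c n * G m n) = b m"
proof (induction N arbitrary: b)
  case (Suc N)
  obtain q where q: "\<And>m. m < N \<Longrightarrow> (\<Sum>n<N. q n * G m n) = G m N" using Suc.IH[of "\<lambda>m. G m N"] by blast
  obtain f where f: "\<And>m. m < N \<Longrightarrow> (\<Sum>n<N. f n * G m n) = b m" using Suc.IH[of b] by blast
  \<comment> \<open>A vector with last entry 1 that the first N rows annihilate.\<close>
  define p where "p n = (if n < N then - q n else 1)" for n
  have pS: "(\<Sum>n<Suc N. p n * G m n) = G m N - (\<Sum>n<N. q n * G m n)" for m
    by (simp add: p_def sum_negf)
  have p0: "(\<Sum>n<Suc N. p n * G m n) = 0" if "m < N" for m
    unfolding pS q[OF that] by simp
  \<comment> \<open>The Schur complement of the last row. It equals the quadratic form at p, where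
    all other rows drop out, and is therefore nonzero.\<close>
  define D where "D = (\<Sum>n<Suc N. p n * G N n)"
  have "(\<Sum>m<Suc N. cnj (p m) * (\<Sum>n<Suc N. p n * G m n)) \<noteq> 0"
    by (rule pd) (auto simp: p_def)
  also have "(\<Sum>m<Suc N. cnj (p m) * (\<Sum>n<Suc N. p n * G m n)) = D"
    using p0 unfolding D_def sum.lessThan_Suc[of "\<lambda>m. cnj (p m) * _ m"]
    by (simp add: p_def)
  finally have D: "D \<noteq> 0" .
  define t where "t = (b N - (\<Sum>n<N. f n * G N n)) / D"
  define c where "c n = (if n < N then f n else 0) + t * p n" for n
  have cS: "(\<Sum>n<Suc N. c n * G m n) = (\<Sum>n<N. f n * G m n) + t * (\<Sum>n<Suc N. p n * G m n)" for m
  proof -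
    have "(\<Sum>n<Suc N. c n * G m n) = (\<Sum>n<Suc N. (if n < N then f n else 0) * G m n) + (\<Sum>n<Suc N. t * (p n * G m n))"
      by (simp only: c_def distrib_right sum.distrib mult.assoc)
    also have "(\<Sum>n<Suc N. (if n < N then f n else 0) * G m n) = (\<Sum>n<N. f n * G m n)"
      by simp
    finally show ?thesis by (simp only: sum_distrib_left)
  qed
  show ?case
  proof (intro exI[of _ c] allI impI)
    fix m assume "m < Suc N"
    show "(\<Sum>n<Suc N. c n * G m n) = b m"
    proof (cases "m < N")
      case True
      then show ?thesis unfolding cS p0[OF True] by (simp add: f)
    next
      case False
      with \<open>m < Suc N\<close> have "m = N" by simp
      have "(\<Sum>n<Suc N. c n * G m n) = (\<Sum>n<N. f n * G N n) + t * D"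
        unfolding cS D_def \<open>m = N\<close> ..
      also have "\<dots> = b N" using D by (simp add: t_def)
      finally show ?thesis using \<open>m = N\<close> by (simp only:)
    qed
  qed
qed simp

text \<open>Weak sequential compactness of balls: a diagonal sequence makes all coefficients
  converge, and Fatou puts the limit in the same ball.\<close>

lemma A2_bounded_subsequence:
  assumes p: "p > -1" and h: "\<And>j. h j \<in> A2 p" and C: "\<And>j. A2_norm p (h j) \<le> C"
  obtains r g where "strict_mono (r :: nat \<Rightarrow> nat)" "g \<in> A2 p" "A2_norm p g \<le> C" "\<And>n. (\<lambda>j. taylor_coeff (h (r j)) n) \<longlonglongrightarrow> taylor_coeff g n"
proof -
  \<comment> \<open>Rescaled so that one bound C serves all n, as the diagonal argument
    requires.\<close>
  let ?F = "\<lambda>j n. taylor_coeff (h j) n * of_real (sqrt (bergman_weight p n))"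
  have w: "sqrt (bergman_weight p n) > 0" for n using bergman_weight_pos[OF p, of n] by simp
  have "norm (?F j n) \<le> C" for j n
    using taylor_coeff_A2_norm_le[OF p h, of j n] C[of j] w[of n] by (simp add: norm_mult field_simps)
  then obtain r where r: "strict_mono (r :: nat \<Rightarrow> nat)" "\<And>n. n \<in> UNIV \<Longrightarrow> \<exists>l. (\<lambda>j. ?F (r j) n) \<longlonglongrightarrow> l"
    by (rule function_convergent_subsequence[where S=UNIV and f="?F" and M=C, rotated]) auto
  have "\<exists>l. (\<lambda>j. taylor_coeff (h (r j)) n) \<longlonglongrightarrow> l" for n
  proof -
    obtain l where "(\<lambda>j. ?F (r j) n) \<longlonglongrightarrow> l" using r(2) by blast
    then have "(\<lambda>j. ?F (r j) n / of_real (sqrt (bergman_weight p n))) \<longlonglongrightarrow> l / of_real (sqrt (bergman_weight p n))"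
      using w[of n] by (intro tendsto_intros) auto
    then show ?thesis using w[of n] by auto
  qed
  then obtain c where c: "\<And>n. (\<lambda>j. taylor_coeff (h (r j)) n) \<longlonglongrightarrow> c n" by metis
  have b: "L2_norm_sq p (h (r j)) \<le> C\<^sup>2" for j
    unfolding A2_norm_squared[symmetric] by (intro power_mono C) simp
  note F = A2_fatou[of p "\<lambda>j. h (r j)", OF p h b c]
  have "0 \<le> C" using C[of 0] order_trans[OF A2_norm_nonneg] by blast
  then have "A2_norm p (disk_series c) \<le> C"
    using real_sqrt_le_mono[OF F(3)] by (simp add: A2_norm_eq)
  then show ?thesis using that[OF r(1) F(1)] c F(2) by simp
qed

section \<open>Range and compactness for Blaschke products\<close>

text \<open>What the estimates use of a Blaschke product: the bounds on e_j and its derivative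
  control the commutators, and the lower bound on e_0 gives coercivity. With J = 0 the defect would
  vanish, as it does for unimodular constants.\<close>

locale decomposed_defect =
  fixes p :: real and \<phi> :: "complex \<Rightarrow> complex" and J :: nat and e :: "nat \<Rightarrow> complex \<Rightarrow> complex" and c0 C :: real
  assumes p: "p > -1" and \<phi>: "\<phi> \<in> Hinf1" and J: "0 < J"
    and dec: "\<And>z. z \<in> unit_disk \<Longrightarrow> 1 - (cmod (\<phi> z))\<^sup>2 = (1 - (cmod z)\<^sup>2) * (\<Sum>j<J. (cmod (e j z))\<^sup>2)"
    and hol: "\<And>j. j < J \<Longrightarrow> e j holomorphic_on unit_disk"
    and C: "0 < C" "\<And>j z. j < J \<Longrightarrow> z \<in> unit_disk \<Longrightarrow> cmod (e j z) \<le> C"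
      "\<And>j z. j < J \<Longrightarrow> z \<in> unit_disk \<Longrightarrow> cmod (deriv (e j) z) \<le> C"
    and c0: "0 < c0" "\<And>z. z \<in> unit_disk \<Longrightarrow> c0 \<le> (cmod (e 0 z))\<^sup>2"
begin

lemma mult_e:
  assumes "j < J" "q > -1" "f \<in> A2 q"
  shows "(\<lambda>z. e j z * f z) \<in> A2 q" "A2_norm q (\<lambda>z. e j z * f z) \<le> C * A2_norm q f"
  using A2_mult_bounded[OF assms(2,3) hol[OF assms(1)] C(2)[OF assms(1)]] by auto

lemma mult_de:
  assumes "j < J" "q > -1" "f \<in> A2 q"
  shows "(\<lambda>z. z * deriv (e j) z * f z) \<in> A2 q" "A2_norm q (\<lambda>z. z * deriv (e j) z * f z) \<le> C * A2_norm q f"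
proof -
  have h: "(\<lambda>z. z * deriv (e j) z) holomorphic_on unit_disk"
    by (intro holomorphic_intros holomorphic_deriv hol assms) auto
  have b: "cmod (z * deriv (e j) z) \<le> C" if "z \<in> unit_disk" for z
  proof -
    have "cmod z * cmod (deriv (e j) z) \<le> 1 * C"
      using that C(3)[OF assms(1) that] by (intro mult_mono) auto
    then show ?thesis by (simp add: norm_mult)
  qed
  show "(\<lambda>z. z * deriv (e j) z * f z) \<in> A2 q" "A2_norm q (\<lambda>z. z * deriv (e j) z * f z) \<le> C * A2_norm q f"
    using A2_mult_bounded[OF assms(2,3) h b] by auto
qed

text \<open>The reciprocal of e_0 is a multiplier bounded by 1 / sqrt c0. The statement is used for
  both weights p and p + 1.\<close>

lemma norm_mult_e0:
  assumes q: "q > -1" and f: "f \<in> A2 q"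
  shows "c0 * L2_norm_sq q f \<le> L2_norm_sq q (\<lambda>z. e 0 z * f z)"
proof -
  have s: "sqrt c0 > 0" using c0 by simp
  have e0: "sqrt c0 \<le> cmod (e 0 z)" if "z \<in> unit_disk" for z
    using c0(2)[OF that] by (rule real_le_lsqrt[rotated]) (use c0 in auto)
  have nz: "e 0 z \<noteq> 0" if "z \<in> unit_disk" for z using e0[OF that] s by auto
  have h: "(\<lambda>z. 1 / e 0 z) holomorphic_on unit_disk"
    by (intro holomorphic_intros hol J nz)
  have b: "cmod (1 / e 0 z) \<le> 1 / sqrt c0" if "z \<in> unit_disk" for z
    using e0[OF that] s nz[OF that] by (simp add: norm_divide frac_le)
  have eq: "(\<lambda>z. 1 / e 0 z * (e 0 z * f z)) = f"
    using nz A2_disk_fun[OF f] by (auto simp: fun_eq_iff disk_fun_def)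
  have "A2_norm q f \<le> 1 / sqrt c0 * A2_norm q (\<lambda>z. e 0 z * f z)"
    using A2_mult_bounded(2)[OF q mult_e(1)[OF J q f] h b] unfolding eq .
  then have "sqrt c0 * A2_norm q f \<le> A2_norm q (\<lambda>z. e 0 z * f z)"
    using s by (simp add: field_simps)
  then have "(sqrt c0 * A2_norm q f)\<^sup>2 \<le> (A2_norm q (\<lambda>z. e 0 z * f z))\<^sup>2"
    using s by (intro power_mono) auto
  then show ?thesis using c0 by (simp add: power_mult_distrib A2_norm_squared)
qed

lemma A2_inner_defect:
  assumes f: "f \<in> A2 p" and v: "v \<in> A2 p"
  shows "A2_inner p (\<lambda>z. defect \<phi> z * f z) v = (\<Sum>j<J. A2_inner p (\<lambda>z. disk_weight z * (e j z * f z)) (\<lambda>z. e j z * v z))"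
proof -
  have "A2_inner p (\<lambda>z. defect \<phi> z * f z) v
    = (\<integral>z. (\<Sum>j<J. disk_weight z * (e j z * f z) * cnj (e j z * v z)) \<partial>dA_weighted p)"
    unfolding A2_inner_def
  proof (intro Bochner_Integration.integral_cong refl)
    fix z
    show "defect \<phi> z * f z * cnj (v z) = (\<Sum>j<J. disk_weight z * (e j z * f z) * cnj (e j z * v z))"
    proof (cases "z \<in> unit_disk")
      case True
      have "defect \<phi> z = of_real ((1 - (cmod z)\<^sup>2) * (\<Sum>j<J. (cmod (e j z))\<^sup>2))"
        using dec[OF True] True by (simp add: defect_def disk_restrict_def)
      also have "\<dots> = disk_weight z * (\<Sum>j<J. e j z * cnj (e j z))"
        by (simp only: disk_weight_def of_real_mult of_real_sum complex_norm_square)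
      finally show ?thesis
        by (simp add: sum_distrib_left sum_distrib_right mult_ac)
    next
      case False
      then have "f z = 0" using A2_disk_fun[OF f] by (simp add: disk_fun_def)
      then show ?thesis by simp
    qed
  qed
  also have "\<dots> = (\<Sum>j<J. A2_inner p (\<lambda>z. disk_weight z * (e j z * f z)) (\<lambda>z. e j z * v z))"
    unfolding A2_inner_def
    by (intro Bochner_Integration.integral_sum L2_inner_integrable L2_disk_weight A2_L2[OF p] mult_e(1) p f v) auto
  finally show ?thesis .
qed

text \<open>Restricted to polynomials F, for which L F is again a polynomial. The last term comes
  from the commutator of L with multiplication by e_j, which is multiplication by z e_j'.\<close>

lemma A2_inner_defect_euler:
  fixes N c
  defines "F \<equiv> disk_poly N c" and "LF \<equiv> disk_poly N (\<lambda>n. of_real (real n + p + 2) * c n)"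
  assumes f: "f \<in> A2 p"
  shows "A2_inner p (\<lambda>z. defect \<phi> z * f z) LF
    = (\<Sum>j<J. of_real (p + 1) * A2_inner p (\<lambda>z. e j z * f z) (\<lambda>z. e j z * F z)
        - A2_inner p (\<lambda>z. disk_weight z * (e j z * f z)) (\<lambda>z. z * deriv (e j) z * F z))"
proof -
  have F: "F \<in> A2 p" and LF: "LF \<in> A2 p" unfolding F_def LF_def by (rule disk_poly_A2[OF p])+
  have "A2_inner p (\<lambda>z. disk_weight z * (e j z * f z)) (\<lambda>z. e j z * LF z)
      = of_real (p + 1) * A2_inner p (\<lambda>z. e j z * f z) (\<lambda>z. e j z * F z)
        - A2_inner p (\<lambda>z. disk_weight z * (e j z * f z)) (\<lambda>z. z * deriv (e j) z * F z)" if j: "j < J" for j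
  proof -
    \<comment> \<open>By the product rule this is L applied to e_j F.\<close>
    define H where "H z = e j z * LF z + z * deriv (e j) z * F z" for z
    have H: "H \<in> A2 p" unfolding H_def by (intro A2_add mult_e mult_de p j F LF)
    have tcH: "taylor_coeff H n = of_real (real n + p + 2) * taylor_coeff (\<lambda>z. e j z * F z) n" for n
      unfolding add.assoc
    proof (rule taylor_coeff_euler[OF A2_disk_fun[OF mult_e(1)[OF j p F]] A2_disk_fun[OF H]])
      fix z :: complex assume z: "z \<in> unit_disk"
      have d1: "e j field_differentiable at z"
        by (rule holomorphic_on_imp_differentiable_at[OF hol[OF j] open_ball z])
      have d2: "F field_differentiable at z"
        by (rule holomorphic_on_imp_differentiable_at[OF disk_fun_hol[OF A2_disk_fun[OF F]] open_ball z])
      have "deriv (\<lambda>z. e j z * F z) z = e j z * deriv F z + deriv (e j) z * F z"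
        using d1 d2 by (rule deriv_mult)
      moreover have "LF z = z * deriv F z + of_real (p + 2) * F z"
        unfolding LF_def F_def using disk_poly_euler[OF z, of N "p + 2" c] by (simp only: add.assoc)
      ultimately show "H z = z * deriv (\<lambda>z. e j z * F z) z + of_real (p + 2) * (e j z * F z)"
        by (simp add: H_def algebra_simps)
    qed
    have "(\<lambda>z. e j z * LF z) = (\<lambda>z. H z - z * deriv (e j) z * F z)"
      by (simp add: H_def)
    then have "A2_inner p (\<lambda>z. disk_weight z * (e j z * f z)) (\<lambda>z. e j z * LF z)
      = A2_inner p (\<lambda>z. disk_weight z * (e j z * f z)) H - A2_inner p (\<lambda>z. disk_weight z * (e j z * f z)) (\<lambda>z. z * deriv (e j) z * F z)"
      by (simp only:) (intro A2_inner_diff_right L2_disk_weight A2_L2[OF p] p H mult_de mult_e j F f)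
    also have "A2_inner p (\<lambda>z. disk_weight z * (e j z * f z)) H = of_real (p + 1) * A2_inner p (\<lambda>z. e j z * f z) (\<lambda>z. e j z * F z)"
      by (intro A2_inner_disk_weight_euler_op p mult_e H j f F tcH)
    finally show ?thesis .
  qed
  then show ?thesis
    unfolding A2_inner_defect[OF f LF] by (intro sum.cong) auto
qed

text \<open>Each j contributes (p + 1) C^2 from the main term and C^2 from the commutator.\<close>

lemma A2_inner_defect_euler_le:
  assumes f: "f \<in> A2 p"
  shows "cmod (A2_inner p (\<lambda>z. defect \<phi> z * f z) (disk_poly N (\<lambda>n. of_real (real n + p + 2) * c n)))
    \<le> (real J * ((p + 2) * C\<^sup>2)) * A2_norm p f * A2_norm p (disk_poly N c)"
proof -
  let ?F = "disk_poly N c"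
  have F: "?F \<in> A2 p" by (rule disk_poly_A2[OF p])
  have "cmod (\<Sum>j<J. of_real (p + 1) * A2_inner p (\<lambda>z. e j z * f z) (\<lambda>z. e j z * ?F z)
        - A2_inner p (\<lambda>z. disk_weight z * (e j z * f z)) (\<lambda>z. z * deriv (e j) z * ?F z))
     \<le> (\<Sum>j<J. (p + 2) * C\<^sup>2 * (A2_norm p f * A2_norm p ?F))"
  proof (rule sum_norm_le)
    fix j assume "j \<in> {..<J}"
    then have j: "j < J" by simp
    have "cmod (A2_inner p (\<lambda>z. e j z * f z) (\<lambda>z. e j z * ?F z))
        \<le> A2_norm p (\<lambda>z. e j z * f z) * A2_norm p (\<lambda>z. e j z * ?F z)"
      by (intro A2_cauchy_schwarz A2_L2[OF p] mult_e j p f F)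
    also have "\<dots> \<le> (C * A2_norm p f) * (C * A2_norm p ?F)"
      using C(1) by (intro mult_mono mult_e j p f F) auto
    finally have 1: "cmod (A2_inner p (\<lambda>z. e j z * f z) (\<lambda>z. e j z * ?F z)) \<le> C\<^sup>2 * (A2_norm p f * A2_norm p ?F)"
      by (simp add: power2_eq_square mult_ac)
    have "cmod (A2_inner p (\<lambda>z. disk_weight z * (e j z * f z)) (\<lambda>z. z * deriv (e j) z * ?F z))
        \<le> A2_norm p (\<lambda>z. disk_weight z * (e j z * f z)) * A2_norm p (\<lambda>z. z * deriv (e j) z * ?F z)"
      by (intro A2_cauchy_schwarz L2_disk_weight A2_L2[OF p] mult_e mult_de j p f F)
    also have "\<dots> \<le> (C * A2_norm p f) * (C * A2_norm p ?F)"
      using C(1) by (intro mult_mono mult_de order_trans[OF A2_norm_disk_weight_le mult_e(2)] A2_L2[OF p] mult_e j p f F) auto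
    finally have 2: "cmod (A2_inner p (\<lambda>z. disk_weight z * (e j z * f z)) (\<lambda>z. z * deriv (e j) z * ?F z)) \<le> C\<^sup>2 * (A2_norm p f * A2_norm p ?F)"
      by (simp add: power2_eq_square mult_ac)
    have "cmod (of_real (p + 1) * A2_inner p (\<lambda>z. e j z * f z) (\<lambda>z. e j z * ?F z)
        - A2_inner p (\<lambda>z. disk_weight z * (e j z * f z)) (\<lambda>z. z * deriv (e j) z * ?F z))
      \<le> (p + 1) * cmod (A2_inner p (\<lambda>z. e j z * f z) (\<lambda>z. e j z * ?F z))
        + cmod (A2_inner p (\<lambda>z. disk_weight z * (e j z * f z)) (\<lambda>z. z * deriv (e j) z * ?F z))"
      using norm_triangle_ineq4[of "of_real (p + 1) * A2_inner p (\<lambda>z. e j z * f z) (\<lambda>z. e j z * ?F z)"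
          "A2_inner p (\<lambda>z. disk_weight z * (e j z * f z)) (\<lambda>z. z * deriv (e j) z * ?F z)"] p
      unfolding norm_mult[of "of_real (p + 1)"] norm_of_real by simp
    also have "\<dots> \<le> (p + 1) * (C\<^sup>2 * (A2_norm p f * A2_norm p ?F)) + C\<^sup>2 * (A2_norm p f * A2_norm p ?F)"
      using 1 2 p by (intro add_mono mult_left_mono) auto
    also have "\<dots> = (p + 2) * C\<^sup>2 * (A2_norm p f * A2_norm p ?F)" by (simp add: algebra_simps)
    finally show "cmod (of_real (p + 1) * A2_inner p (\<lambda>z. e j z * f z) (\<lambda>z. e j z * ?F z)
        - A2_inner p (\<lambda>z. disk_weight z * (e j z * f z)) (\<lambda>z. z * deriv (e j) z * ?F z)) \<le> (p + 2) * C\<^sup>2 * (A2_norm p f * A2_norm p ?F)" .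
  qed
  then show ?thesis
    unfolding A2_inner_defect_euler[OF f] by (simp add: mult_ac)
qed

text \<open>Duality: a partial sum F of the expansion of L E f, tested against itself, satisfies a
  bound of its squared norm by K times its norm, uniformly in N. Hence L E f exists in
  \<open>A2 p\<close> and has norm at most K.\<close>

lemma E_bar_range:
  assumes f: "f \<in> A2 p"
  shows "E_bar_op p \<phi> f \<in> A2 (p - 2)" "A2_norm p (euler_op p (E_bar_op p \<phi> f)) \<le> (real J * ((p + 2) * C\<^sup>2)) * A2_norm p f"
proof -
  define K where "K = (real J * ((p + 2) * C\<^sup>2)) * A2_norm p f"
  have K0: "K \<ge> 0" using p by (simp add: K_def)
  let ?g = "E_bar_op p \<phi> f"
  let ?L = "\<lambda>n. of_real (real n + p + 2) :: complex"
  have g: "?g \<in> A2 p" by (rule E_bar_A2(1)[OF p \<phi> f])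
  have le: "(\<Sum>n<N. (real n + p + 2)\<^sup>2 * (cmod (taylor_coeff ?g n))\<^sup>2 * bergman_weight p n) \<le> K\<^sup>2" for N
  proof -
    define F where "F = disk_poly N (\<lambda>n. ?L n * taylor_coeff ?g n)"
    have sF: "L2_norm_sq p F = (\<Sum>n<N. (real n + p + 2)\<^sup>2 * (cmod (taylor_coeff ?g n))\<^sup>2 * bergman_weight p n)"
      unfolding F_def L2_norm_sq_poly[OF p] norm_mult norm_of_real power_mult_distrib power2_abs ..
    \<comment> \<open>The test polynomial is L F. One of its two eigenvalue factors moves to E f,
      and the pairing becomes the squared norm of F.\<close>
    have "A2_inner p ?g (disk_poly N (\<lambda>n. ?L n * (?L n * taylor_coeff ?g n)))
       = (\<Sum>n<N. cnj (?L n * (?L n * taylor_coeff ?g n)) * (taylor_coeff ?g n * of_real (bergman_weight p n)))"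
      unfolding A2_inner_poly_right[OF p A2_L2[OF p g]] A2_inner_monom[OF p g] ..
    also have "\<dots> = of_real (L2_norm_sq p F)"
      unfolding sF of_real_sum
    proof (intro sum.cong refl)
      fix n
      define d where "d = real n + p + 2"
      have "cnj (of_real d * (of_real d * taylor_coeff ?g n)) * (taylor_coeff ?g n * of_real (bergman_weight p n))
         = of_real d * of_real d * (taylor_coeff ?g n * cnj (taylor_coeff ?g n)) * of_real (bergman_weight p n)"
        by simp
      also have "\<dots> = of_real (d\<^sup>2 * (cmod (taylor_coeff ?g n))\<^sup>2 * bergman_weight p n)"
        unfolding complex_norm_square[symmetric] by (simp only: of_real_mult power2_eq_square)
      finally show "cnj (?L n * (?L n * taylor_coeff ?g n)) * (taylor_coeff ?g n * of_real (bergman_weight p n))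
        = of_real ((real n + p + 2)\<^sup>2 * (cmod (taylor_coeff ?g n))\<^sup>2 * bergman_weight p n)" by (simp only: d_def)
    qed
    finally have "of_real (L2_norm_sq p F) = A2_inner p ?g (disk_poly N (\<lambda>n. ?L n * (?L n * taylor_coeff ?g n)))" ..
    also have "\<dots> = A2_inner p (\<lambda>z. defect \<phi> z * f z) (disk_poly N (\<lambda>n. ?L n * (?L n * taylor_coeff ?g n)))"
      by (rule E_bar_A2(2)[OF p \<phi> f disk_poly_A2[OF p]])
    finally have "cmod (of_real (L2_norm_sq p F)) \<le> K * A2_norm p F"
      using A2_inner_defect_euler_le[OF f, of N "\<lambda>n. ?L n * taylor_coeff ?g n"] by (simp only: K_def F_def)
    then have "(A2_norm p F)\<^sup>2 \<le> K * A2_norm p F"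
      by (simp add: A2_norm_squared)
    then have "A2_norm p F \<le> K"
      using K0 by (cases "A2_norm p F = 0") (auto simp: power2_eq_square mult_le_cancel_right less_le)
    then have "(A2_norm p F)\<^sup>2 \<le> K\<^sup>2" by (intro power_mono) auto
    then show ?thesis by (simp add: A2_norm_squared sF)
  qed
  have sm: "summable (\<lambda>n. (real n + p + 2)\<^sup>2 * (cmod (taylor_coeff ?g n))\<^sup>2 * bergman_weight p n)"
    using bergman_weight_pos[OF p] le by (intro summableI_nonneg_bounded[of _ "K\<^sup>2"]) (auto simp: less_imp_le)
  then show g2: "?g \<in> A2 (p - 2)"
    using A2_disk_fun[OF g] by (simp add: A2_minus2_iff[OF p])
  have "(\<lambda>n. (cmod (taylor_coeff (euler_op p ?g) n))\<^sup>2 * bergman_weight p n) sums L2_norm_sq p (euler_op p ?g)"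
    by (rule A2_L2_norm_sq_sums[OF p euler_op_A2(1)[OF p g2]])
  then have "(\<lambda>n. (real n + p + 2)\<^sup>2 * (cmod (taylor_coeff ?g n))\<^sup>2 * bergman_weight p n) sums L2_norm_sq p (euler_op p ?g)"
    unfolding euler_op_A2(2)[OF p g2] norm_mult norm_of_real power_mult_distrib power2_abs .
  then have "L2_norm_sq p (euler_op p ?g) = (\<Sum>n. (real n + p + 2)\<^sup>2 * (cmod (taylor_coeff ?g n))\<^sup>2 * bergman_weight p n)"
    by (rule sums_unique)
  also have "\<dots> \<le> K\<^sup>2" by (rule suminf_le_const[OF sm le])
  finally have "(A2_norm p (euler_op p ?g))\<^sup>2 \<le> K\<^sup>2" by (simp add: A2_norm_squared)
  then show "A2_norm p (euler_op p ?g) \<le> (real J * ((p + 2) * C\<^sup>2)) * A2_norm p f"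
    unfolding K_def[symmetric] using K0 by (rule power2_le_imp_le)
qed

text \<open>Every summand is nonnegative and the one with e_0 already suffices. Because the defect
  carries 1 - |z|^2, only the norm of weight p + 1 is controlled.\<close>

lemma A2_inner_defect_self_ge:
  assumes F: "F \<in> A2 p"
  shows "(p + 1) / (p + 2) * c0 * L2_norm_sq (p + 1) F \<le> Re (A2_inner p (\<lambda>z. defect \<phi> z * F z) F)"
proof -
  have p1: "p + 1 > -1" using p by simp
  have F1: "F \<in> A2 (p + 1)" by (rule A2_subset_plus1[OF p F])
  have diag: "A2_inner p (\<lambda>z. disk_weight z * (e j z * F z)) (\<lambda>z. e j z * F z) = of_real ((p + 1) / (p + 2) * L2_norm_sq (p + 1) (\<lambda>z. e j z * F z))" if "j < J" for j
    using L2_measurable[OF A2_L2[OF p mult_e(1)[OF that p F]]]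
    by (simp only: A2_inner_disk_weight[OF p] A2_inner_self of_real_mult)
  have "(p + 1) / (p + 2) * c0 * L2_norm_sq (p + 1) F \<le> (p + 1) / (p + 2) * L2_norm_sq (p + 1) (\<lambda>z. e 0 z * F z)"
    using norm_mult_e0[OF p1 F1] p by (simp only: mult.assoc) (intro mult_left_mono, auto)
  also have "\<dots> \<le> (\<Sum>j<J. (p + 1) / (p + 2) * L2_norm_sq (p + 1) (\<lambda>z. e j z * F z))"
    using p J by (intro member_le_sum[of 0]) auto
  also have "\<dots> = Re (A2_inner p (\<lambda>z. defect \<phi> z * F z) F)"
    unfolding A2_inner_defect[OF F F] Re_sum by (intro sum.cong refl) (simp only: diag lessThan_iff Re_complex_of_real)
  finally show ?thesis .
qed

text \<open>A Garding-type inequality: the main term with e_0 is coercive in weight p, and the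
  commutator terms carry 1 - |z|^2, so the weaker norm of weight p + 1 dominates them.\<close>

lemma A2_inner_defect_euler_ge:
  fixes N c
  defines "F \<equiv> disk_poly N c"
  shows "(p + 1) * c0 * L2_norm_sq p F - real J * ((p + 1) / (p + 2) * C\<^sup>2) * L2_norm_sq (p + 1) F
    \<le> Re (A2_inner p (\<lambda>z. defect \<phi> z * F z) (disk_poly N (\<lambda>n. of_real (real n + p + 2) * c n)))"
proof -
  have p1: "p + 1 > -1" using p by simp
  have F: "F \<in> A2 p" unfolding F_def by (rule disk_poly_A2[OF p])
  have F1: "F \<in> A2 (p + 1)" by (rule A2_subset_plus1[OF p F])
  define B where "B = (p + 1) / (p + 2) * C\<^sup>2 * L2_norm_sq (p + 1) F"
  have err: "Re (A2_inner p (\<lambda>z. disk_weight z * (e j z * F z)) (\<lambda>z. z * deriv (e j) z * F z)) \<le> B" if j: "j < J" for j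
  proof -
    have "cmod (A2_inner (p + 1) (\<lambda>z. e j z * F z) (\<lambda>z. z * deriv (e j) z * F z))
        \<le> A2_norm (p + 1) (\<lambda>z. e j z * F z) * A2_norm (p + 1) (\<lambda>z. z * deriv (e j) z * F z)"
      by (intro A2_cauchy_schwarz A2_L2[OF p1] mult_e mult_de j p1 F1)
    also have "\<dots> \<le> (C * A2_norm (p + 1) F) * (C * A2_norm (p + 1) F)"
      using C(1) by (intro mult_mono mult_e mult_de j p1 F1) auto
    also have "\<dots> = C\<^sup>2 * L2_norm_sq (p + 1) F"
      unfolding A2_norm_squared[symmetric] by (simp add: power2_eq_square)
    finally have "(p + 1) / (p + 2) * cmod (A2_inner (p + 1) (\<lambda>z. e j z * F z) (\<lambda>z. z * deriv (e j) z * F z)) \<le> (p + 1) / (p + 2) * (C\<^sup>2 * L2_norm_sq (p + 1) F)"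
      using p by (intro mult_left_mono) auto
    moreover have "cmod (A2_inner p (\<lambda>z. disk_weight z * (e j z * F z)) (\<lambda>z. z * deriv (e j) z * F z))
        = (p + 1) / (p + 2) * cmod (A2_inner (p + 1) (\<lambda>z. e j z * F z) (\<lambda>z. z * deriv (e j) z * F z))"
      using p A2_inner_disk_weight[OF p L2_measurable[OF A2_L2[OF p mult_e(1)[OF j p F]]] L2_measurable[OF A2_L2[OF p mult_de(1)[OF j p F]]]]
      by (simp only: norm_mult norm_of_real) simp
    ultimately show ?thesis
      using complex_Re_le_cmod order_trans unfolding B_def mult.assoc by metis
  qed
  have "(p + 1) * c0 * L2_norm_sq p F \<le> (p + 1) * L2_norm_sq p (\<lambda>z. e 0 z * F z)"
    using norm_mult_e0[OF p F] p by (simp only: mult.assoc) (intro mult_left_mono, auto)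
  also have "\<dots> \<le> (\<Sum>j<J. (p + 1) * L2_norm_sq p (\<lambda>z. e j z * F z))"
    using p J by (intro member_le_sum[of 0]) auto
  finally have "(p + 1) * c0 * L2_norm_sq p F - real J * B \<le> (\<Sum>j<J. (p + 1) * L2_norm_sq p (\<lambda>z. e j z * F z)) - (\<Sum>j<J. B)"
    by simp
  also have "\<dots> = (\<Sum>j<J. (p + 1) * L2_norm_sq p (\<lambda>z. e j z * F z) - B)"
    by (rule sum_subtractf[symmetric])
  also have "\<dots> \<le> (\<Sum>j<J. Re (of_real (p + 1) * A2_inner p (\<lambda>z. e j z * F z) (\<lambda>z. e j z * F z)
        - A2_inner p (\<lambda>z. disk_weight z * (e j z * F z)) (\<lambda>z. z * deriv (e j) z * F z)))"
  proof (rule sum_mono)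
    fix j assume "j \<in> {..<J}"
    then have "Re (A2_inner p (\<lambda>z. disk_weight z * (e j z * F z)) (\<lambda>z. z * deriv (e j) z * F z)) \<le> B"
      by (intro err) simp
    then show "(p + 1) * L2_norm_sq p (\<lambda>z. e j z * F z) - B \<le> Re (of_real (p + 1) * A2_inner p (\<lambda>z. e j z * F z) (\<lambda>z. e j z * F z)
        - A2_inner p (\<lambda>z. disk_weight z * (e j z * F z)) (\<lambda>z. z * deriv (e j) z * F z))"
      by (simp only: A2_inner_self of_real_mult[symmetric] minus_complex.simps Re_complex_of_real)
  qed
  also have "\<dots> = Re (A2_inner p (\<lambda>z. defect \<phi> z * F z) (disk_poly N (\<lambda>n. of_real (real n + p + 2) * c n)))"
    unfolding A2_inner_defect_euler[OF F, of N c] Re_sum by (simp only: F_def)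
  finally show ?thesis by (simp only: B_def mult.assoc)
qed

lemma A2_inner_defect_commute:
  "A2_inner p (\<lambda>z. defect \<phi> z * f z) g = cnj (A2_inner p (\<lambda>z. defect \<phi> z * g z) f)"
  by (subst A2_inner_defect_left) (rule A2_inner_commute)

text \<open>The matrix represents E on polynomials of degree below N. Its form is positive there,
  for which coercivity in the weaker norm is enough.\<close>

lemma galerkin_exists:
  "\<exists>c. \<forall>m<N. A2_inner p (\<lambda>z. defect \<phi> z * disk_poly N c z) (monom_fun m) = A2_inner p g (monom_fun m)"
proof -
  let ?G = "\<lambda>m n. A2_inner p (\<lambda>z. defect \<phi> z * monom_fun n z) (monom_fun m)"
  have lin: "(\<Sum>n<N. c n * ?G m n) = A2_inner p (\<lambda>z. defect \<phi> z * disk_poly N c z) (monom_fun m)" for N c m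
  proof -
    have L: "L2 p (\<lambda>z. defect \<phi> z * monom_fun m z)" by (intro L2_defect p \<phi> A2_L2[OF p] monom_A2)
    have "A2_inner p (\<lambda>z. defect \<phi> z * disk_poly N c z) (monom_fun m)
      = cnj (A2_inner p (\<lambda>z. defect \<phi> z * monom_fun m z) (disk_poly N c))"
      by (rule A2_inner_defect_commute)
    also have "\<dots> = (\<Sum>n<N. c n * cnj (A2_inner p (\<lambda>z. defect \<phi> z * monom_fun m z) (monom_fun n)))"
      unfolding A2_inner_poly_right[OF p L] by (simp add: cnj_sum)
    also have "\<dots> = (\<Sum>n<N. c n * ?G m n)"
      by (intro sum.cong refl arg_cong2[where f="(*)"] A2_inner_defect_commute[symmetric])
    finally show ?thesis ..
  qed
  have "\<exists>c. \<forall>m<N. (\<Sum>n<N. c n * ?G m n) = A2_inner p g (monom_fun m)"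
  proof (rule galerkin_solvable)
    fix N and c :: "nat \<Rightarrow> complex" assume "\<exists>n<N. c n \<noteq> 0"
    then obtain n where n: "n < N" "c n \<noteq> 0" by blast
    have p1: "p + 1 > -1" using p by simp
    have F: "disk_poly N c \<in> A2 p" by (rule disk_poly_A2[OF p])
    have "0 < (cmod (c n))\<^sup>2 * bergman_weight (p + 1) n"
      using n bergman_weight_pos[OF p1, of n] by simp
    also have "\<dots> \<le> L2_norm_sq (p + 1) (disk_poly N c)"
      unfolding L2_norm_sq_poly[OF p1] using n bergman_weight_pos[OF p1]
      by (intro member_le_sum) (auto simp: less_imp_le)
    finally have "0 < (p + 1) / (p + 2) * c0 * L2_norm_sq (p + 1) (disk_poly N c)"
      using p c0 by simp
    then have "0 < Re (A2_inner p (\<lambda>z. defect \<phi> z * disk_poly N c z) (disk_poly N c))"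
      using A2_inner_defect_self_ge[OF F] by linarith
    moreover have "(\<Sum>m<N. cnj (c m) * (\<Sum>n<N. c n * ?G m n))
        = A2_inner p (\<lambda>z. defect \<phi> z * disk_poly N c z) (disk_poly N c)"
      unfolding lin by (intro A2_inner_poly_right[symmetric] p L2_defect \<phi> A2_L2[OF p] F)
    ultimately show "(\<Sum>m<N. cnj (c m) * (\<Sum>n<N. c n * ?G m n)) \<noteq> 0" by auto
  qed
  then show ?thesis unfolding lin .
qed

text \<open>Two tests in turn: F itself bounds the norm of weight p + 1 by a constant independent of
  N, and L F then bounds the norm of weight p, with the first bound taking care of the commutator
  terms.\<close>

lemma galerkin_bounded:
  assumes g: "g \<in> A2 (p - 2)"
  shows "\<exists>K. \<forall>N c. (\<forall>m<N. A2_inner p (\<lambda>z. defect \<phi> z * disk_poly N c z) (monom_fun m) = A2_inner p g (monom_fun m))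
     \<longrightarrow> A2_norm p (disk_poly N c) \<le> K"
proof -
  have p1: "p + 1 > -1" using p by simp
  have gp: "g \<in> A2 p" by (rule A2_minus2_subset[OF p g])
  define L where "L = euler_op p g"
  have L: "L \<in> A2 p" "\<And>n. taylor_coeff L n = of_real (real n + p + 2) * taylor_coeff g n"
    unfolding L_def by (rule euler_op_A2[OF p g])+
  \<comment> \<open>The bound from the first test: the pairing of F with g is estimated in weight p
    + 1 through L g, so one power of the norm of F cancels.\<close>
  define S where "S = A2_norm (p + 1) L / (c0 * (p + 1))"
  have S0: "0 \<le> S" using c0 p by (simp add: S_def)
  define b where "b = A2_norm p L"
  define d where "d = real J * ((p + 1) / (p + 2) * C\<^sup>2) * S\<^sup>2"
  define a where "a = (p + 1) * c0"
  have abd: "a > 0" "b \<ge> 0" "d \<ge> 0" using p c0 by (auto simp: a_def b_def d_def)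
  have "A2_norm p (disk_poly N c) \<le> 1 + (b + d) / a"
    if sol: "\<And>m. m < N \<Longrightarrow> A2_inner p (\<lambda>z. defect \<phi> z * disk_poly N c z) (monom_fun m) = A2_inner p g (monom_fun m)" for N c
  proof -
    define F where "F = disk_poly N c"
    have F: "F \<in> A2 p" unfolding F_def by (rule disk_poly_A2[OF p])
    have F1: "F \<in> A2 (p + 1)" by (rule A2_subset_plus1[OF p F])
    \<comment> \<open>The equations for single monomials extend to all polynomials of degree below
      N; these include F and, since L is diagonal, also L F.\<close>
    have test: "A2_inner p (\<lambda>z. defect \<phi> z * F z) (disk_poly N h) = A2_inner p g (disk_poly N h)" for h
      unfolding A2_inner_poly_right[OF p L2_defect[OF p \<phi> A2_L2[OF p F]]] A2_inner_poly_right[OF p A2_L2[OF p gp]]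
      using sol by (intro sum.cong refl) (simp add: F_def)
    define s where "s = A2_norm (p + 1) F"
    have "s \<le> S"
    proof -
      define \<kappa> where "\<kappa> = (p + 1) / (p + 2)"
      have \<kappa>: "\<kappa> > 0" using p by (simp add: \<kappa>_def)
      have "of_real (p + 1) * A2_inner p F g = A2_inner p (\<lambda>z. disk_weight z * F z) L"
        by (rule A2_inner_disk_weight_euler_op[symmetric, OF p F gp L])
      also have "\<dots> = of_real \<kappa> * A2_inner (p + 1) F L"
        unfolding \<kappa>_def by (intro A2_inner_disk_weight p L2_measurable[OF A2_L2[OF p]] F L)
      finally have "cmod (of_real (p + 1) * A2_inner p F g) = cmod (of_real \<kappa> * A2_inner (p + 1) F L)"
        by simp
      then have "(p + 1) * cmod (A2_inner p F g) = \<kappa> * cmod (A2_inner (p + 1) F L)"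
        using p \<kappa> by (simp only: norm_mult norm_of_real abs_of_pos)
      also have "\<dots> \<le> \<kappa> * (s * A2_norm (p + 1) L)"
        using \<kappa> unfolding s_def
        by (intro mult_left_mono A2_cauchy_schwarz A2_L2[OF p1] F1 A2_subset_plus1 p L) auto
      finally have 1: "(p + 1) * cmod (A2_inner p F g) \<le> \<kappa> * (s * A2_norm (p + 1) L)" .
      have "\<kappa> * c0 * s\<^sup>2 \<le> Re (A2_inner p (\<lambda>z. defect \<phi> z * F z) F)"
        unfolding \<kappa>_def s_def A2_norm_squared by (rule A2_inner_defect_self_ge[OF F])
      also have "\<dots> = Re (A2_inner p g F)" using test[of c] by (simp add: F_def)
      also have "\<dots> \<le> cmod (A2_inner p F g)"
        using complex_Re_le_cmod[of "A2_inner p g F"] by (simp add: A2_inner_commute[of p g])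
      finally have "(p + 1) * (\<kappa> * c0 * s\<^sup>2) \<le> (p + 1) * cmod (A2_inner p F g)"
        using p by (intro mult_left_mono) auto
      with 1 have "\<kappa> * (s * (c0 * (p + 1) * s)) \<le> \<kappa> * (s * A2_norm (p + 1) L)"
        by (simp add: power2_eq_square mult_ac)
      then have "s * (c0 * (p + 1) * s) \<le> s * A2_norm (p + 1) L"
        using \<kappa> by simp
      then have "s = 0 \<or> c0 * (p + 1) * s \<le> A2_norm (p + 1) L"
        by (auto simp: mult_le_cancel_left s_def less_le)
      then show ?thesis
        using S0 c0 p by (auto simp: S_def pos_le_divide_eq mult_ac)
    qed
    moreover have "0 \<le> s" by (simp add: s_def)
    ultimately have s2: "L2_norm_sq (p + 1) F \<le> S\<^sup>2"
      unfolding A2_norm_squared[symmetric] s_def by (rule power_mono)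
    define X where "X = A2_norm p F"
    have X0: "X \<ge> 0" by (simp add: X_def)
    have "a * X\<^sup>2 - d \<le> (p + 1) * c0 * L2_norm_sq p F - real J * ((p + 1) / (p + 2) * C\<^sup>2) * L2_norm_sq (p + 1) F"
      unfolding a_def X_def d_def A2_norm_squared using s2 p by (intro diff_left_mono mult_left_mono) auto
    also have "\<dots> \<le> Re (A2_inner p (\<lambda>z. defect \<phi> z * F z) (disk_poly N (\<lambda>n. of_real (real n + p + 2) * c n)))"
      unfolding F_def by (rule A2_inner_defect_euler_ge)
    also have "\<dots> = Re (A2_inner p g (disk_poly N (\<lambda>n. of_real (real n + p + 2) * c n)))"
      by (simp only: test)
    also have "A2_inner p g (disk_poly N (\<lambda>n. of_real (real n + p + 2) * c n)) = A2_inner p L F"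
      unfolding F_def A2_inner_poly_right[OF p A2_L2[OF p gp]] A2_inner_poly_right[OF p A2_L2[OF p L(1)]]
        A2_inner_monom[OF p gp] A2_inner_monom[OF p L(1)] L(2)
      by (intro sum.cong refl) (simp only: complex_cnj_mult complex_cnj_complex_of_real mult_ac)
    also have "Re (A2_inner p L F) \<le> b * X"
      unfolding b_def X_def using A2_cauchy_schwarz[OF A2_L2[OF p L(1)] A2_L2[OF p F]] complex_Re_le_cmod order_trans by blast
    finally have q: "a * X\<^sup>2 \<le> b * X + d" by simp
    \<comment> \<open>Solves a X^2 \<le> b X + d without roots: if X exceeds 1, then d \<le> d X and
      one factor X cancels.\<close>
    have "X \<le> 1 + (b + d) / a"
    proof (cases "X \<le> 1")
      case True
      moreover have "0 \<le> (b + d) / a" using abd by simp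
      ultimately show ?thesis by linarith
    next
      case False
      then have "d * 1 \<le> d * X" using abd by (intro mult_left_mono) auto
      then have "(a * X) * X \<le> (b + d) * X" using q by (simp add: power2_eq_square algebra_simps)
      then have "a * X \<le> b + d" using False by simp
      then have "X \<le> (b + d) / a" using abd by (simp add: pos_le_divide_eq mult.commute)
      then show ?thesis by simp
    qed
    then show ?thesis by (simp add: X_def F_def)
  qed
  then show ?thesis by (intro exI[of _ "1 + (b + d) / a"]) blast
qed

lemma E_bar_surj:
  assumes g: "g \<in> A2 (p - 2)"
  shows "\<exists>f\<in>A2 p. E_bar_op p \<phi> f = g"
proof -
  have gp: "g \<in> A2 p" by (rule A2_minus2_subset[OF p g])
  obtain c where c: "\<And>N m. m < N \<Longrightarrow> A2_inner p (\<lambda>z. defect \<phi> z * disk_poly N (c N) z) (monom_fun m) = A2_inner p g (monom_fun m)"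
    using galerkin_exists[of _ g] by metis
  obtain K where "\<forall>N c. (\<forall>m<N. A2_inner p (\<lambda>z. defect \<phi> z * disk_poly N c z) (monom_fun m) = A2_inner p g (monom_fun m))
     \<longrightarrow> A2_norm p (disk_poly N c) \<le> K"
    using galerkin_bounded[OF g] by (rule exE)
  then have K: "A2_norm p (disk_poly N (c N)) \<le> K" for N using c by simp
  define F where "F N = disk_poly N (c N)" for N
  have F: "F N \<in> A2 p" "A2_norm p (F N) \<le> K" for N unfolding F_def by (rule disk_poly_A2[OF p], rule K)
  obtain r f where rf: "strict_mono (r :: nat \<Rightarrow> nat)" "f \<in> A2 p" "A2_norm p f \<le> K" "\<And>n. (\<lambda>j. taylor_coeff (F (r j)) n) \<longlonglongrightarrow> taylor_coeff f n"
    by (rule A2_bounded_subsequence[of p F K, OF p F], rule that)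
  have "taylor_coeff (E_bar_op p \<phi> f) m = taylor_coeff g m" for m
  proof -
    let ?m = "monom_fun m"
    have m: "?m \<in> A2 p" by (rule monom_A2[OF p])
    let ?v = "\<lambda>z. defect \<phi> z * ?m z"
    have Em: "E_bar_op p \<phi> ?m \<in> A2 p" by (rule E_bar_A2(1)[OF p \<phi> m])
    \<comment> \<open>E is symmetric, so it can be moved to the fixed monomial; weak convergence of
      the Galerkin solutions then suffices.\<close>
    have swap: "A2_inner p (\<lambda>z. defect \<phi> z * h z) ?m = cnj (A2_inner p (E_bar_op p \<phi> ?m) h)" if "h \<in> A2 p" for h
      unfolding A2_inner_defect_left E_bar_A2(2)[OF p \<phi> m that] A2_inner_commute[of p h] A2_inner_defect_left ..
    have "(\<lambda>j. A2_inner p (E_bar_op p \<phi> ?m) (\<lambda>z. F (r j) z - f z)) \<longlonglongrightarrow> 0"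
    proof (rule A2_weakly_null[where C="K + K", OF p Em])
      show "(\<lambda>z. F (r j) z - f z) \<in> A2 p" for j by (intro A2_diff p F rf)
      show "A2_norm p (\<lambda>z. F (r j) z - f z) \<le> K + K" for j
      proof -
        have "A2_norm p (\<lambda>z. F (r j) z + (-1) * f z) \<le> A2_norm p (F (r j)) + A2_norm p (\<lambda>z. (-1) * f z)"
          by (intro A2_norm_triangle A2_L2[OF p] A2_scale p F rf)
        also have "\<dots> \<le> K + K" unfolding A2_norm_scale using F(2)[of "r j"] rf(3) by simp
        finally show ?thesis by simp
      qed
      show "(\<lambda>j. taylor_coeff (\<lambda>z. F (r j) z - f z) n) \<longlonglongrightarrow> 0" for n
        unfolding taylor_coeff_diff[OF A2_disk_fun[OF F(1)] A2_disk_fun[OF rf(2)]]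
        using tendsto_diff[OF rf(4)[of n] tendsto_const[of "taylor_coeff f n"]] by simp
    qed
    moreover have "A2_inner p (E_bar_op p \<phi> ?m) (\<lambda>z. F (r j) z - f z) = A2_inner p (E_bar_op p \<phi> ?m) (F (r j)) - A2_inner p (E_bar_op p \<phi> ?m) f" for j
      by (intro A2_inner_diff_right A2_L2[OF p] F rf Em)
    ultimately have "(\<lambda>j. A2_inner p (E_bar_op p \<phi> ?m) (F (r j)) - A2_inner p (E_bar_op p \<phi> ?m) f) \<longlonglongrightarrow> 0"
      by simp
    then have lim: "(\<lambda>j. A2_inner p (E_bar_op p \<phi> ?m) (F (r j))) \<longlonglongrightarrow> A2_inner p (E_bar_op p \<phi> ?m) f"
      by (rule LIM_zero_cancel)
    \<comment> \<open>The m-th equation is imposed only on solutions of index greater than m, and r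
      j \<ge> j ensures this.\<close>
    have "A2_inner p (E_bar_op p \<phi> ?m) (F (r j)) = cnj (A2_inner p g ?m)" if "j \<ge> Suc m" for j
    proof -
      have "m < r j" using seq_suble[OF rf(1), of j] that by simp
      from c[OF this] have "A2_inner p (\<lambda>z. defect \<phi> z * F (r j) z) ?m = A2_inner p g ?m"
        by (simp add: F_def)
      then show ?thesis unfolding swap[OF F(1)] by (metis complex_cnj_cnj)
    qed
    then have "(\<lambda>j. A2_inner p (E_bar_op p \<phi> ?m) (F (r j))) \<longlonglongrightarrow> cnj (A2_inner p g ?m)"
      by (intro tendsto_eventually eventually_sequentiallyI[of "Suc m"])
    with lim have "A2_inner p (E_bar_op p \<phi> ?m) f = cnj (A2_inner p g ?m)"
      using LIMSEQ_unique by blast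
    then have "A2_inner p (\<lambda>z. defect \<phi> z * f z) ?m = A2_inner p g ?m"
      unfolding swap[OF rf(2)] by simp
    then have "taylor_coeff (E_bar_op p \<phi> f) m * of_real (bergman_weight p m) = taylor_coeff g m * of_real (bergman_weight p m)"
      using taylor_coeff_E_bar[OF p \<phi> rf(2), of m] A2_inner_monom[OF p gp, of m] by simp
    then show ?thesis using bergman_weight_pos[OF p, of m] by simp
  qed
  then have "E_bar_op p \<phi> f = g"
    by (intro A2_eqI[where p=p] E_bar_A2(1)[OF p \<phi>] rf gp)
  with rf(2) show ?thesis by blast
qed

lemma E_bar_range_eq: "E_bar_op p \<phi> ` A2 p = A2 (p - 2)"
  using E_bar_range(1) E_bar_surj by blast

text \<open>Since L E is bounded, E maps the unit ball into the image of a ball under the inverse of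
  L. That image is compact: bounded sequences have weakly convergent subsequences, which the inverse
  of L turns into norm convergent ones.\<close>

lemma E_bar_compact: "A2_compact_operator p (E_bar_op p \<phi>)"
proof -
  interpret Metric_space "A2 p" "\<lambda>f g. A2_norm p (\<lambda>z. f z - g z)" by (rule Metric_space_A2[OF p])
  define K where "K = real J * ((p + 2) * C\<^sup>2)"
  have K0: "K \<ge> 0" using p by (simp add: K_def)
  \<comment> \<open>Taken with the closed ball of radius K, so that weak limits stay inside and the
    image is compact itself, hence closed; it then contains the closure required by the definition
    of a compact operator.\<close>
  let ?T = "euler_inverse p ` {h \<in> A2 p. A2_norm p h \<le> K}"
  have T: "?T \<subseteq> A2 p" using euler_inverse_A2(1)[OF p] by auto
  have cpt: "compactin mtopology ?T"
    unfolding compactin_sequentially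
  proof (intro conjI T allI impI)
    fix \<sigma> :: "nat \<Rightarrow> complex \<Rightarrow> complex" assume "range \<sigma> \<subseteq> ?T"
    then have "\<exists>h. h \<in> A2 p \<and> A2_norm p h \<le> K \<and> \<sigma> j = euler_inverse p h" for j by blast
    then obtain h where h: "\<And>j. h j \<in> A2 p" "\<And>j. A2_norm p (h j) \<le> K" "\<And>j. \<sigma> j = euler_inverse p (h j)" by metis
    obtain r f where rf: "strict_mono (r :: nat \<Rightarrow> nat)" "f \<in> A2 p" "A2_norm p f \<le> K" "\<And>n. (\<lambda>j. taylor_coeff (h (r j)) n) \<longlonglongrightarrow> taylor_coeff f n"
      by (rule A2_bounded_subsequence[of p h K, OF p h(1,2)], rule that)
    have hf: "(\<lambda>z. h (r j) z - f z) \<in> A2 p" for j by (intro A2_diff p h rf)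
    have "(\<lambda>j. A2_norm p (euler_inverse p (\<lambda>z. h (r j) z - f z))) \<longlonglongrightarrow> 0"
    proof (rule euler_inverse_weakly_null[where C="(K + K)\<^sup>2", OF p hf])
      show "L2_norm_sq p (\<lambda>z. h (r j) z - f z) \<le> (K + K)\<^sup>2" for j
      proof -
        have "A2_norm p (\<lambda>z. h (r j) z + (-1) * f z) \<le> A2_norm p (h (r j)) + A2_norm p (\<lambda>z. (-1) * f z)"
          by (intro A2_norm_triangle A2_L2[OF p] A2_scale p h rf)
        also have "\<dots> \<le> K + K" unfolding A2_norm_scale using h(2)[of "r j"] rf(3) by simp
        finally have "A2_norm p (\<lambda>z. h (r j) z - f z) \<le> K + K" by simp
        then show ?thesis unfolding A2_norm_squared[symmetric] by (intro power_mono) auto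
      qed
      show "(\<lambda>j. taylor_coeff (\<lambda>z. h (r j) z - f z) n) \<longlonglongrightarrow> 0" for n
        unfolding taylor_coeff_diff[OF A2_disk_fun[OF h(1)] A2_disk_fun[OF rf(2)]]
        using tendsto_diff[OF rf(4)[of n] tendsto_const[of "taylor_coeff f n"]] by simp
    qed
    moreover have "euler_inverse p (\<lambda>z. h (r j) z - f z) = (\<lambda>z. \<sigma> (r j) z - euler_inverse p f z)" for j
      unfolding h(3)
    proof (rule A2_eqI[where p=p])
      fix n
      show "taylor_coeff (euler_inverse p (\<lambda>z. h (r j) z - f z)) n = taylor_coeff (\<lambda>z. euler_inverse p (h (r j)) z - euler_inverse p f z) n"
        unfolding euler_inverse_A2(2)[OF p hf] taylor_coeff_diff[OF A2_disk_fun[OF euler_inverse_A2(1)[OF p h(1)]] A2_disk_fun[OF euler_inverse_A2(1)[OF p rf(2)]]]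
          euler_inverse_A2(2)[OF p h(1)] euler_inverse_A2(2)[OF p rf(2)] taylor_coeff_diff[OF A2_disk_fun[OF h(1)] A2_disk_fun[OF rf(2)]]
        by (rule diff_divide_distrib)
    qed (intro A2_diff euler_inverse_A2 p hf h rf)+
    ultimately have lim: "(\<lambda>j. A2_norm p (\<lambda>z. \<sigma> (r j) z - euler_inverse p f z)) \<longlonglongrightarrow> 0" by simp
    have "limitin mtopology (\<sigma> \<circ> r) (euler_inverse p f) sequentially"
      unfolding limitin_metric
    proof (intro conjI allI impI)
      show "euler_inverse p f \<in> A2 p" by (rule euler_inverse_A2(1)[OF p rf(2)])
      fix e :: real assume "e > 0"
      with lim have "\<forall>\<^sub>F j in sequentially. A2_norm p (\<lambda>z. \<sigma> (r j) z - euler_inverse p f z) < e"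
        by (rule order_tendstoD(2))
      then show "\<forall>\<^sub>F j in sequentially. (\<sigma> \<circ> r) j \<in> A2 p \<and> A2_norm p (\<lambda>z. (\<sigma> \<circ> r) j z - euler_inverse p f z) < e"
        by (rule eventually_mono) (use euler_inverse_A2(1)[OF p h(1)] h(3) in auto)
    qed
    moreover have "euler_inverse p f \<in> ?T" using rf by blast
    ultimately show "\<exists>l r. l \<in> ?T \<and> strict_mono r \<and> limitin mtopology (\<sigma> \<circ> r) l sequentially"
      using rf(1) by blast
  qed
  have sub: "E_bar_op p \<phi> ` {f \<in> A2 p. A2_norm p f \<le> 1} \<subseteq> ?T"
  proof (rule image_subsetI)
    fix f assume "f \<in> {f \<in> A2 p. A2_norm p f \<le> 1}"
    then have f: "f \<in> A2 p" "A2_norm p f \<le> 1" by auto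
    let ?g = "E_bar_op p \<phi> f"
    note R = E_bar_range[OF f(1)]
    have "A2_norm p (euler_op p ?g) \<le> K * 1"
      using R(2) f(2) K0 by (intro order_trans[OF R(2)[folded K_def]] mult_left_mono) auto
    moreover have L: "euler_op p ?g \<in> A2 p" by (rule euler_op_A2(1)[OF p R(1)])
    moreover have "?g = euler_inverse p (euler_op p ?g)"
    proof (rule A2_eqI[where p=p])
      show "?g \<in> A2 p" by (rule E_bar_A2(1)[OF p \<phi> f(1)])
      show "euler_inverse p (euler_op p ?g) \<in> A2 p" by (rule euler_inverse_A2(1)[OF p L])
      fix n
      have "complex_of_real (real n + p + 2) \<noteq> 0" using p by (simp only: of_real_eq_0_iff)
      then show "taylor_coeff ?g n = taylor_coeff (euler_inverse p (euler_op p ?g)) n"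
        unfolding euler_inverse_A2(2)[OF p L] euler_op_A2(2)[OF p R(1)] by (rule nonzero_mult_div_cancel_left[symmetric])
    qed
    ultimately show "?g \<in> ?T" by auto
  qed
  have "closedin mtopology ?T"
    by (rule compactin_imp_closedin[OF Hausdorff_space_mtopology cpt])
  then have "mtopology closure_of (E_bar_op p \<phi> ` {f \<in> A2 p. A2_norm p f \<le> 1}) \<subseteq> ?T"
    by (intro closure_of_minimal sub)
  then have "compactin mtopology (mtopology closure_of (E_bar_op p \<phi> ` {f \<in> A2 p. A2_norm p f \<le> 1}))"
    by (rule closed_compactin[OF cpt]) simp
  then show ?thesis
    using E_bar_A2(1)[OF p \<phi>] by (auto simp: A2_compact_operator_def A2_topology_def)
qed

end

section \<open>Blaschke products and the equivalence\<close>

lemma Blaschke_decomposed_defect: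
  assumes p: "p > -1" and \<phi>: "\<phi> \<in> Hinf1" and B: "finite_Blaschke_product \<phi>"
    and nc: "\<not> (\<exists>c. cmod c = 1 \<and> (\<forall>z\<in>unit_disk. \<phi> z = c))"
  shows "\<exists>J e c0 C. decomposed_defect p \<phi> J e c0 C"
proof -
  obtain c as where c: "cmod c = 1" and as: "set as \<subseteq> unit_disk"
    and eq: "\<And>z. z \<in> unit_disk \<Longrightarrow> \<phi> z = c * blaschke_prod as z"
    using B unfolding finite_Blaschke_product_iff by blast
  \<comment> \<open>An empty product would make \<phi> a unimodular constant, and there would be no
    e_0 to provide coercivity.\<close>
  have ne: "as \<noteq> []"
  proof
    assume "as = []"
    then have "\<forall>z\<in>unit_disk. \<phi> z = c" using eq by simp
    with c nc show False by blast
  qed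
  obtain e where e: "(\<forall>j<length as. analytic_closed_disk (e j)) \<and>
     (\<forall>z\<in>unit_disk. 1 - (cmod (blaschke_prod as z))\<^sup>2 = (1 - (cmod z)\<^sup>2) * (\<Sum>j<length as. (cmod (e j z))\<^sup>2)) \<and>
     (as \<noteq> [] \<longrightarrow> (\<exists>c>0. \<forall>z\<in>unit_disk. c \<le> (cmod (e 0 z))\<^sup>2))"
    using blaschke_prod_defect[OF as] by blast
  then obtain c0 where c0: "c0 > 0" "\<And>z. z \<in> unit_disk \<Longrightarrow> c0 \<le> (cmod (e 0 z))\<^sup>2" using ne by blast
  have "\<exists>C. j < length as \<longrightarrow> 0 < C \<and> e j holomorphic_on unit_disk \<and> (\<forall>z\<in>unit_disk. cmod (e j z) \<le> C \<and> cmod (deriv (e j) z) \<le> C)" for j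
  proof (cases "j < length as")
    case True
    then have "analytic_closed_disk (e j)" using e by blast
    then show ?thesis by (rule analytic_closed_disk_bounds) blast
  qed simp
  then obtain K where K: "\<And>j. j < length as \<Longrightarrow> 0 < K j" "\<And>j. j < length as \<Longrightarrow> e j holomorphic_on unit_disk"
     "\<And>j z. j < length as \<Longrightarrow> z \<in> unit_disk \<Longrightarrow> cmod (e j z) \<le> K j" "\<And>j z. j < length as \<Longrightarrow> z \<in> unit_disk \<Longrightarrow> cmod (deriv (e j) z) \<le> K j"
    by metis
  define C where "C = (\<Sum>j<length as. K j)"
  have KC: "K j \<le> C" if "j < length as" for j
    unfolding C_def using that K(1) by (intro member_le_sum) (auto simp: less_imp_le)
  have "decomposed_defect p \<phi> (length as) e c0 C"
  proof
    show "0 < length as" using ne by simp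
    then show "0 < C" using K(1)[of 0] KC[of 0] by linarith
    fix z :: complex assume z: "z \<in> unit_disk"
    show "1 - (cmod (\<phi> z))\<^sup>2 = (1 - (cmod z)\<^sup>2) * (\<Sum>j<length as. (cmod (e j z))\<^sup>2)"
      using e z c by (simp add: eq[OF z] norm_mult)
    show "c0 \<le> (cmod (e 0 z))\<^sup>2" by (rule c0(2)[OF z])
    fix j assume j: "j < length as"
    show "cmod (e j z) \<le> C" "cmod (deriv (e j) z) \<le> C"
      using K(3,4)[OF j z] KC[OF j] by linarith+
  qed (use p \<phi> K(2) c0(1) in auto)
  then show ?thesis by blast
qed

text \<open>Unimodular constants are excluded because they make E vanish: then E is compact and its
  range is contained in \<open>A2 (\<alpha> - 2)\<close>, but the range {0} is not equal to that
  space, which contains all polynomials extended by 0.\<close>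

theorem theorem16:
  fixes \<alpha> :: real and \<phi> :: "complex \<Rightarrow> complex"
  assumes "\<alpha> > -1"
    and "\<phi> \<in> Hinf1"
    and not_unimodular_const: "\<not> (\<exists>c. cmod c = 1 \<and> (\<forall>z\<in>unit_disk. \<phi> z = c))"
  shows "(A2_compact_operator \<alpha> (E_bar_op \<alpha> \<phi>) \<longleftrightarrow> finite_Blaschke_product \<phi>) \<and>
         (finite_Blaschke_product \<phi> \<longleftrightarrow> E_bar_op \<alpha> \<phi> ` A2 \<alpha> = A2 (\<alpha> - 2)) \<and>
         (E_bar_op \<alpha> \<phi> ` A2 \<alpha> = A2 (\<alpha> - 2) \<longleftrightarrow> E_bar_op \<alpha> \<phi> ` A2 \<alpha> \<subseteq> A2 (\<alpha> - 2))"
proof -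
  have "A2_compact_operator \<alpha> (E_bar_op \<alpha> \<phi>) \<and> E_bar_op \<alpha> \<phi> ` A2 \<alpha> = A2 (\<alpha> - 2)"
    if B: "finite_Blaschke_product \<phi>"
  proof -
    obtain J e c0 C where "decomposed_defect \<alpha> \<phi> J e c0 C"
      using Blaschke_decomposed_defect[OF assms(1,2) B not_unimodular_const] by blast
    then show ?thesis
      using decomposed_defect.E_bar_compact decomposed_defect.E_bar_range_eq by blast
  qed
  moreover have "finite_Blaschke_product \<phi>" if "A2_compact_operator \<alpha> (E_bar_op \<alpha> \<phi>)"
    using compact_imp_Blaschke[OF assms(1,2) that] .
  moreover have "finite_Blaschke_product \<phi>" if "E_bar_op \<alpha> \<phi> ` A2 \<alpha> \<subseteq> A2 (\<alpha> - 2)"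
    using range_subset_imp_Blaschke[OF assms(1,2) that] .
  ultimately show ?thesis by blast
qed

end
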